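(* Let $X=(X_{ij})_{1\le i,j\le n}$ be a collection of jointly gaussian random variables with mean zero and $n^2\times n^2$ covariance matrix $\Sigma$, and let $A=n^{-1/2}(X_{ij})_{1\le i,j\le n}$ (not necessarily symmetric). Let $f(z)=\sum_{m=0}^\infty b_mz^m$ be an entire function and let $f_1(z)=\sum_{m=1}^\infty m|b_m|z^{m-1}$, $f_2(z)=\sum_{m=2}^\infty m(m-1)|b_m|z^{m-2}$. Let $\lambda$ denote the operator norm of $A$, and let $a=(\mathbb{E}f_1(\lambda)^4)^{1/4}$ and $b=(\mathbb{E}f_2(\lambda)^4)^{1/4}$. Suppose $W=\operatorname{Re}\operatorname{Tr}f(A)$ has finite fourth moment and let $\sigma^2=\mathrm{Var}(W)$. Let $Z$ be a normal random variable with the same mean and variance as $W$. Then $$d_{TV}(W,Z)\le\frac{2\sqrt5\,\|\Sigma\|^{3/2}ab}{\sigma^2n}.$$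
   Context: $d_{TV}(W,Z)=\sup_B|\mathbb{P}(W\in B)-\mathbb{P}(Z\in B)|$ over Borel sets $B$. $\|\Sigma\|$ is the operator norm of $\Sigma$ (induced by the Euclidean norm). *)

theory Defs
  imports "HOL-Probability.Probability" "HOL-Complex_Analysis.Complex_Analysis"
begin

(* Constants count as (degenerate) normal variables: the covariance matrix of a
   jointly gaussian family may be singular. *)
definition gaussian_rv :: "'w measure \<Rightarrow> ('w \<Rightarrow> real) \<Rightarrow> bool" where
  "gaussian_rv M Y \<longleftrightarrow> Y \<in> borel_measurable M \<and>
     ((\<exists>\<mu> \<sigma>. \<sigma> > 0 \<and> distributed M lborel Y (\<lambda>x. ennreal (normal_density \<mu> \<sigma> x))) \<or>
      (\<exists>\<mu>. AE \<omega> in M. Y \<omega> = \<mu>))"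

definition jointly_gaussian :: "'w measure \<Rightarrow> ('i::finite \<Rightarrow> 'w \<Rightarrow> real) \<Rightarrow> bool" where
  "jointly_gaussian M Y \<longleftrightarrow> (\<forall>c :: 'i \<Rightarrow> real. gaussian_rv M (\<lambda>\<omega>. \<Sum>p\<in>UNIV. c p * Y p \<omega>))"

definition covariance :: "'w measure \<Rightarrow> ('w \<Rightarrow> real) \<Rightarrow> ('w \<Rightarrow> real) \<Rightarrow> real" where
  "covariance M U V =
     integral\<^sup>L M (\<lambda>\<omega>. (U \<omega> - integral\<^sup>L M U) * (V \<omega> - integral\<^sup>L M V))"

(* The two variables may live on different probability spaces. *)
definition tv_dist :: "'w measure \<Rightarrow> ('w \<Rightarrow> real) \<Rightarrow> 'v measure \<Rightarrow> ('v \<Rightarrow> real) \<Rightarrow> real" where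
  "tv_dist M W N Z =
     (SUP B\<in>sets (borel :: real measure).
        \<bar>measure M (W -` B \<inter> space M) - measure N (Z -` B \<inter> space N)\<bar>)"

(* The norm on vectors is the Euclidean one, so this is the l2 operator norm. *)
definition matrix_onorm :: "real^'m^'m \<Rightarrow> real" where
  "matrix_onorm A = onorm (\<lambda>v. A *v v)"

(* Multiplication and power of the vector type act componentwise, hence the
   separate power for matrix multiplication. *)
primrec matrix_pow :: "('a::semiring_1)^'m^'m \<Rightarrow> nat \<Rightarrow> 'a^'m^'m" where
  "matrix_pow A 0 = mat 1"
| "matrix_pow A (Suc k) = A ** matrix_pow A k"

(* f(A) for f(z) = sum of b m * z ^ m; the matrix series is summed entrywise. *)
definition matrix_power_series :: "(nat \<Rightarrow> complex) \<Rightarrow> complex^'m^'m \<Rightarrow> complex^'m^'m" where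
  "matrix_power_series b A = (\<chi> i j. \<Sum>m. b m * matrix_pow A m $ i $ j)"

definition complex_matrix :: "real^'m^'m \<Rightarrow> complex^'m^'m" where
  "complex_matrix A = (\<chi> i j. complex_of_real (A $ i $ j))"

(* The terms m = 0, respectively m = 0 and m = 1, have coefficient 0, so the truncated
   exponents of these terms are immaterial. *)
definition abs_series_d1 :: "(nat \<Rightarrow> complex) \<Rightarrow> real \<Rightarrow> real" where
  "abs_series_d1 b x = (\<Sum>m. real m * cmod (b m) * x ^ (m - 1))"

definition abs_series_d2 :: "(nat \<Rightarrow> complex) \<Rightarrow> real \<Rightarrow> real" where
  "abs_series_d2 b x = (\<Sum>m. real m * (real m - 1) * cmod (b m) * x ^ (m - 2))"

(* The fourth root of E Y^4, with value infinity when the fourth moment is infinite. *)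
definition L4_norm :: "'w measure \<Rightarrow> ('w \<Rightarrow> real) \<Rightarrow> ennreal" where
  "L4_norm M Y =
     (let I = (\<integral>\<^sup>+ \<omega>. ennreal (Y \<omega> ^ 4) \<partial>M)
      in if I = \<infinity> then \<infinity> else ennreal (root 4 (enn2real I)))"

end

theory Submission
  imports Defs
begin

text \<open>If \<open>x\<close>, \<open>y\<close> are independent copies of a centred gaussian vector, then the law of \<open>(x, y)\<close> is
  invariant under the rotations \<open>(x, y) \<mapsto> (x cos t + y sin t, y cos t - x sin t)\<close>, and together with
  the finiteness of all moments this is all that is used about gaussian vectors. Differentiating in \<open>t\<close> gives integration by parts; with \<open>S\<close> the covariance
  operator and \<open>x_t = x cos t + y sin t\<close>, integrating over \<open>0 \<le> t \<le> \<pi>/2\<close> gives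
  \<open>Cov(p(x), q(x)) = \<integral> sin t E[\<nabla>p(x) \<bullet> S \<nabla>q(x_t)] dt\<close>, hence the Poincare inequality.

  For \<open>p = \<phi> \<circ> g\<close> and \<open>q = g\<close> the formula reads \<open>E[(g - E g) \<phi>(g)] = \<integral> sin t E[\<phi>'(g(x)) \<tau>_t(x, y)] dt\<close> with
  \<open>\<tau>_t(x, y) = \<nabla>g(x) \<bullet> S \<nabla>g(x_t)\<close>. The Poincare inequality in \<open>x\<close>, for each fixed \<open>y\<close> and \<open>t\<close>, shows that
  \<open>\<tau>_t\<close> is almost independent of \<open>x\<close>, so that the right-hand side is close to \<open>Var(g) E[\<phi>'(g)]\<close>; Stein's
  equation turns this into a bound on the total variation distance. Fixing \<open>y\<close> and \<open>t\<close> avoids differentiating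
  under an integral. The resulting constant is 4, which is at most \<open>2 \<surd>5\<close>.

  For \<open>g(A) = Re Tr f(A)\<close> with \<open>f\<close> a polynomial, the gradient is bounded by \<open>\<surd>n f\<^sub>1(\<lambda>)\<close> and the Hessian
  by \<open>f\<^sub>2(\<lambda>)\<close>; these bounds are monotone under truncation of the power series, so entire functions follow by
  dominated convergence.\<close>

section \<open>Uniqueness of characteristic functions\<close>

text \<open>The covariance may be singular, so no density on the matrix space is available.
  Invariance of the product law under rotations takes its place, and characteristic functions serve
  only to establish it. The constant 4 is 2 times 2. One factor bounds \<open>\<phi>'\<close>,
  because both h - Nh and w * \<phi>(w) are at most 1 in absolute value. The other comes from the
  two product rule terms in the gradient of \<open>\<tau>\<close>. The weight sin t has mass 1 on
  [0, pi/2] and adds nothing. The power of n: the entries of A have covariance \<Sigma>/n, so s =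
  |\<Sigma>|/n. One factor s comes from \<open>\<tau>\<close> itself and a further sqrt s from the
  Poincare inequality. With the sqrt n of the gradient this makes |\<Sigma>|^(3/2) / n. Test
  functions are taken continuous, which makes the Stein solution continuously differentiable;
  regularity of Borel measures then reaches all Borel sets without loss. As a and b may be infinite
  or zero and the variance may vanish, the expressions 0 * infinity and 0 / 0 have to be dealt with
  by the case distinctions at the end.\<close>

lemma tendsto_infdist_bump:
  fixes C :: "'a::metric_space set"
  assumes "closed C" "C \<noteq> {}"
  shows "(\<lambda>n. max 0 (1 - real n * infdist x C)) \<longlonglongrightarrow> indicator C x"
proof (cases "x \<in> C")
  case True
  then show ?thesis by simp
next
  case False
  then have pos: "infdist x C > 0"
    using assms by (simp add: infdist_pos_not_in_closed)
  have "eventually (\<lambda>n. real n * infdist x C \<ge> 1) sequentially"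
  proof -
    obtain n0 :: nat where "1 / infdist x C \<le> real n0" using real_arch_simple by blast
    then show ?thesis
      using pos by (intro eventually_sequentiallyI[of n0])
        (smt (verit, ccfv_SIG) divide_le_eq mult_right_mono of_nat_mono)
  qed
  then have "eventually (\<lambda>n. max 0 (1 - real n * infdist x C) = indicator C x) sequentially"
    by eventually_elim (use False in auto)
  then show ?thesis by (rule tendsto_eventually)
qed

text \<open>The bumps \<open>max 0 (1 - real n * infdist x C)\<close> converge to the indicator of a
  closed set, and inner regularity by compact sets carries the bound over to Borel sets. It serves
  twice: with \<open>D = 0\<close> for the uniqueness of characteristic functions, and for the total
  variation distance.\<close>

lemma measure_diff_le_continuous:
  fixes P Q :: "'a::{second_countable_topology, complete_space} measure"
  assumes P: "prob_space P" "sets P = sets borel" and Q: "prob_space Q" "sets Q = sets borel"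
    and h: "\<And>h::'a \<Rightarrow> real. continuous_on UNIV h \<Longrightarrow> (\<And>x. 0 \<le> h x) \<Longrightarrow> (\<And>x. h x \<le> 1)
        \<Longrightarrow> integral\<^sup>L P h - integral\<^sup>L Q h \<le> D"
    and B: "B \<in> sets borel"
  shows "\<bar>measure P B - measure Q B\<bar> \<le> D"
proof -
  interpret P: prob_space P by fact
  interpret Q: prob_space Q by fact
  have D0: "0 \<le> D" using h[of "\<lambda>_. 0"] by simp
  have closed: "measure P C - measure Q C \<le> D" if C: "closed C" for C
  proof (cases "C = {}")
    case True then show ?thesis using D0 by simp
  next
    case False
    let ?h = "\<lambda>n x. max 0 (1 - real n * infdist x C)"
    have lim: "(\<lambda>n. integral\<^sup>L R (?h n)) \<longlonglongrightarrow> measure R C"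
      if R: "prob_space R" "sets R = sets borel" for R :: "'a measure"
    proof -
      interpret R: prob_space R by fact
      have Cs: "C \<in> sets R" using C R(2) by auto
      have "(\<lambda>n. integral\<^sup>L R (?h n)) \<longlonglongrightarrow> integral\<^sup>L R (indicator C)"
      proof (rule integral_dominated_convergence[where w="\<lambda>_. 1"])
        show "AE x in R. (\<lambda>n. ?h n x) \<longlonglongrightarrow> indicator C x"
          using tendsto_infdist_bump[OF C False] by simp
        show "AE x in R. norm (?h n x) \<le> 1" for n
          by (auto simp: infdist_nonneg)
        show "?h n \<in> borel_measurable R" for n
          unfolding measurable_cong_sets[OF R(2) refl]
          by (intro borel_measurable_continuous_onI continuous_intros)
      qed (use Cs in auto)
      then show ?thesis
        using Cs R(2) by (simp add: sets_eq_imp_space_eq)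
    qed
    have "integral\<^sup>L P (?h n) - integral\<^sup>L Q (?h n) \<le> D" for n
      by (rule h) (auto intro!: continuous_intros simp: infdist_nonneg)
    moreover have "(\<lambda>n. integral\<^sup>L P (?h n) - integral\<^sup>L Q (?h n)) \<longlonglongrightarrow> measure P C - measure Q C"
      by (intro tendsto_diff lim P Q)
    ultimately show ?thesis
      by (intro LIMSEQ_le_const2) auto
  qed
  have one: "measure P B - measure Q B \<le> D" if B: "B \<in> sets borel" for B
  proof (rule field_le_epsilon)
    fix e :: real assume e: "0 < e"
    have "emeasure P B = (SUP K \<in> {K. K \<subseteq> B \<and> compact K}. emeasure P K)"
      using P(2) B by (intro inner_regular) auto
    moreover have "emeasure P B < emeasure P B + ennreal e"
      using e by (simp add: P.emeasure_eq_measure ennreal_less_iff flip: ennreal_plus)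
    ultimately have "\<exists>K \<in> {K. K \<subseteq> B \<and> compact K}. emeasure P B < emeasure P K + ennreal e"
      by (metis (no_types, lifting) e ennreal_SUP_add_left ennreal_neq_top empty_subsetI compact_empty less_SUP_iff mem_Collect_eq empty_iff)
    then obtain K where K: "K \<subseteq> B" "compact K" "emeasure P B < emeasure P K + ennreal e" by auto
    then have "measure P B \<le> measure P K + e"
      using e by (simp add: P.emeasure_eq_measure ennreal_less_iff flip: ennreal_plus)
    moreover have "measure Q K \<le> measure Q B"
      using K B Q(2) by (intro Q.finite_measure_mono) auto
    moreover have "measure P K - measure Q K \<le> D"
      using closed K compact_imp_closed by blast
    ultimately show "measure P B - measure Q B \<le> D + e" by linarith
  qed
  \<comment> \<open>Complements supply the reverse inequality, so the hypothesis on \<open>h\<close>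
    can stay one-sided.\<close>
  have "measure P (-B) - measure Q (-B) \<le> D" using B by (intro one) auto
  moreover have "measure R (-B) = 1 - measure R B"
    if "prob_space R" "sets R = sets borel" for R :: "'a measure"
    using prob_space.prob_compl[OF that(1), of B] B that(2)
    by (simp add: sets_eq_imp_space_eq Compl_eq_Diff_UNIV)
  ultimately show ?thesis using one[OF B] P Q by (simp add: abs_le_iff)
qed

section \<open>Trigonometric polynomials and the approximation of the identity by sines\<close>

inductive trig_poly :: "('a::real_inner \<Rightarrow> complex) \<Rightarrow> bool" where
  monom: "trig_poly (\<lambda>x. a * cis (u \<bullet> x))"
| add: "trig_poly f \<Longrightarrow> trig_poly g \<Longrightarrow> trig_poly (\<lambda>x. f x + g x)"

lemma trig_poly_const: "trig_poly (\<lambda>x. a)"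
  using trig_poly.monom[of a 0] by simp

lemma trig_poly_mult:
  assumes "trig_poly f" "trig_poly g"
  shows "trig_poly (\<lambda>x. f x * g x)"
  using assms(1)
proof induction
  case (monom a u)
  from assms(2) show ?case
  proof induction
    case (monom b v)
    have "(\<lambda>x. (a * cis (u \<bullet> x)) * (b * cis (v \<bullet> x))) = (\<lambda>x. (a * b) * cis ((u + v) \<bullet> x))"
      by (auto simp: cis_mult inner_add_left algebra_simps)
    then show ?case by (simp only: trig_poly.monom)
  next
    case (add f g)
    then show ?case by (simp add: distrib_left trig_poly.add)
  qed
next
  case (add f g)
  then show ?case by (simp add: distrib_right trig_poly.add)
qed

lemma trig_poly_sum:
  assumes "finite I" "\<And>i. i \<in> I \<Longrightarrow> trig_poly (f i)"
  shows "trig_poly (\<lambda>x. \<Sum>i\<in>I. f i x)"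
  using assms by induction (auto intro: trig_poly_const trig_poly.add)

lemma trig_poly_sin: "trig_poly (\<lambda>x. complex_of_real (c * sin (u \<bullet> x)))"
proof -
  have "(\<lambda>x. complex_of_real (c * sin (u \<bullet> x))) =
      (\<lambda>x. (- \<i> * c / 2) * cis (u \<bullet> x) + (\<i> * c / 2) * cis ((-u) \<bullet> x))"
    by (auto simp: complex_eq_iff)
  then show ?thesis by (simp only: trig_poly.intros)
qed

lemma trig_poly_continuous: "trig_poly f \<Longrightarrow> continuous_on S f"
  by (induction rule: trig_poly.induct) (auto intro!: continuous_intros)

lemma trig_poly_bounded: "trig_poly f \<Longrightarrow> \<exists>C. \<forall>x. cmod (f x) \<le> C"
proof (induction rule: trig_poly.induct)
  case (monom a u)
  then show ?case by (intro exI[of _ "cmod a"]) (auto simp: norm_mult)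
next
  case (add f g)
  then obtain C D where "\<forall>x. cmod (f x) \<le> C" "\<forall>x. cmod (g x) \<le> D" by auto
  then show ?case by (intro exI[of _ "C + D"]) (auto intro!: norm_triangle_mono)
qed

lemma trig_poly_integrable:
  fixes P :: "'a::{real_inner, second_countable_topology} measure"
  assumes "trig_poly f" "prob_space P" "sets P = sets borel"
  shows "integrable P f"
proof -
  interpret prob_space P by fact
  obtain C where "\<forall>x. cmod (f x) \<le> C" using trig_poly_bounded[OF assms(1)] by blast
  moreover have "f \<in> borel_measurable P"
    unfolding measurable_cong_sets[OF assms(3) refl]
    by (intro borel_measurable_continuous_onI trig_poly_continuous assms)
  ultimately show ?thesis by (intro integrable_const_bound[where B=C]) auto
qed

lemma trig_poly_integral_cong:
  fixes P Q :: "'a::{real_inner, second_countable_topology} measure"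
  assumes f: "trig_poly f" and P: "prob_space P" "sets P = sets borel"
    and Q: "prob_space Q" "sets Q = sets borel"
    and eq: "\<And>u. (\<integral>x. cis (u \<bullet> x) \<partial>P) = (\<integral>x. cis (u \<bullet> x) \<partial>Q)"
  shows "integral\<^sup>L P f = integral\<^sup>L Q f"
  using f
  by (induction rule: trig_poly.induct) (auto simp: eq trig_poly_integrable[OF _ P] trig_poly_integrable[OF _ Q])

definition sin_map :: "real \<Rightarrow> 'a::euclidean_space \<Rightarrow> 'a" where
  "sin_map r x = (\<Sum>b\<in>Basis. (r * sin (x \<bullet> b / r)) *\<^sub>R b)"

lemma trig_poly_comp_sin_map:
  assumes "real_polynomial_function p"
  shows "trig_poly (\<lambda>x. complex_of_real (p (sin_map r x)))"
  using assms
proof induction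
  case (linear f)
  then interpret bounded_linear f .
  have "(\<lambda>x. complex_of_real (f (sin_map r x))) =
      (\<lambda>x. \<Sum>b\<in>Basis. complex_of_real ((r * f b) * sin ((b /\<^sub>R r) \<bullet> x)))"
    by (auto simp: sin_map_def sum scaleR inner_commute field_simps)
  then show ?case by (simp only: trig_poly_sum trig_poly_sin finite_Basis)
qed (simp_all add: trig_poly_const trig_poly.add trig_poly_mult)

lemma tendsto_sin_map: "(\<lambda>n. sin_map (real (Suc n)) x) \<longlonglongrightarrow> x"
proof -
  have "(\<lambda>n. real (Suc n) * sin (y / real (Suc n))) \<longlonglongrightarrow> y" for y :: real
  proof -
    have "((\<lambda>t. sin (y * t) / t) \<longlongrightarrow> y) (at 0)"
    proof -
      have "((\<lambda>t. sin (y * t)) has_field_derivative y) (at 0)"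
        by (auto intro!: derivative_eq_intros)
      then show ?thesis by (simp add: has_field_derivative_iff)
    qed
    moreover have "filterlim (\<lambda>n. 1 / real (Suc n)) (at 0) sequentially"
      by (rule filterlim_atI) (auto simp del: of_nat_Suc intro!: LIMSEQ_Suc[OF lim_1_over_n])
    ultimately have "(\<lambda>n. sin (y * (1 / real (Suc n))) / (1 / real (Suc n))) \<longlonglongrightarrow> y"
      by (rule filterlim_compose)
    then show ?thesis by (simp add: field_simps)
  qed
  then have "(\<lambda>n. sin_map (real (Suc n)) x) \<longlonglongrightarrow> (\<Sum>b\<in>Basis. (x \<bullet> b) *\<^sub>R b)"
    unfolding sin_map_def by (intro tendsto_intros)
  then show ?thesis by (simp add: euclidean_representation)
qed

lemma continuous_sin_map: "continuous_on S (sin_map r)"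
  unfolding sin_map_def by (cases "r = 0") (auto intro!: continuous_intros)

lemma norm_sin_map_le: "norm (sin_map r (x :: 'a::euclidean_space)) \<le> \<bar>r\<bar> * real DIM('a)"
proof -
  have "norm (sin_map r x) \<le> (\<Sum>b\<in>(Basis::'a set). \<bar>r\<bar> * 1)"
    unfolding sin_map_def
    by (intro sum_norm_le) (auto simp: abs_mult intro!: mult_left_le)
  then show ?thesis by (simp add: mult.commute)
qed

text \<open>The maps \<open>x \<mapsto> r sin (x/r)\<close> (coordinatewise) have bounded range and converge to the identity as
  \<open>r\<close> grows. On a bounded range polynomials are dense, and polynomials of sines are trigonometric
  polynomials.\<close>
theorem characteristic_function_unique:
  fixes P Q :: "'a::euclidean_space measure"
  assumes P: "prob_space P" "sets P = sets borel"
    and Q: "prob_space Q" "sets Q = sets borel"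
    and eq: "\<And>u. (\<integral>x. cis (u \<bullet> x) \<partial>P) = (\<integral>x. cis (u \<bullet> x) \<partial>Q)"
  shows "P = Q"
proof -
  interpret P: prob_space P by fact
  interpret Q: prob_space Q by fact
  have meas: "f \<in> borel_measurable P" "f \<in> borel_measurable Q" if "continuous_on UNIV f" for f :: "'a \<Rightarrow> real"
    unfolding measurable_cong_sets[OF P(2) refl] measurable_cong_sets[OF Q(2) refl]
    using that by (auto intro: borel_measurable_continuous_onI)
  have cont: "integral\<^sup>L P h = integral\<^sup>L Q h"
    if h: "continuous_on UNIV h" "\<And>x. 0 \<le> h x" "\<And>x. h x \<le> 1" for h :: "'a \<Rightarrow> real"
  proof -
    have hs: "continuous_on UNIV (\<lambda>x. h (sin_map r x))" for r
      by (rule continuous_on_compose2[OF h(1) continuous_sin_map]) auto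
    have sin_eq: "(\<integral>x. h (sin_map r x) \<partial>P) = (\<integral>x. h (sin_map r x) \<partial>Q)" for r
    proof -
      have "\<bar>(\<integral>x. h (sin_map r x) \<partial>P) - (\<integral>x. h (sin_map r x) \<partial>Q)\<bar> \<le> 0 + e" if e: "0 < e" for e
      proof -
        let ?K = "cball (0::'a) (\<bar>r\<bar> * real DIM('a))"
        obtain p where p: "real_polynomial_function p" "\<And>x. x \<in> ?K \<Longrightarrow> \<bar>h x - p x\<bar> < e / 2"
          using Stone_Weierstrass_real_polynomial_function[of ?K h "e/2"] h(1) e
          by (metis compact_cball continuous_on_subset half_gt_zero subset_UNIV)
        have close: "\<bar>h (sin_map r x) - p (sin_map r x)\<bar> \<le> e / 2" for x
          using p(2)[of "sin_map r x"] norm_sin_map_le[of r x] by (auto simp: less_imp_le)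
        note T = trig_poly_comp_sin_map[OF p(1), of r]
        have ip: "integrable P (\<lambda>x. p (sin_map r x))" "integrable Q (\<lambda>x. p (sin_map r x))"
          using trig_poly_integrable[OF T P] trig_poly_integrable[OF T Q] by (simp_all add: complex_of_real_integrable_eq)
        have "complex_of_real (\<integral>x. p (sin_map r x) \<partial>P) = complex_of_real (\<integral>x. p (sin_map r x) \<partial>Q)"
          using trig_poly_integral_cong[OF T P Q eq] by simp
        then have peq: "(\<integral>x. p (sin_map r x) \<partial>P) = (\<integral>x. p (sin_map r x) \<partial>Q)" by simp
        have approx: "\<bar>(\<integral>x. h (sin_map r x) \<partial>R) - (\<integral>x. p (sin_map r x) \<partial>R)\<bar> \<le> e / 2"
          if R: "prob_space R" "sets R = sets borel" "integrable R (\<lambda>x. p (sin_map r x))" for R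
        proof -
          interpret R: prob_space R by fact
          have "integrable R (\<lambda>x. h (sin_map r x))"
            using h(2,3)
            by (intro R.integrable_const_bound[where B=1])
              (auto intro: borel_measurable_continuous_onI hs simp: measurable_cong_sets[OF R(2) refl])
          then have "(\<integral>x. h (sin_map r x) \<partial>R) - (\<integral>x. p (sin_map r x) \<partial>R)
              = (\<integral>x. h (sin_map r x) - p (sin_map r x) \<partial>R)"
            and "integrable R (\<lambda>x. h (sin_map r x) - p (sin_map r x))"
            using R(3) by auto
          moreover from this(2) have "\<bar>\<integral>x. h (sin_map r x) - p (sin_map r x) \<partial>R\<bar> \<le> e / 2"
            using close
            by (intro order_trans[OF integral_abs_bound] R.integral_le_const) auto
          ultimately show ?thesis by simp
        qed
        show ?thesis using approx[OF P ip(1)] approx[OF Q ip(2)] peq by linarith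
      qed
      then have "\<bar>(\<integral>x. h (sin_map r x) \<partial>P) - (\<integral>x. h (sin_map r x) \<partial>Q)\<bar> \<le> 0"
        by (rule field_le_epsilon)
      then show ?thesis by simp
    qed
    have lim: "(\<lambda>n. \<integral>x. h (sin_map (real (Suc n)) x) \<partial>R) \<longlonglongrightarrow> integral\<^sup>L R h"
      if R: "prob_space R" "sets R = sets borel" for R
    proof (rule integral_dominated_convergence[where w="\<lambda>_. 1"])
      interpret R: prob_space R by fact
      show "integrable R (\<lambda>_. 1::real)" by simp
      show "h \<in> borel_measurable R" "(\<lambda>x. h (sin_map (real (Suc n)) x)) \<in> borel_measurable R" for n
        unfolding measurable_cong_sets[OF R(2) refl]
        using h(1) hs by (auto intro: borel_measurable_continuous_onI)
      show "AE x in R. (\<lambda>n. h (sin_map (real (Suc n)) x)) \<longlonglongrightarrow> h x"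
        using h(1) by (intro AE_I2 isCont_tendsto_compose[OF _ tendsto_sin_map])
          (simp add: continuous_on_eq_continuous_at)
      show "AE x in R. norm (h (sin_map (real (Suc n)) x)) \<le> 1" for n
        using h by auto
    qed
    show ?thesis
      using lim[OF P] lim[OF Q] unfolding sin_eq by (rule LIMSEQ_unique)
  qed
  show ?thesis
  proof (rule measure_eqI)
    fix A assume "A \<in> sets P"
    then have "\<bar>measure P A - measure Q A\<bar> \<le> 0"
      using P Q cont by (intro measure_diff_le_continuous) auto
    then show "emeasure P A = emeasure Q A"
      by (simp add: P.emeasure_eq_measure Q.emeasure_eq_measure)
  qed (simp add: P Q)
qed

section \<open>Rotation invariant product measures\<close>

text \<open>This class is stable under all operations used below, and its members are integrable
  against every measure with finite moments, so integrability never needs a separate estimate.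
  Derivatives are required to be tame jointly in point and direction, as functions of a
  pair.\<close>

definition tame :: "('a::real_normed_vector \<Rightarrow> 'b::real_normed_vector) \<Rightarrow> bool" where
  "tame f \<longleftrightarrow> continuous_on UNIV f \<and> (\<exists>C k. \<forall>x. norm (f x) \<le> C * (1 + norm x) ^ k)"

lemma tameI:
  assumes "continuous_on UNIV f" "\<And>x. norm (f x) \<le> C * (1 + norm x) ^ k"
  shows "tame f"
  using assms unfolding tame_def by blast

lemma tame_continuous: "tame f \<Longrightarrow> continuous_on S f"
  unfolding tame_def using continuous_on_subset by blast

lemma tameE:
  assumes "tame f"
  obtains C k where "C \<ge> 0" "\<And>x. norm (f x) \<le> C * (1 + norm x) ^ k"
proof -
  obtain C k where C: "\<And>x. norm (f x) \<le> C * (1 + norm x) ^ k" using assms unfolding tame_def by blast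
  have "0 \<le> C" using order_trans[OF norm_ge_zero C[of 0]] by simp
  with C show ?thesis using that by blast
qed

lemma tame_bounded:
  assumes "continuous_on UNIV f" "\<And>x. norm (f x) \<le> C"
  shows "tame f"
  using assms by (intro tameI[where k=0]) auto

lemma tame_const [intro]: "tame (\<lambda>x. c)"
  by (rule tame_bounded[of _ "norm c"]) auto

lemma tame_linear:
  assumes "bounded_linear f" shows "tame f"
proof -
  interpret bounded_linear f by fact
  obtain K where K: "0 < K" "\<And>x. norm (f x) \<le> norm x * K" using pos_bounded by blast
  show ?thesis
  proof (rule tameI[where k=1 and C=K])
    show "continuous_on UNIV f" by (intro linear_continuous_on assms)
    show "norm (f x) \<le> K * (1 + norm x) ^ 1" for x
      using K(1) K(2)[of x] by (simp add: algebra_simps)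
  qed
qed

lemma tame_add:
  fixes f g :: "'a::real_normed_vector \<Rightarrow> 'b::real_normed_vector"
  assumes "tame f" "tame g" shows "tame (\<lambda>x. f x + g x)"
proof -
  obtain C k where C: "C \<ge> 0" "\<And>x. norm (f x) \<le> C * (1 + norm x) ^ k" using tameE[OF assms(1)] by metis
  obtain D l where D: "D \<ge> 0" "\<And>x. norm (g x) \<le> D * (1 + norm x) ^ l" using tameE[OF assms(2)] by metis
  show ?thesis
  proof (rule tameI[where C="C + D" and k="k + l"])
    show "continuous_on UNIV (\<lambda>x. f x + g x)" by (intro continuous_intros tame_continuous assms)
    fix x :: 'a
    have "C * (1 + norm x) ^ k \<le> C * (1 + norm x) ^ (k + l)" "D * (1 + norm x) ^ l \<le> D * (1 + norm x) ^ (k + l)"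
      using C(1) D(1) by (intro mult_left_mono power_increasing; simp)+
    then show "norm (f x + g x) \<le> (C + D) * (1 + norm x) ^ (k + l)"
      using C(2)[of x] D(2)[of x] norm_triangle_ineq[of "f x" "g x"] by (simp add: distrib_right)
  qed
qed

lemma tame_compose:
  assumes "tame f" "tame g" shows "tame (\<lambda>x. f (g x))"
proof -
  obtain C k where C: "C \<ge> 0" "\<And>x. norm (f x) \<le> C * (1 + norm x) ^ k" using tameE[OF assms(1)] by metis
  obtain D l where D: "D \<ge> 0" "\<And>x. norm (g x) \<le> D * (1 + norm x) ^ l" using tameE[OF assms(2)] by metis
  show ?thesis
  proof (rule tameI[where C="C * (1 + D) ^ k" and k="l * k"])
    show "continuous_on UNIV (\<lambda>x. f (g x))"
      by (rule continuous_on_compose2[of UNIV f]) (auto intro: tame_continuous assms)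
    fix x
    have "1 + norm (g x) \<le> (1 + D) * (1 + norm x) ^ l"
      using D(2)[of x] one_le_power[of "1 + norm x" l] by (simp add: distrib_right del: one_le_power)
    then have "(1 + norm (g x)) ^ k \<le> ((1 + D) * (1 + norm x) ^ l) ^ k" by (intro power_mono) auto
    then show "norm (f (g x)) \<le> C * (1 + D) ^ k * (1 + norm x) ^ (l * k)"
      using C(2)[of "g x"] C(1) mult_left_mono by (fastforce simp: power_mult_distrib power_mult mult.assoc)
  qed
qed

lemma tame_Pair:
  fixes f :: "'a::real_normed_vector \<Rightarrow> 'b::real_normed_vector" and g :: "'a \<Rightarrow> 'c::real_normed_vector"
  assumes "tame f" "tame g" shows "tame (\<lambda>x. (f x, g x))"
proof -
  obtain C k where C: "C \<ge> 0" "\<And>x. norm (f x) \<le> C * (1 + norm x) ^ k" using tameE[OF assms(1)] by metis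
  obtain D l where D: "D \<ge> 0" "\<And>x. norm (g x) \<le> D * (1 + norm x) ^ l" using tameE[OF assms(2)] by metis
  show ?thesis
  proof (rule tameI[where C="C + D" and k="k + l"])
    show "continuous_on UNIV (\<lambda>x. (f x, g x))" by (intro continuous_intros tame_continuous assms)
    fix x :: 'a
    have "C * (1 + norm x) ^ k \<le> C * (1 + norm x) ^ (k + l)" "D * (1 + norm x) ^ l \<le> D * (1 + norm x) ^ (k + l)"
      using C(1) D(1) by (intro mult_left_mono power_increasing; simp)+
    then show "norm (f x, g x) \<le> (C + D) * (1 + norm x) ^ (k + l)"
      using C(2)[of x] D(2)[of x] norm_Pair_le[of "f x" "g x"] by (simp add: distrib_right)
  qed
qed

lemma tame_bounded_bilinear:
  fixes f :: "'a::real_normed_vector \<Rightarrow> 'b::real_normed_vector" and g :: "'a \<Rightarrow> 'c::real_normed_vector"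
  assumes bil: "bounded_bilinear h" and fg: "tame f" "tame g" shows "tame (\<lambda>x. h (f x) (g x))"
proof -
  interpret bounded_bilinear h by fact
  obtain K where K: "0 < K" "\<And>a b. norm (h a b) \<le> norm a * norm b * K" using pos_bounded by blast
  obtain C k where C: "C \<ge> 0" "\<And>x. norm (f x) \<le> C * (1 + norm x) ^ k" using tameE[OF fg(1)] by metis
  obtain D l where D: "D \<ge> 0" "\<And>x. norm (g x) \<le> D * (1 + norm x) ^ l" using tameE[OF fg(2)] by metis
  show ?thesis
  proof (rule tameI[where C="C * D * K" and k="k + l"])
    show "continuous_on UNIV (\<lambda>x. h (f x) (g x))" by (intro continuous_on tame_continuous fg)
    fix x
    have "norm (h (f x) (g x)) \<le> norm (f x) * norm (g x) * K" by (rule K)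
    also have "\<dots> \<le> (C * (1 + norm x) ^ k) * (D * (1 + norm x) ^ l) * K"
      using C D K by (intro mult_right_mono mult_mono) auto
    finally show "norm (h (f x) (g x)) \<le> C * D * K * (1 + norm x) ^ (k + l)"
      by (simp add: power_add ac_simps)
  qed
qed

lemmas tame_mult = tame_bounded_bilinear[OF bounded_bilinear_mult]
lemmas tame_scaleR = tame_bounded_bilinear[OF bounded_bilinear_scaleR]
lemmas tame_inner = tame_bounded_bilinear[OF bounded_bilinear_inner]
lemmas tame_linear_comp = tame_compose[OF tame_linear]
lemmas tame_fst = tame_linear_comp[OF bounded_linear_fst]
lemmas tame_snd = tame_linear_comp[OF bounded_linear_snd]
lemmas tame_minus = tame_linear_comp[OF bounded_linear_minus[OF bounded_linear_ident]]

lemma tame_ident: "tame (\<lambda>x. x)" by (intro tame_linear bounded_linear_ident)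

lemma tame_diff: "tame f \<Longrightarrow> tame g \<Longrightarrow> tame (\<lambda>x. f x - g x)"
  using tame_add[of f "\<lambda>x. - g x"] tame_minus[of g] by simp

lemma tame_norm: "tame f \<Longrightarrow> tame (\<lambda>x. norm (f x))"
  by (rule tame_compose[of norm]) (auto intro!: tameI[where C=1 and k=1] continuous_intros)

lemma tame_cos: "tame f \<Longrightarrow> tame (\<lambda>x. cos (f x :: real))"
  by (rule tame_compose[of cos]) (auto intro!: tame_bounded[where C=1] continuous_intros)

lemma tame_sin: "tame f \<Longrightarrow> tame (\<lambda>x. sin (f x :: real))"
  by (rule tame_compose[of sin]) (auto intro!: tame_bounded[where C=1] continuous_intros)

lemma tame_power: "tame f \<Longrightarrow> tame (\<lambda>x. f x ^ n :: 'b::real_normed_algebra_1)"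
  by (induction n) (auto intro: tame_mult)

lemma tame_sum:
  assumes "\<And>i. i \<in> I \<Longrightarrow> tame (f i)"
  shows "tame (\<lambda>x. \<Sum>i\<in>I. f i x)"
proof (cases "finite I")
  case True
  then show ?thesis using assms by induction (auto intro: tame_add)
qed auto

lemma tame_if_tame_norm_le:
  fixes g :: "'a::real_normed_vector \<Rightarrow> real"
  assumes "continuous_on UNIV f" "tame g" "\<And>x. norm (f x) \<le> g x"
  shows "tame f"
proof -
  obtain C k where C: "C \<ge> 0" "\<And>x. norm (g x) \<le> C * (1 + norm x) ^ k" using tameE[OF assms(2)] by metis
  show ?thesis by (rule tameI[OF assms(1), of C k]) (smt (verit) C(2) assms(3) real_norm_def)
qed

lemmas tame_intros = tame_add tame_diff tame_minus tame_mult tame_scaleR tame_inner tame_Pair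
  tame_ident tame_cos tame_sin tame_norm tame_power tame_sum tame_const tame_fst tame_snd

section \<open>Rotations of a pair of vectors and the measures that they preserve\<close>

definition rot :: "real \<Rightarrow> 'a::real_vector \<times> 'a \<Rightarrow> 'a \<times> 'a" where
  "rot t z = (cos t *\<^sub>R fst z + sin t *\<^sub>R snd z, cos t *\<^sub>R snd z - sin t *\<^sub>R fst z)"

lemma rot_rot: "rot s (rot t z) = rot (s + t) z"
  by (simp add: rot_def cos_add sin_add algebra_simps)

lemma rot_0 [simp]: "rot 0 z = z" by (simp add: rot_def)

text \<open>The velocity is the generator (y, -x) evaluated at the rotated point. Derivatives along
  a path are therefore again functions of \<open>rot t z\<close>, to which invariance
  applies.\<close>

lemma rot_has_vector_derivative:
  "((\<lambda>t. rot t z) has_vector_derivative (snd (rot t z), - fst (rot t z))) (at t within S)"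
  for z :: "'a::real_normed_vector \<times> 'a"
  unfolding rot_def
  by (auto intro!: derivative_eq_intros has_vector_derivative_Pair simp: has_real_derivative_iff_has_vector_derivative[symmetric] algebra_simps)

lemma tame_rot: "tame f \<Longrightarrow> tame g \<Longrightarrow> tame (\<lambda>x. rot (f x) (g x))"
  unfolding rot_def by (intro tame_intros)

text \<open>Formulated without a density, which admits singular covariances and even the point mass
  at 0. The moment condition is what makes every tame function integrable.\<close>

locale rotation_invariant = prob_space \<mu> for \<mu> :: "'a::euclidean_space measure" +
  assumes sets_eq: "sets \<mu> = sets borel"
    and moment: "\<And>k. integrable \<mu> (\<lambda>x. norm x ^ k)"
    and distr_rot: "\<And>t. distr (\<mu> \<Otimes>\<^sub>M \<mu>) (\<mu> \<Otimes>\<^sub>M \<mu>) (rot t) = \<mu> \<Otimes>\<^sub>M \<mu>"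
begin

sublocale PP: pair_prob_space \<mu> \<mu> ..

abbreviation "\<mu>2 \<equiv> \<mu> \<Otimes>\<^sub>M \<mu>"

lemma sets_pair: "sets \<mu>2 = sets borel"
  by (metis sets_pair_measure_cong sets_eq borel_prod)

lemma measurable_mu: "f \<in> borel_measurable \<mu> \<longleftrightarrow> f \<in> borel_measurable borel"
  by (simp add: measurable_cong_sets[OF sets_eq refl])

lemma measurable_mu2: "f \<in> borel_measurable \<mu>2 \<longleftrightarrow> f \<in> borel_measurable borel"
  by (simp add: measurable_cong_sets[OF sets_pair refl])

lemma tame_measurable: "tame f \<Longrightarrow> f \<in> borel_measurable \<mu>"
  by (auto simp: measurable_mu intro: borel_measurable_continuous_onI tame_continuous)

lemma tame_measurable2: "tame f \<Longrightarrow> f \<in> borel_measurable \<mu>2"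
  by (auto simp: measurable_mu2 intro: borel_measurable_continuous_onI tame_continuous)

lemma integrable_one_plus_norm: "integrable \<mu> (\<lambda>x. (1 + norm x) ^ k)"
proof (rule Bochner_Integration.integrable_bound)
  show "integrable \<mu> (\<lambda>x. 2 ^ k * (1 + norm x ^ k))" using moment by simp
  show "(\<lambda>x. (1 + norm x) ^ k) \<in> borel_measurable \<mu>" by (intro tame_measurable tame_intros)
  show "AE x in \<mu>. norm ((1 + norm x) ^ k) \<le> norm (2 ^ k * (1 + norm x ^ k))"
  proof (rule AE_I2)
    fix x :: 'a
    have "(1 + norm x) ^ k \<le> (2 * max 1 (norm x)) ^ k" by (intro power_mono) auto
    also have "max 1 (norm x) ^ k \<le> 1 + norm x ^ k" by (auto simp: max_def)
    then have "(2 * max 1 (norm x)) ^ k \<le> 2 ^ k * (1 + norm x ^ k)" by (simp add: power_mult_distrib)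
    finally show "norm ((1 + norm x) ^ k) \<le> norm (2 ^ k * (1 + norm x ^ k))" by simp
  qed
qed

lemma integrable_tame:
  fixes f :: "'a \<Rightarrow> 'b::{banach, second_countable_topology}"
  assumes "tame f" shows "integrable \<mu> f"
proof -
  obtain C k where C: "C \<ge> 0" "\<And>x. norm (f x) \<le> C * (1 + norm x) ^ k" using tameE[OF assms] by metis
  show ?thesis
    by (rule Bochner_Integration.integrable_bound[where f="\<lambda>x. C * (1 + norm x) ^ k"])
      (use C assms integrable_one_plus_norm tame_measurable in auto)
qed

lemma integrable_one_plus_norm2: "integrable \<mu>2 (\<lambda>z. (1 + norm z) ^ k)"
proof (rule Bochner_Integration.integrable_bound)
  show "integrable \<mu>2 (\<lambda>z. (1 + norm (fst z)) ^ k * (1 + norm (snd z)) ^ k)"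
  proof (rule PP.Fubini_integrable)
    show "(\<lambda>z. (1 + norm (fst z)) ^ k * (1 + norm (snd z)) ^ k) \<in> borel_measurable \<mu>2"
      by (intro tame_measurable2 tame_intros)
  qed (use integrable_one_plus_norm in \<open>auto simp: abs_mult\<close>)
  show "(\<lambda>z. (1 + norm z) ^ k) \<in> borel_measurable \<mu>2" by (intro tame_measurable2 tame_intros)
  show "AE z in \<mu>2. norm ((1 + norm z) ^ k) \<le> norm ((1 + norm (fst z)) ^ k * (1 + norm (snd z)) ^ k)"
  proof (rule AE_I2)
    fix z :: "'a \<times> 'a"
    have "norm z \<le> norm (fst z) + norm (snd z)" using norm_Pair_le[of "fst z" "snd z"] by simp
    then have "1 + norm z \<le> (1 + norm (fst z)) * (1 + norm (snd z))" by (simp add: algebra_simps add_increasing2 del: norm_ge_zero) (smt (verit) mult_nonneg_nonneg norm_ge_zero)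
    then have "(1 + norm z) ^ k \<le> ((1 + norm (fst z)) * (1 + norm (snd z))) ^ k" by (intro power_mono) auto
    then show "norm ((1 + norm z) ^ k) \<le> norm ((1 + norm (fst z)) ^ k * (1 + norm (snd z)) ^ k)"
      by (simp add: power_mult_distrib abs_mult)
  qed
qed

lemma integrable_tame2:
  fixes f :: "'a \<times> 'a \<Rightarrow> 'b::{banach, second_countable_topology}"
  assumes "tame f" shows "integrable \<mu>2 f"
proof -
  obtain C k where C: "C \<ge> 0" "\<And>x. norm (f x) \<le> C * (1 + norm x) ^ k" using tameE[OF assms] by metis
  show ?thesis
    by (rule Bochner_Integration.integrable_bound[where f="\<lambda>x. C * (1 + norm x) ^ k"])
      (use C assms integrable_one_plus_norm2 tame_measurable2 in auto)
qed

lemma integral_rot: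
  fixes f :: "'a \<times> 'a \<Rightarrow> real"
  assumes "tame f" shows "(\<integral>z. f (rot t z) \<partial>\<mu>2) = integral\<^sup>L \<mu>2 f"
proof -
  have "rot t \<in> \<mu>2 \<rightarrow>\<^sub>M \<mu>2"
    using tame_measurable2[OF tame_rot[OF tame_const tame_ident], of t]
    by (simp add: measurable_cong_sets[OF refl sets_pair])
  from integral_distr[OF this tame_measurable2[OF assms]] show ?thesis
    by (simp add: distr_rot)
qed

lemma integral_iterated:
  fixes f :: "'a \<times> 'a \<Rightarrow> real"
  assumes "tame f"
  shows "integral\<^sup>L \<mu>2 f = (\<integral>x. \<integral>y. f (x, y) \<partial>\<mu> \<partial>\<mu>)" "integral\<^sup>L \<mu>2 f = (\<integral>y. \<integral>x. f (x, y) \<partial>\<mu> \<partial>\<mu>)"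
    "integrable \<mu> (\<lambda>x. \<integral>y. f (x, y) \<partial>\<mu>)" "integrable \<mu> (\<lambda>y. \<integral>x. f (x, y) \<partial>\<mu>)"
proof -
  have "integrable \<mu>2 (\<lambda>(x, y). f (x, y))" using integrable_tame2[OF assms] by simp
  from PP.integral_fst[OF this] PP.integral_snd[OF this] PP.integrable_fst[OF this] PP.integrable_snd[OF this]
  show "integral\<^sup>L \<mu>2 f = (\<integral>x. \<integral>y. f (x, y) \<partial>\<mu> \<partial>\<mu>)" "integral\<^sup>L \<mu>2 f = (\<integral>y. \<integral>x. f (x, y) \<partial>\<mu> \<partial>\<mu>)"
    "integrable \<mu> (\<lambda>x. \<integral>y. f (x, y) \<partial>\<mu>)" "integrable \<mu> (\<lambda>y. \<integral>x. f (x, y) \<partial>\<mu>)"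
    by simp_all
qed

lemma integral_product:
  fixes f g :: "'a \<Rightarrow> real"
  assumes "tame f" "tame g"
  shows "(\<integral>z. f (fst z) * g (snd z) \<partial>\<mu>2) = integral\<^sup>L \<mu> f * integral\<^sup>L \<mu> g"
  using integral_iterated(1)[of "\<lambda>z. f (fst z) * g (snd z)"] assms
  by (simp add: tame_mult tame_compose[OF _ tame_fst[OF tame_ident]] tame_compose[OF _ tame_snd[OF tame_ident]])

lemma integral_fst: "tame f \<Longrightarrow> (\<integral>z. f (fst z) \<partial>\<mu>2) = (integral\<^sup>L \<mu> f :: real)"
  using integral_product[of f "\<lambda>_. 1"] by (simp add: tame_const prob_space)

lemma integral_fst_rot: "tame f \<Longrightarrow> (\<integral>z. f (fst (rot t z)) \<partial>\<mu>2) = (integral\<^sup>L \<mu> f :: real)"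
  using integral_rot[of "\<lambda>z. f (fst z)" t] integral_fst[of f] tame_compose[OF _ tame_fst[OF tame_ident], of f] by simp

text \<open>On a bounded interval the polynomial growth in \<open>t\<close> is absorbed into a
  constant (\<open>D\<close> in the proof), which leaves a dominating function of \<open>z\<close>
  alone that is integrable for the product law.\<close>

lemma path_fubini:
  fixes H :: "real \<times> 'a \<times> 'a \<Rightarrow> real"
  assumes "tame H"
  shows "(\<integral>z. (LBINT t:{a..b}. H (t, z)) \<partial>\<mu>2) = (LBINT t:{a..b}. (\<integral>z. H (t, z) \<partial>\<mu>2))"
    and "set_integrable lborel {a..b} (\<lambda>t. \<integral>z. H (t, z) \<partial>\<mu>2)"
proof -
  interpret L: pair_sigma_finite "lborel :: real measure" \<mu>2 ..
  let ?h = "\<lambda>(t, z). indicator {a..b} t * H (t, z)"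
  have sets: "sets ((lborel :: real measure) \<Otimes>\<^sub>M \<mu>2) = sets borel"
    by (subst sets_pair_measure_cong[OF sets_lborel sets_pair]) (simp only: borel_prod)
  have Hm: "H \<in> borel_measurable (lborel \<Otimes>\<^sub>M \<mu>2)"
    unfolding measurable_cong_sets[OF sets refl] by (intro borel_measurable_continuous_onI tame_continuous assms)
  obtain C k where C: "C \<ge> 0" "\<And>x. norm (H x) \<le> C * (1 + norm x) ^ k" using tameE[OF assms] by metis
  define D where "D = C * (1 + \<bar>a\<bar> + \<bar>b\<bar>) ^ k"
  have bound: "\<bar>H (t, z)\<bar> \<le> D * (1 + norm z) ^ k" if "t \<in> {a..b}" for t z
  proof -
    have "\<bar>t\<bar> \<le> \<bar>a\<bar> + \<bar>b\<bar>" using that by auto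
    then have "norm (t, z) \<le> \<bar>a\<bar> + \<bar>b\<bar> + norm z" using norm_Pair_le[of t z] by simp
    moreover have "0 \<le> (\<bar>a\<bar> + \<bar>b\<bar>) * norm z" by simp
    ultimately have "1 + norm (t, z) \<le> (1 + \<bar>a\<bar> + \<bar>b\<bar>) * (1 + norm z)"
      unfolding distrib_left distrib_right mult_1_left mult_1_right by linarith
    then have "(1 + norm (t, z)) ^ k \<le> ((1 + \<bar>a\<bar> + \<bar>b\<bar>) * (1 + norm z)) ^ k" by (intro power_mono) auto
    then have "C * (1 + norm (t, z)) ^ k \<le> C * ((1 + \<bar>a\<bar> + \<bar>b\<bar>) * (1 + norm z)) ^ k" using C(1) by (rule mult_left_mono)
    then show ?thesis using C(2)[of "(t, z)"] by (simp add: D_def power_mult_distrib mult.assoc)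
  qed
  have Im: "indicator ({a..b} \<times> UNIV) \<in> borel_measurable (lborel \<Otimes>\<^sub>M \<mu>2)" (is "?I \<in> _")
    unfolding measurable_cong_sets[OF sets refl]
    by (intro borel_measurable_indicator borel_closed closed_Times) auto
  have int: "integrable (lborel \<Otimes>\<^sub>M \<mu>2) ?h"
  proof (rule Bochner_Integration.integrable_bound)
    show "integrable (lborel \<Otimes>\<^sub>M \<mu>2) (\<lambda>x. ?I x * (D * (1 + norm (snd x)) ^ k))"
    proof (rule L.Fubini_integrable)
      have "(\<lambda>x. D * (1 + norm (snd x)) ^ k) \<in> borel_measurable ((lborel :: real measure) \<Otimes>\<^sub>M \<mu>2)"
        unfolding measurable_cong_sets[OF sets refl]
        by (intro borel_measurable_continuous_onI continuous_intros)
      with Im show "(\<lambda>x. ?I x * (D * (1 + norm (snd x)) ^ k)) \<in> borel_measurable (lborel \<Otimes>\<^sub>M \<mu>2)"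
        by (rule borel_measurable_times)
      have "integrable lborel (indicator {a..b} :: real \<Rightarrow> real)"
        by (rule integrable_real_indicator) (auto simp: emeasure_lborel_Icc_eq)
      then show "integrable lborel (\<lambda>t. \<integral>z. norm (?I (t, z) * (D * (1 + norm (snd (t, z))) ^ k)) \<partial>\<mu>2)"
        by (simp add: abs_mult indicator_times)
    qed (use integrable_one_plus_norm2 in \<open>auto simp: indicator_times\<close>)
    show "?h \<in> borel_measurable (lborel \<Otimes>\<^sub>M \<mu>2)"
      using borel_measurable_times[OF Im Hm] by (simp add: case_prod_beta' indicator_times)
    show "AE x in lborel \<Otimes>\<^sub>M \<mu>2. norm (?h x) \<le> norm (?I x * (D * (1 + norm (snd x)) ^ k))"
      using bound by (intro AE_I2) (auto simp: indicator_def intro: order_trans[OF _ abs_ge_self])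
  qed
  show "(\<integral>z. (LBINT t:{a..b}. H (t, z)) \<partial>\<mu>2) = (LBINT t:{a..b}. (\<integral>z. H (t, z) \<partial>\<mu>2))"
    using L.Fubini_integral[OF int] by (simp add: set_lebesgue_integral_def)
  show "set_integrable lborel {a..b} (\<lambda>t. \<integral>z. H (t, z) \<partial>\<mu>2)"
    using L.integrable_fst[OF int] by (simp add: set_integrable_def)
qed

end

section \<open>Integration by parts, covariance formula and Poincare inequality\<close>

context rotation_invariant
begin

text \<open>Since \<open>\<mu> \<otimes> \<mu>\<close> is invariant under the rotations \<open>rot t\<close>, the integral of a derivative along
  their generator vanishes. This is the only source of integration by parts below.\<close>
lemma integral_rotation_generator:
  fixes F :: "'a \<times> 'a \<Rightarrow> real"
  assumes F: "\<And>z. (F has_derivative F' z) (at z)"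
    and tame: "tame F" "tame (\<lambda>z. F' z (snd z, - fst z))"
  shows "(\<integral>z. F' z (snd z, - fst z) \<partial>\<mu>2) = 0"
proof -
  define K where "K = (\<lambda>z. F' z (snd z, - fst z))"
  have K: "tame K" using tame by (simp add: K_def)
  have KH: "tame (\<lambda>x :: real \<times> 'a \<times> 'a. K (rot (fst x) (snd x)))"
    by (intro tame_compose[OF K] tame_rot tame_fst tame_snd tame_ident)
  have deriv: "((\<lambda>t. F (rot t z)) has_vector_derivative K (rot t z)) (at t within T)" for t z T
  proof -
    interpret F': bounded_linear "F' w" for w by (rule has_derivative_bounded_linear[OF F])
    have "F' w (c *\<^sub>R a, - (c *\<^sub>R b)) = c * F' w (a, - b)" for w c a b
      using F'.scaleR[of w c "(a, - b)"] by simp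
    then show ?thesis
      using has_derivative_compose[OF rot_has_vector_derivative[unfolded has_vector_derivative_def] F, of z t T]
      unfolding has_vector_derivative_def K_def by (simp add: mult.commute)
  qed
  have ftc: "(LBINT t:{0..1}. K (rot t z)) = F (rot 1 z) - F z" for z
  proof -
    have "continuous_on {0..1} (\<lambda>t. K (rot t z))"
      by (rule tame_continuous[OF tame_compose[OF K tame_rot[OF tame_ident tame_const]]])
    then show ?thesis
      using integral_FTC_atLeastAtMost[of 0 1 "\<lambda>t. F (rot t z)" "\<lambda>t. K (rot t z)"] deriv
      by (simp add: set_lebesgue_integral_def)
  qed
  \<comment> \<open>Invariance makes the integrals of \<open>F (rot 1 z)\<close> and
    \<open>F z\<close> equal. Their difference is the time integral of \<open>K\<close> along the
    rotation, and invariance removes the time from that as well.\<close>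
  have "0 = (\<integral>z. F (rot 1 z) - F z \<partial>\<mu>2)"
    using tame(1) tame_compose[OF tame(1) tame_rot[OF tame_const tame_ident]]
    by (subst Bochner_Integration.integral_diff) (auto simp: integral_rot intro!: integrable_tame2)
  also have "\<dots> = (LBINT t:{0..1}. (\<integral>z. K (rot t z) \<partial>\<mu>2))"
    using path_fubini(1)[OF KH, of 0 1] by (simp add: ftc)
  also have "\<dots> = (\<integral>z. K z \<partial>\<mu>2)"
    by (simp add: integral_rot[OF K] set_lebesgue_integral_def)
  finally show ?thesis by (simp add: K_def)
qed

text \<open>No mean is subtracted: invariance under \<open>rot pi\<close>, which is the reflection z
  to -z, forces the measure to be symmetric and hence centred.\<close>

definition cov_op :: "'a \<Rightarrow> 'a" where
  "cov_op u = (\<integral>z. (u \<bullet> z) *\<^sub>R z \<partial>\<mu>)"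

lemma integral_linear_cov_op:
  assumes "bounded_linear l"
  shows "(\<integral>z. l z * (u \<bullet> z) \<partial>\<mu>) = l (cov_op u)"
proof -
  interpret bounded_linear l by fact
  have "l (cov_op u) = (\<integral>z. l ((u \<bullet> z) *\<^sub>R z) \<partial>\<mu>)"
    unfolding cov_op_def
    by (intro integral_bounded_linear[symmetric] assms integrable_tame tame_intros)
  then show ?thesis by (simp add: scaleR mult.commute)
qed

lemma inner_cov_op: "v \<bullet> cov_op u = (\<integral>z. (v \<bullet> z) * (u \<bullet> z) \<partial>\<mu>)"
  using integral_linear_cov_op[OF bounded_linear_inner_right] by simp

lemma bounded_linear_cov_op: "bounded_linear cov_op"
proof -
  have int: "integrable \<mu> (\<lambda>z. (u \<bullet> z) *\<^sub>R z)" for u by (intro integrable_tame tame_intros)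
  have "linear cov_op"
    by (rule linearI) (use int in \<open>auto simp: cov_op_def inner_add_left scaleR_add_left simp flip: scaleR_scaleR\<close>)
  then show ?thesis by (simp add: linear_conv_bounded_linear)
qed

text \<open>The generator identity is applied to F(x, y) = \<psi>(x) (u . y). The derivative of F in
  direction (y, -x) is \<psi>'(x)(y) (u . y) - \<psi>(x) (u . x), and integrating y out of the first
  term produces the covariance operator.\<close>

lemma integration_by_parts:
  assumes \<psi>: "\<And>x. (\<psi> has_derivative \<psi>' x) (at x)"
    and tame: "tame \<psi>" "tame (\<lambda>p. \<psi>' (fst p) (snd p))"
  shows "(\<integral>x. \<psi> x * (u \<bullet> x) \<partial>\<mu>) = (\<integral>x. \<psi>' x (cov_op u) \<partial>\<mu>)"
proof -
  let ?F = "\<lambda>z. \<psi> (fst z) * (u \<bullet> snd z)"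
  let ?F' = "\<lambda>z h. \<psi> (fst z) * (u \<bullet> snd h) + \<psi>' (fst z) (fst h) * (u \<bullet> snd z)"
  have t1: "tame (\<lambda>z :: 'a \<times> 'a. \<psi> (fst z) * (u \<bullet> fst z))"
    by (intro tame_intros tame_compose[OF tame(1)])
  have t2: "tame (\<lambda>z :: 'a \<times> 'a. \<psi>' (fst z) (snd z) * (u \<bullet> snd z))"
    by (intro tame_intros tame)
  have "(\<integral>z. ?F' z (snd z, - fst z) \<partial>\<mu>2) = 0"
  proof (rule integral_rotation_generator)
    show "(?F has_derivative ?F' z) (at z)" for z
      by (auto intro!: derivative_eq_intros has_derivative_compose[OF _ \<psi>, of fst])
    show "tame ?F" by (intro tame_intros tame_compose[OF tame(1)])
    show "tame (\<lambda>z. ?F' z (snd z, - fst z))"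
      using tame_diff[OF t2 t1] by (simp add: algebra_simps)
  qed
  then have "(\<integral>z. \<psi>' (fst z) (snd z) * (u \<bullet> snd z) - \<psi> (fst z) * (u \<bullet> fst z) \<partial>\<mu>2) = 0"
    by (simp add: algebra_simps)
  then have "(\<integral>z. \<psi>' (fst z) (snd z) * (u \<bullet> snd z) \<partial>\<mu>2) = (\<integral>z. \<psi> (fst z) * (u \<bullet> fst z) \<partial>\<mu>2)"
    using integrable_tame2[OF t1] integrable_tame2[OF t2] by simp
  also have "\<dots> = (\<integral>x. \<psi> x * (u \<bullet> x) \<partial>\<mu>)"
    by (intro integral_fst[of "\<lambda>x. \<psi> x * (u \<bullet> x)"] tame_intros tame)
  also have "(\<integral>z. \<psi>' (fst z) (snd z) * (u \<bullet> snd z) \<partial>\<mu>2) = (\<integral>x. \<psi>' x (cov_op u) \<partial>\<mu>)"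
    using integral_iterated(1)[OF t2] integral_linear_cov_op[OF has_derivative_bounded_linear[OF \<psi>]] by simp
  finally show ?thesis by simp
qed

text \<open>Along the rotation q moves from q(x) at t = 0 to q(y) at t = pi/2, and by independence
  E[p(x) (q(y) - q(x))] is minus the covariance. The time derivative G(x_t) . y_t is linear in y_t,
  which is what integration by parts needs.\<close>

lemma covariance_formula:
  assumes p: "\<And>x. (p has_derivative p' x) (at x)" "tame p" "tame (\<lambda>y. p' (fst y) (snd y))"
    and q: "\<And>x. (q has_derivative (\<lambda>h. G x \<bullet> h)) (at x)" "tame q" "tame G"
  shows "(\<integral>x. p x * q x \<partial>\<mu>) - (\<integral>x. p x \<partial>\<mu>) * (\<integral>x. q x \<partial>\<mu>)
      = (LBINT t:{0..pi/2}. sin t * (\<integral>z. p' (fst z) (cov_op (G (fst (rot t z)))) \<partial>\<mu>2))"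
    and "set_integrable lborel {0..pi/2} (\<lambda>t. sin t * (\<integral>z. p' (fst z) (cov_op (G (fst (rot t z)))) \<partial>\<mu>2))"
proof -
  note S = bounded_linear_cov_op
  let ?H = "\<lambda>x :: real \<times> 'a \<times> 'a. p (fst (snd x)) * (G (fst (rot (fst x) (snd x))) \<bullet> snd (rot (fst x) (snd x)))"
  have tH: "tame ?H"
    by (intro tame_intros tame_compose[OF p(2)] tame_compose[OF q(3)] tame_rot)
  let ?f = "\<lambda>t z. p' (fst z) (cov_op (G (fst (rot t z))))"
  have tf: "tame (?f t)" for t :: real
    by (rule tame_compose[OF p(3), of "\<lambda>z. (fst z, cov_op (G (fst (rot t z))))", simplified])
      (intro tame_intros tame_linear_comp[OF S] tame_compose[OF q(3)] tame_rot)
  have deriv: "((\<lambda>t. q (fst (rot t z))) has_vector_derivative G (fst (rot t z)) \<bullet> snd (rot t z)) (at t within T)" for t z T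
  proof -
    have "((\<lambda>t. fst (rot t z)) has_derivative (\<lambda>h. h *\<^sub>R snd (rot t z))) (at t within T)"
      using bounded_linear.has_vector_derivative[OF bounded_linear_fst rot_has_vector_derivative]
      by (simp add: has_vector_derivative_def)
    from has_derivative_compose[OF this q(1)] show ?thesis
      unfolding has_vector_derivative_def by (simp add: inner_simps)
  qed
  have ftc: "(LBINT t:{0..pi/2}. ?H (t, z)) = p (fst z) * q (snd z) - p (fst z) * q (fst z)" for z
  proof -
    have c: "continuous_on {0..pi/2} (\<lambda>t. G (fst (rot t z)) \<bullet> snd (rot t z))"
      by (intro tame_continuous tame_intros tame_compose[OF q(3)] tame_rot)
    have "(LBINT t:{0..pi/2}. G (fst (rot t z)) \<bullet> snd (rot t z)) = q (fst (rot (pi/2) z)) - q (fst (rot 0 z))"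
      using integral_FTC_atLeastAtMost[OF _ deriv c] by (simp add: set_lebesgue_integral_def)
    then show ?thesis by (simp add: rot_def right_diff_distrib)
  qed
  \<comment> \<open>Written in the rotated pair (x, y), the old first component is x cos t - y sin
    t. Integrating by parts in y for fixed x therefore produces the factor - sin t from the chain
    rule.\<close>
  have inner: "(\<integral>z. ?H (t, z) \<partial>\<mu>2) = - (sin t * (\<integral>z. ?f t z \<partial>\<mu>2))" for t
  proof -
    let ?h = "\<lambda>w. p (fst (rot (-t) w)) * (G (fst w) \<bullet> snd w)"
    have th: "tame ?h" by (intro tame_intros tame_compose[OF p(2)] tame_compose[OF q(3)] tame_rot)
    have by_parts: "(\<integral>y. p (cos t *\<^sub>R x - sin t *\<^sub>R y) * (G x \<bullet> y) \<partial>\<mu>)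
        = (\<integral>y. - (sin t * p' (cos t *\<^sub>R x - sin t *\<^sub>R y) (cov_op (G x))) \<partial>\<mu>)" for x
    proof -
      interpret p': bounded_linear "p' w" for w by (rule has_derivative_bounded_linear[OF p(1)])
      have "(\<integral>y. p (cos t *\<^sub>R x - sin t *\<^sub>R y) * (G x \<bullet> y) \<partial>\<mu>)
          = (\<integral>y. p' (cos t *\<^sub>R x - sin t *\<^sub>R y) (- (sin t *\<^sub>R cov_op (G x))) \<partial>\<mu>)"
      proof (rule integration_by_parts)
        show "((\<lambda>y. p (cos t *\<^sub>R x - sin t *\<^sub>R y)) has_derivative
            (\<lambda>h. p' (cos t *\<^sub>R x - sin t *\<^sub>R y) (- (sin t *\<^sub>R h)))) (at y)" for y
          by (rule has_derivative_compose[OF _ p(1)]) (auto intro!: derivative_eq_intros)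
        show "tame (\<lambda>y. p (cos t *\<^sub>R x - sin t *\<^sub>R y))"
          by (intro tame_intros tame_compose[OF p(2)])
        show "tame (\<lambda>y. p' (cos t *\<^sub>R x - sin t *\<^sub>R fst y) (- (sin t *\<^sub>R snd y)))"
          by (rule tame_compose[OF p(3), of "\<lambda>y. (cos t *\<^sub>R x - sin t *\<^sub>R fst y, - (sin t *\<^sub>R snd y))", simplified])
            (intro tame_intros)
      qed
      then show ?thesis by (simp add: p'.neg p'.scaleR)
    qed
    have "(\<integral>z. ?H (t, z) \<partial>\<mu>2) = (\<integral>z. ?h (rot t z) \<partial>\<mu>2)" by (simp add: rot_rot)
    also have "\<dots> = (\<integral>z. ?h z \<partial>\<mu>2)" by (rule integral_rot[OF th])
    also have "\<dots> = (\<integral>x. \<integral>y. p (cos t *\<^sub>R x - sin t *\<^sub>R y) * (G x \<bullet> y) \<partial>\<mu> \<partial>\<mu>)"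
      using integral_iterated(1)[OF th] by (simp add: rot_def)
    also have "\<dots> = (\<integral>x. \<integral>y. - (sin t * p' (cos t *\<^sub>R x - sin t *\<^sub>R y) (cov_op (G x))) \<partial>\<mu> \<partial>\<mu>)"
      by (simp only: by_parts)
    also have "\<dots> = (\<integral>z. - (sin t * ?f t (rot (-t) z)) \<partial>\<mu>2)"
    proof -
      have "tame (\<lambda>z. - (sin t * ?f t (rot (-t) z)))"
        by (intro tame_intros tame_compose[OF tf] tame_rot)
      from integral_iterated(1)[OF this] show ?thesis
        by (simp add: rot_rot) (auto simp: rot_def)
    qed
    also have "\<dots> = - (sin t * (\<integral>z. ?f t z \<partial>\<mu>2))"
      using integral_rot[OF tf, of "-t" t] by simp
    finally show ?thesis .
  qed
  have t1: "tame (\<lambda>z :: 'a \<times> 'a. p (fst z) * q (snd z))" "tame (\<lambda>z :: 'a \<times> 'a. p (fst z) * q (fst z))"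
    by (intro tame_intros tame_compose[OF p(2)] tame_compose[OF q(2)])+
  have "(\<integral>x. p x \<partial>\<mu>) * (\<integral>x. q x \<partial>\<mu>) - (\<integral>x. p x * q x \<partial>\<mu>)
      = (\<integral>z. p (fst z) * q (snd z) - p (fst z) * q (fst z) \<partial>\<mu>2)"
    using integrable_tame2[OF t1(1)] integrable_tame2[OF t1(2)] integral_product[OF p(2) q(2)]
      integral_fst[OF tame_mult[OF p(2) q(2)]] by simp
  also have "\<dots> = (LBINT t:{0..pi/2}. (\<integral>z. ?H (t, z) \<partial>\<mu>2))"
    using path_fubini(1)[OF tH, of 0 "pi/2"] unfolding ftc .
  also have "\<dots> = - (LBINT t:{0..pi/2}. sin t * (\<integral>z. ?f t z \<partial>\<mu>2))"
    unfolding inner by (simp add: set_lebesgue_integral_def)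
  finally show "(\<integral>x. p x * q x \<partial>\<mu>) - (\<integral>x. p x \<partial>\<mu>) * (\<integral>x. q x \<partial>\<mu>)
      = (LBINT t:{0..pi/2}. sin t * (\<integral>z. ?f t z \<partial>\<mu>2))" by simp
  show "set_integrable lborel {0..pi/2} (\<lambda>t. sin t * (\<integral>z. ?f t z \<partial>\<mu>2))"
    using path_fubini(2)[OF tH, of 0 "pi/2"] unfolding inner set_integrable_def by simp
qed

lemma sin_integral: "(LBINT t:{0..pi/2}. sin t) = 1" "set_integrable lborel {0..pi/2} sin"
proof -
  have "(LBINT t:{0..pi/2}. sin t) = - cos (pi/2) - (- cos 0)"
    unfolding set_lebesgue_integral_def
    by (rule integral_FTC_atLeastAtMost)
      (auto intro!: derivative_eq_intros continuous_intros simp flip: has_real_derivative_iff_has_vector_derivative)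
  then show "(LBINT t:{0..pi/2}. sin t) = 1" by simp
  show "set_integrable lborel {0..pi/2} sin"
    by (rule borel_integrable_atLeastAtMost') (intro continuous_intros)
qed

text \<open>The weight sin t is a probability density on [0, pi/2], so a bound that is uniform in
  \<open>t\<close> survives the averaging with the same constant.\<close>

lemma abs_sin_weighted_integral_le:
  assumes "set_integrable lborel {0..pi/2} (\<lambda>t. sin t * f t)" "\<And>t. t \<in> {0..pi/2} \<Longrightarrow> \<bar>f t\<bar> \<le> C"
  shows "\<bar>LBINT t:{0..pi/2}. sin t * f t\<bar> \<le> C"
proof -
  have sin: "0 \<le> sin t" if "t \<in> {0..pi/2}" for t using that by (auto intro: sin_ge_zero)
  have "\<bar>LBINT t:{0..pi/2}. sin t * f t\<bar> \<le> (LBINT t:{0..pi/2}. \<bar>sin t * f t\<bar>)"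
    using set_integral_norm_bound[OF assms(1)] by simp
  also have "\<dots> \<le> (LBINT t:{0..pi/2}. sin t * C)"
    using assms sin sin_integral(2) set_integrable_abs[OF assms(1)]
    by (intro set_integral_mono) (auto simp: abs_mult intro!: mult_left_mono)
  also have "\<dots> = C" by (simp add: sin_integral)
  finally show ?thesis .
qed

text \<open>Under the integral |pq| is at most (p^2 + q^2) / 2. The sum form suits its use at two
  points with the same law, where both squares have the same expectation.\<close>

lemma abs_inner_cov_op_le:
  assumes s: "\<And>u. u \<bullet> cov_op u \<le> s * (norm u)\<^sup>2"
  shows "\<bar>u \<bullet> cov_op v\<bar> \<le> s * ((norm u)\<^sup>2 + (norm v)\<^sup>2) / 2"
proof -
  have int: "integrable \<mu> (\<lambda>z. (a \<bullet> z) * (b \<bullet> z))" for a b by (intro integrable_tame tame_intros)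
  have "\<bar>u \<bullet> cov_op v\<bar> \<le> (\<integral>z. \<bar>(u \<bullet> z) * (v \<bullet> z)\<bar> \<partial>\<mu>)" unfolding inner_cov_op by (rule integral_abs_bound)
  also have "\<dots> \<le> (\<integral>z. ((u \<bullet> z) * (u \<bullet> z) + (v \<bullet> z) * (v \<bullet> z)) / 2 \<partial>\<mu>)"
  proof (rule integral_mono)
    show "\<bar>(u \<bullet> z) * (v \<bullet> z)\<bar> \<le> ((u \<bullet> z) * (u \<bullet> z) + (v \<bullet> z) * (v \<bullet> z)) / 2" for z
      using sum_squares_bound[of "\<bar>u \<bullet> z\<bar>" "\<bar>v \<bullet> z\<bar>"] by (simp add: abs_mult power2_eq_square field_simps)
  qed (use int in auto)
  also have "\<dots> = (u \<bullet> cov_op u + v \<bullet> cov_op v) / 2"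
    using int by (simp add: inner_cov_op)
  finally show ?thesis using s[of u] s[of v] by (simp add: distrib_left)
qed

lemma norm_cov_op_le:
  assumes s: "\<And>u. u \<bullet> cov_op u \<le> s * (norm u)\<^sup>2"
  shows "norm (cov_op v) \<le> s * norm v"
proof (cases "v = 0 \<or> cov_op v = 0")
  case True
  interpret S: bounded_linear cov_op by (rule bounded_linear_cov_op)
  \<comment> \<open>The sign of \<open>s\<close> is not among the assumptions; it is recovered from
    the positivity of the covariance form.\<close>
  have "0 \<le> s * (norm v)\<^sup>2"
    using s[of v] unfolding inner_cov_op by (rule order_trans[rotated]) (simp add: Bochner_Integration.integral_nonneg)
  then have "0 \<le> s * norm v" by (auto simp: zero_le_mult_iff)
  with True show ?thesis by (auto simp: S.zero)
next
  case False
  let ?w = "cov_op v"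
  \<comment> \<open>Rescaling \<open>cov_op v\<close> to the length of \<open>v\<close> makes the
    two squares in the preceding estimate equal, which turns the bound by a sum into the required
    product.\<close>
  define u where "u = (norm v / norm ?w) *\<^sub>R ?w"
  have nu: "norm u = norm v" using False by (simp add: u_def)
  have "u \<bullet> ?w = norm v * norm ?w" using False by (simp add: u_def power2_norm_eq_inner[symmetric] power2_eq_square)
  then have "norm v * norm ?w \<le> s * (norm v)\<^sup>2"
    using abs_inner_cov_op_le[OF s, of u v] nu by simp
  then show ?thesis using False by (simp add: power2_eq_square)
qed

text \<open>This is the covariance formula with p = q. The points x and x_t have the same law, so
  each contributes half of \<open>s\<close> times the expectation of the squared gradient
  bound.\<close>

lemma poincare_inequality:
  fixes q :: "'a \<Rightarrow> real"
  assumes s: "\<And>u. u \<bullet> cov_op u \<le> s * (norm u)\<^sup>2" "0 \<le> s"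
    and q: "\<And>x. (q has_derivative q' x) (at x)" "tame q" "tame (\<lambda>y. q' (fst y) (snd y))"
    and L: "\<And>x v. \<bar>q' x v\<bar> \<le> L x * norm v" "tame L"
  shows "(\<integral>x. (q x)\<^sup>2 \<partial>\<mu>) - (\<integral>x. q x \<partial>\<mu>)\<^sup>2 \<le> s * (\<integral>x. (L x)\<^sup>2 \<partial>\<mu>)"
proof -
  \<comment> \<open>The gradient is rebuilt from the values of the derivative on the basis, because
    the covariance formula asks for one of its two derivatives as an inner product.\<close>
  define G where "G x = (\<Sum>b\<in>Basis. q' x b *\<^sub>R b)" for x
  have G: "q' x h = G x \<bullet> h" for x h
  proof -
    interpret q': bounded_linear "q' x" by (rule has_derivative_bounded_linear[OF q(1)])
    have "q' x h = q' x (\<Sum>b\<in>Basis. (h \<bullet> b) *\<^sub>R b)" by (simp add: euclidean_representation)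
    also have "\<dots> = G x \<bullet> h"
      unfolding q'.sum q'.scaleR G_def inner_sum_left by (intro sum.cong) (auto simp: inner_commute)
    finally show ?thesis .
  qed
  have tG: "tame G"
    unfolding G_def
    by (intro tame_sum tame_scaleR tame_const tame_compose[OF q(3), of "\<lambda>x. (x, b)" for b, simplified] tame_Pair tame_ident)
  have nG: "norm (G x) \<le> \<bar>L x\<bar>" for x
  proof (cases "G x = 0")
    case False
    have "norm (G x) * norm (G x) = \<bar>q' x (G x)\<bar>" by (simp add: G power2_eq_square[symmetric] power2_norm_eq_inner)
    also have "\<dots> \<le> L x * norm (G x)" by (rule L)
    finally show ?thesis using False by simp
  qed simp
  have nG2: "(norm (G x))\<^sup>2 \<le> (L x)\<^sup>2" for x using power_mono[OF nG norm_ge_zero, of x 2] by simp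
  have tL: "tame (\<lambda>x. (L x)\<^sup>2)" by (intro tame_intros L)
  have qd: "\<And>x. (q has_derivative (\<lambda>h. G x \<bullet> h)) (at x)" using q(1) unfolding G .
  have tq': "tame (\<lambda>y. G (fst y) \<bullet> snd y)" using q(3) by (simp add: G)
  note cov = covariance_formula[OF qd q(2) tq' qd q(2) tG]
  have "\<bar>\<integral>z. G (fst z) \<bullet> cov_op (G (fst (rot t z))) \<partial>\<mu>2\<bar> \<le> s * (\<integral>x. (L x)\<^sup>2 \<partial>\<mu>)" for t
  proof -
    have "\<bar>\<integral>z. G (fst z) \<bullet> cov_op (G (fst (rot t z))) \<partial>\<mu>2\<bar> \<le> (\<integral>z. \<bar>G (fst z) \<bullet> cov_op (G (fst (rot t z)))\<bar> \<partial>\<mu>2)"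
      by (rule integral_abs_bound)
    also have "\<dots> \<le> (\<integral>z. s / 2 * (L (fst z))\<^sup>2 + s / 2 * (L (fst (rot t z)))\<^sup>2 \<partial>\<mu>2)"
    proof (rule integral_mono)
      show "integrable \<mu>2 (\<lambda>z. \<bar>G (fst z) \<bullet> cov_op (G (fst (rot t z)))\<bar>)"
        by (intro integrable_abs integrable_tame2 tame_intros tame_linear_comp[OF bounded_linear_cov_op] tame_compose[OF tG] tame_rot)
      show "integrable \<mu>2 (\<lambda>z. s / 2 * (L (fst z))\<^sup>2 + s / 2 * (L (fst (rot t z)))\<^sup>2)"
        by (intro integrable_tame2 tame_intros tame_compose[OF L(2)] tame_rot)
      fix z
      have "\<bar>G (fst z) \<bullet> cov_op (G (fst (rot t z)))\<bar> \<le> s * ((norm (G (fst z)))\<^sup>2 + (norm (G (fst (rot t z))))\<^sup>2) / 2"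
        by (rule abs_inner_cov_op_le[OF s(1)])
      also have "\<dots> \<le> s * ((L (fst z))\<^sup>2 + (L (fst (rot t z)))\<^sup>2) / 2"
        using s(2) nG2 by (intro divide_right_mono mult_left_mono add_mono) auto
      finally show "\<bar>G (fst z) \<bullet> cov_op (G (fst (rot t z)))\<bar> \<le> s / 2 * (L (fst z))\<^sup>2 + s / 2 * (L (fst (rot t z)))\<^sup>2"
        by (simp add: algebra_simps add_divide_distrib)
    qed
    also have "\<dots> = s * (\<integral>x. (L x)\<^sup>2 \<partial>\<mu>)"
    proof -
      have "integrable \<mu>2 (\<lambda>z. (L (fst z))\<^sup>2)" "integrable \<mu>2 (\<lambda>z. (L (fst (rot t z)))\<^sup>2)"
        by (intro integrable_tame2 tame_intros tame_compose[OF L(2)] tame_rot)+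
      then show ?thesis by (simp add: integral_fst[OF tL] integral_fst_rot[OF tL])
    qed
    finally show ?thesis .
  qed
  then have "\<bar>LBINT t:{0..pi/2}. sin t * (\<integral>z. G (fst z) \<bullet> cov_op (G (fst (rot t z))) \<partial>\<mu>2)\<bar> \<le> s * (\<integral>x. (L x)\<^sup>2 \<partial>\<mu>)"
    by (intro abs_sin_weighted_integral_le cov(2))
  then show ?thesis unfolding cov(1)[symmetric] by (simp add: power2_eq_square)
qed


text \<open>The variance of g is itself given by the covariance formula with p = q = g. The defect
  is therefore the sin t average of E[\<phi>'(g) \<tau>] - E[\<phi>'(g)] E[\<tau>]. As \<phi>'(g(x))
  does not involve y, this is for fixed y a covariance in x, of size at most D times the standard
  deviation of \<tau> in x.\<close>

lemma second_order_stein: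
  fixes g :: "'a \<Rightarrow> real" and G :: "'a \<Rightarrow> 'a" and DG :: "'a \<Rightarrow> 'a \<Rightarrow> 'a"
  assumes s: "\<And>u. u \<bullet> cov_op u \<le> s * (norm u)\<^sup>2" "0 < s"
    and g: "\<And>x. (g has_derivative (\<lambda>h. G x \<bullet> h)) (at x)" "tame g"
    and G: "\<And>x. (G has_derivative DG x) (at x)" "tame G" "tame (\<lambda>p. DG (fst p) (snd p))"
    and k1: "\<And>x. norm (G x) \<le> k1 x" "tame k1" "(\<integral>x. k1 x ^ 4 \<partial>\<mu>) \<le> \<kappa>1 ^ 4" "0 < \<kappa>1"
    and k2: "\<And>x v. norm (DG x v) \<le> k2 x * norm v" "\<And>x. 0 \<le> k2 x" "tame k2" "(\<integral>x. k2 x ^ 4 \<partial>\<mu>) \<le> \<kappa>2 ^ 4" "0 < \<kappa>2"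
    and \<phi>: "\<And>w. (\<phi> has_real_derivative \<phi>' w) (at w)" "continuous_on UNIV \<phi>'" "\<And>w. \<bar>\<phi> w\<bar> \<le> C" "\<And>w. \<bar>\<phi>' w\<bar> \<le> D"
  shows "\<bar>(\<integral>x. \<phi> (g x) * g x \<partial>\<mu>) - (\<integral>x. \<phi> (g x) \<partial>\<mu>) * (\<integral>x. g x \<partial>\<mu>)
      - (\<integral>x. \<phi>' (g x) \<partial>\<mu>) * ((\<integral>x. (g x)\<^sup>2 \<partial>\<mu>) - (\<integral>x. g x \<partial>\<mu>)\<^sup>2)\<bar> \<le> D * (2 * s * sqrt s * \<kappa>1 * \<kappa>2)"
proof -
  note S = bounded_linear_cov_op
  \<comment> \<open>\<open>B\<close> bounds the root mean square over \<open>y\<close> of the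
    standard deviation of \<open>\<tau> t (x, y)\<close> in \<open>x\<close>. In its square, one
    \<open>s\<close> comes from the Poincare inequality, two from the gradient bound
    \<open>s * L\<close>, and the rest from the second moment of \<open>L\<close>.\<close>
  define B where "B = 2 * s * sqrt s * \<kappa>1 * \<kappa>2"
  have B: "0 < B" "B\<^sup>2 = 4 * s ^ 3 * (\<kappa>1\<^sup>2 * \<kappa>2\<^sup>2)"
    using s k1(4) k2(5) by (auto simp: B_def power_mult_distrib power2_eq_square power3_eq_cube algebra_simps)
  have D: "0 \<le> D" using \<phi>(4)[of 0] by linarith
  have k1_nonneg: "0 \<le> k1 x" for x using k1(1)[of x] norm_ge_zero order_trans by blast
  have t\<phi>': "tame (\<lambda>x. \<phi>' (g x))"
    by (rule tame_compose[OF _ g(2)]) (use \<phi> in \<open>auto intro!: tame_bounded[where C=D]\<close>)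
  have c\<phi>: "continuous_on UNIV \<phi>"
    using \<phi>(1) by (meson DERIV_isCont continuous_at_imp_continuous_on)
  have t\<phi>: "tame (\<lambda>x. \<phi> (g x))"
    by (rule tame_compose[OF _ g(2)]) (use \<phi> c\<phi> in \<open>auto intro!: tame_bounded[where C=C]\<close>)
  define \<tau> where "\<tau> t z = G (fst z) \<bullet> cov_op (G (fst (rot t z)))" for t z
  \<comment> \<open>Up to the factor \<open>s\<close> this bounds the gradient of
    \<open>\<tau> t (x, y)\<close> in \<open>x\<close>. There is one summand for each factor of the
    inner product; the chain rule factor cos t in the second is estimated by 1.\<close>
  define L where "L t z = k2 (fst z) * k1 (fst (rot t z)) + k1 (fst z) * k2 (fst (rot t z))" for t z
  have t\<tau>: "tame (\<tau> t)" for t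
    unfolding \<tau>_def by (intro tame_intros tame_linear_comp[OF S] tame_compose[OF G(2)] tame_rot)
  have tL: "tame (L t)" for t
    unfolding L_def by (intro tame_intros tame_compose[OF k1(2)] tame_compose[OF k2(3)] tame_rot)
  have t\<phi>\<tau>: "tame (\<lambda>z. \<phi>' (g (fst z)) * \<tau> t z)" for t
    by (intro tame_intros t\<tau> tame_compose[OF t\<phi>'])
  have tsec: "tame (\<lambda>x. f (x, y))" if "tame f" for f :: "'a \<times> 'a \<Rightarrow> real" and y
    by (intro tame_compose[OF that] tame_intros)

  have var_\<tau>: "(\<integral>x. (\<tau> t (x, y))\<^sup>2 \<partial>\<mu>) - (\<integral>x. \<tau> t (x, y) \<partial>\<mu>)\<^sup>2 \<le> s * (\<integral>x. (s * L t (x, y))\<^sup>2 \<partial>\<mu>)" for t y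
  proof (rule poincare_inequality[OF s(1) less_imp_le[OF s(2)]])
    let ?r = "\<lambda>x. cos t *\<^sub>R x + sin t *\<^sub>R y"
    let ?q' = "\<lambda>x v. DG x v \<bullet> cov_op (G (?r x)) + G x \<bullet> cov_op (DG (?r x) (cos t *\<^sub>R v))"
    have r: "(?r has_derivative (\<lambda>v. cos t *\<^sub>R v)) (at x)" for x by (auto intro!: derivative_eq_intros)
    have "((\<lambda>x. cov_op (G (?r x))) has_derivative (\<lambda>v. cov_op (DG (?r x) (cos t *\<^sub>R v)))) (at x)" for x
      by (rule bounded_linear.has_derivative[OF S has_derivative_compose[OF r G(1)]])
    from has_derivative_inner[OF G(1) this]
    show "((\<lambda>x. \<tau> t (x, y)) has_derivative ?q' x) (at x)" for x
      by (simp add: \<tau>_def rot_def add.commute)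
    show "tame (\<lambda>x. \<tau> t (x, y))" by (rule tsec[OF t\<tau>])
    have "tame (\<lambda>w. DG (?r (fst w)) (cos t *\<^sub>R snd w))"
      by (rule tame_compose[OF G(3), of "\<lambda>w. (?r (fst w), cos t *\<^sub>R snd w)", simplified]) (intro tame_intros)
    then show "tame (\<lambda>w. ?q' (fst w) (snd w))"
      by (intro tame_intros G(3) tame_linear_comp[OF S] tame_compose[OF G(2)])
    show "tame (\<lambda>x. s * L t (x, y))" by (intro tame_intros tsec[OF tL])
    fix x v
    have nS: "norm (cov_op w) \<le> s * norm w" for w by (rule norm_cov_op_le[OF s(1)])
    have "\<bar>DG x v \<bullet> cov_op (G (?r x))\<bar> \<le> norm (DG x v) * norm (cov_op (G (?r x)))"
      by (rule Cauchy_Schwarz_ineq2)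
    also have "\<dots> \<le> (k2 x * norm v) * (s * k1 (?r x))"
      using k2 s(2) k1(1) by (intro mult_mono order_trans[OF nS] mult_left_mono) auto
    finally have 1: "\<bar>DG x v \<bullet> cov_op (G (?r x))\<bar> \<le> s * (k2 x * k1 (?r x)) * norm v" by (simp add: ac_simps)
    have "\<bar>G x \<bullet> cov_op (DG (?r x) (cos t *\<^sub>R v))\<bar> \<le> norm (G x) * norm (cov_op (DG (?r x) (cos t *\<^sub>R v)))"
      by (rule Cauchy_Schwarz_ineq2)
    also have "\<dots> \<le> k1 x * (s * (k2 (?r x) * norm v))"
    proof (intro mult_mono order_trans[OF nS] mult_left_mono)
      have "norm (DG (?r x) (cos t *\<^sub>R v)) \<le> k2 (?r x) * (\<bar>cos t\<bar> * norm v)" using k2(1)[of "?r x" "cos t *\<^sub>R v"] by simp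
      also have "\<dots> \<le> k2 (?r x) * norm v"
        using k2(2) by (intro mult_left_mono mult_left_le_one_le) auto
      finally show "norm (DG (?r x) (cos t *\<^sub>R v)) \<le> k2 (?r x) * norm v" .
    qed (use k1 k1_nonneg s in auto)
    finally have 2: "\<bar>G x \<bullet> cov_op (DG (?r x) (cos t *\<^sub>R v))\<bar> \<le> s * (k1 x * k2 (?r x)) * norm v" by (simp add: ac_simps)
    show "\<bar>?q' x v\<bar> \<le> s * L t (x, y) * norm v"
      using 1 2 unfolding L_def rot_def by (simp add: algebra_simps)
  qed

  have L4: "(\<integral>z. (L t z)\<^sup>2 \<partial>\<mu>2) \<le> 4 * (\<kappa>1\<^sup>2 * \<kappa>2\<^sup>2)" for t
  proof -
    \<comment> \<open>This weight balances the arithmetic-geometric mean inequality: c \<kappa>2^4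
      and \<kappa>1^4 / c both equal \<kappa>1^2 \<kappa>2^2.\<close>
    define c where "c = (\<kappa>1 / \<kappa>2)\<^sup>2"
    have c: "0 < c" using k1(4) k2(5) by (simp add: c_def)
    let ?a = "\<lambda>z :: 'a \<times> 'a. k2 (fst z) ^ 4" and ?b = "\<lambda>z. k1 (fst (rot t z)) ^ 4"
      and ?d = "\<lambda>z :: 'a \<times> 'a. k1 (fst z) ^ 4" and ?e = "\<lambda>z. k2 (fst (rot t z)) ^ 4"
    have tk: "tame (\<lambda>x. k1 x ^ 4)" "tame (\<lambda>x. k2 x ^ 4)" by (intro tame_power k1 k2)+
    have int: "integrable \<mu>2 ?a" "integrable \<mu>2 ?b" "integrable \<mu>2 ?d" "integrable \<mu>2 ?e"
      by (intro integrable_tame2 tame_power tame_compose[OF k1(2)] tame_compose[OF k2(3)] tame_fst tame_rot tame_const tame_ident)+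
    have am_gm: "(p * q + r * u)\<^sup>2 \<le> c * p ^ 4 + (1/c) * q ^ 4 + (1/c) * r ^ 4 + c * u ^ 4" for p q r u :: real
    proof -
      have pq: "2 * (p * q)\<^sup>2 \<le> c * p ^ 4 + (1/c) * q ^ 4" for p q :: real
      proof -
        have "0 \<le> (sqrt c * p\<^sup>2 - q\<^sup>2 / sqrt c)\<^sup>2" by simp
        also have "\<dots> = c * p ^ 4 + (1/c) * q ^ 4 - 2 * (p * q)\<^sup>2"
          using c by (simp add: power2_diff power_mult_distrib power_divide)
        finally show ?thesis by simp
      qed
      have "0 \<le> (p * q - r * u)\<^sup>2" by simp
      then have "(p * q + r * u)\<^sup>2 \<le> 2 * (p * q)\<^sup>2 + 2 * (u * r)\<^sup>2"
        by (simp add: power2_eq_square algebra_simps)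
      then show ?thesis using pq[of p q] pq[of u r] by linarith
    qed
    have "(\<integral>z. (L t z)\<^sup>2 \<partial>\<mu>2) \<le> (\<integral>z. c * ?a z + (1/c) * ?b z + (1/c) * ?d z + c * ?e z \<partial>\<mu>2)"
    proof (rule integral_mono)
      show "integrable \<mu>2 (\<lambda>z. (L t z)\<^sup>2)" by (intro integrable_tame2 tame_power tL)
      show "integrable \<mu>2 (\<lambda>z. c * ?a z + (1/c) * ?b z + (1/c) * ?d z + c * ?e z)"
        by (intro Bochner_Integration.integrable_add integrable_mult_right int)
      show "(L t z)\<^sup>2 \<le> c * ?a z + (1/c) * ?b z + (1/c) * ?d z + c * ?e z" for z
        unfolding L_def by (rule am_gm)
    qed
    also have "\<dots> = c * (\<integral>x. k2 x ^ 4 \<partial>\<mu>) + (1/c) * (\<integral>x. k1 x ^ 4 \<partial>\<mu>) + (1/c) * (\<integral>x. k1 x ^ 4 \<partial>\<mu>) + c * (\<integral>x. k2 x ^ 4 \<partial>\<mu>)"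
      using int by (simp add: integral_fst[OF tk(1)] integral_fst[OF tk(2)] integral_fst_rot[OF tk(1)] integral_fst_rot[OF tk(2)])
    also have "\<dots> \<le> c * \<kappa>2 ^ 4 + (1/c) * \<kappa>1 ^ 4 + (1/c) * \<kappa>1 ^ 4 + c * \<kappa>2 ^ 4"
      using c k1(3) k2(4) by (intro add_mono mult_left_mono) auto
    also have "\<dots> = 4 * (\<kappa>1\<^sup>2 * \<kappa>2\<^sup>2)"
      using k1(4) k2(5) by (simp add: c_def field_simps power2_eq_square power4_eq_xxxx)
    finally show ?thesis .
  qed

  define m where "m t y = (\<integral>x. \<tau> t (x, y) \<partial>\<mu>)" for t y
  define V where "V t y = s * (\<integral>x. (s * L t (x, y))\<^sup>2 \<partial>\<mu>)" for t y
  have slice: "\<bar>(\<integral>x. \<phi>' (g x) * \<tau> t (x, y) \<partial>\<mu>) - (\<integral>x. \<phi>' (g x) \<partial>\<mu>) * m t y\<bar> \<le> D / 2 * (V t y / B + B)" for t y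
  proof -
    have i1: "integrable \<mu> (\<lambda>x. \<tau> t (x, y))" "integrable \<mu> (\<lambda>x. (\<tau> t (x, y))\<^sup>2)"
      by (intro integrable_tame tame_power tsec[OF t\<tau>])+
    have i2: "integrable \<mu> (\<lambda>x. \<phi>' (g x) * \<tau> t (x, y))" "integrable \<mu> (\<lambda>x. \<phi>' (g x))"
      by (intro integrable_tame tame_mult t\<phi>' tsec[OF t\<tau>])+
    have var: "(\<integral>x. (\<tau> t (x, y) - m t y)\<^sup>2 \<partial>\<mu>) = (\<integral>x. (\<tau> t (x, y))\<^sup>2 \<partial>\<mu>) - (m t y)\<^sup>2"
      using i1 unfolding m_def by (rule variance_eq)
    have i3: "integrable \<mu> (\<lambda>x. (\<tau> t (x, y) - m t y)\<^sup>2)"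
      by (intro integrable_tame tame_intros tsec[OF t\<tau>])
    have "(\<integral>x. \<phi>' (g x) * \<tau> t (x, y) \<partial>\<mu>) - (\<integral>x. \<phi>' (g x) \<partial>\<mu>) * m t y = (\<integral>x. \<phi>' (g x) * (\<tau> t (x, y) - m t y) \<partial>\<mu>)"
      using i2 by (simp add: right_diff_distrib)
    also have "\<bar>\<dots>\<bar> \<le> (\<integral>x. \<bar>\<phi>' (g x) * (\<tau> t (x, y) - m t y)\<bar> \<partial>\<mu>)" by (rule integral_abs_bound)
    \<comment> \<open>The inequality 2 |d| \<le> d^2 / B + B stands in for Cauchy-Schwarz. It keeps
      the estimate linear in the variance in \<open>x\<close>, so that averaging over
      \<open>y\<close> involves no square root, and \<open>B\<close> is the size of d for which it
      loses nothing.\<close>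
    also have "\<dots> \<le> (\<integral>x. D / 2 * ((\<tau> t (x, y) - m t y)\<^sup>2 / B + B) \<partial>\<mu>)"
    proof (rule integral_mono)
      show "integrable \<mu> (\<lambda>x. \<bar>\<phi>' (g x) * (\<tau> t (x, y) - m t y)\<bar>)"
        by (intro integrable_abs integrable_tame tame_intros t\<phi>' tsec[OF t\<tau>])
      show "integrable \<mu> (\<lambda>x. D / 2 * ((\<tau> t (x, y) - m t y)\<^sup>2 / B + B))"
        using i3 by simp
      fix x
      let ?d = "\<tau> t (x, y) - m t y"
      have "0 \<le> (\<bar>?d\<bar> - B)\<^sup>2" by simp
      then have "2 * B * \<bar>?d\<bar> \<le> ?d\<^sup>2 + B\<^sup>2" by (simp add: power2_diff algebra_simps)
      then have "\<bar>?d\<bar> \<le> (?d\<^sup>2 / B + B) / 2" using B(1) by (simp add: field_simps power2_eq_square)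
      then have "\<bar>\<phi>' (g x)\<bar> * \<bar>?d\<bar> \<le> D * ((?d\<^sup>2 / B + B) / 2)"
        using \<phi>(4) D by (intro mult_mono) auto
      then show "\<bar>\<phi>' (g x) * ?d\<bar> \<le> D / 2 * (?d\<^sup>2 / B + B)" by (simp add: abs_mult)
    qed
    also have "\<dots> = D / 2 * ((\<integral>x. (\<tau> t (x, y) - m t y)\<^sup>2 \<partial>\<mu>) / B + B)"
      using i3 by (simp add: prob_space)
    also have "\<dots> \<le> D / 2 * (V t y / B + B)"
      using var_\<tau>[of t y] B(1) D unfolding var
      by (intro mult_left_mono add_mono divide_right_mono) (auto simp: V_def m_def)
    finally show ?thesis .
  qed

  have decouple: "\<bar>(\<integral>z. \<phi>' (g (fst z)) * \<tau> t z \<partial>\<mu>2) - (\<integral>x. \<phi>' (g x) \<partial>\<mu>) * (\<integral>z. \<tau> t z \<partial>\<mu>2)\<bar> \<le> D * B" for t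
  proof -
    have tL2: "tame (\<lambda>z. (s * L t z)\<^sup>2)" by (intro tame_intros tL)
    note I1 = integral_iterated[OF t\<phi>\<tau>[of t]] and I2 = integral_iterated[OF t\<tau>[of t]] and I3 = integral_iterated[OF tL2]
    have iV: "integrable \<mu> (V t)" unfolding V_def using I3(4) by simp
    have im: "integrable \<mu> (m t)" unfolding m_def using I2(4) by simp
    have i1: "integrable \<mu> (\<lambda>y. \<integral>x. \<phi>' (g x) * \<tau> t (x, y) \<partial>\<mu>)" using I1(4) by simp
    have "(\<integral>y. V t y \<partial>\<mu>) = s * (\<integral>z. (s * L t z)\<^sup>2 \<partial>\<mu>2)" unfolding V_def I3(2) by simp
    also have "\<dots> = s ^ 3 * (\<integral>z. (L t z)\<^sup>2 \<partial>\<mu>2)" by (simp add: power_mult_distrib power2_eq_square[of s] power3_eq_cube)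
    also have "\<dots> \<le> s ^ 3 * (4 * (\<kappa>1\<^sup>2 * \<kappa>2\<^sup>2))" using L4 s(2) by (intro mult_left_mono) auto
    finally have VB: "(\<integral>y. V t y \<partial>\<mu>) \<le> B\<^sup>2" using B(2) by simp
    have "(\<integral>z. \<phi>' (g (fst z)) * \<tau> t z \<partial>\<mu>2) - (\<integral>x. \<phi>' (g x) \<partial>\<mu>) * (\<integral>z. \<tau> t z \<partial>\<mu>2)
        = (\<integral>y. (\<integral>x. \<phi>' (g x) * \<tau> t (x, y) \<partial>\<mu>) - (\<integral>x. \<phi>' (g x) \<partial>\<mu>) * m t y \<partial>\<mu>)"
      unfolding I1(2) I2(2) m_def[symmetric] using im i1 by simp
    also have "\<bar>\<dots>\<bar> \<le> (\<integral>y. \<bar>(\<integral>x. \<phi>' (g x) * \<tau> t (x, y) \<partial>\<mu>) - (\<integral>x. \<phi>' (g x) \<partial>\<mu>) * m t y\<bar> \<partial>\<mu>)"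
      by (rule integral_abs_bound)
    also have "\<dots> \<le> (\<integral>y. D / 2 * (V t y / B + B) \<partial>\<mu>)"
      using i1 im iV by (intro integral_mono slice) auto
    also have "\<dots> = D / 2 * ((\<integral>y. V t y \<partial>\<mu>) / B + B)" using iV by (simp add: prob_space)
    also have "\<dots> \<le> D / 2 * (B\<^sup>2 / B + B)"
      using VB B(1) D by (intro mult_left_mono add_mono divide_right_mono) auto
    also have "\<dots> = D * B" using B(1) by (simp add: power2_eq_square)
    finally show ?thesis .
  qed

  have p: "((\<lambda>x. \<phi> (g x)) has_derivative (\<lambda>v. \<phi>' (g x) * (G x \<bullet> v))) (at x)" for x
    using has_derivative_compose[OF g(1) \<phi>(1)[unfolded has_field_derivative_def]] .
  have tp: "tame (\<lambda>y. \<phi>' (g (fst y)) * (G (fst y) \<bullet> snd y))"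
    by (intro tame_intros tame_compose[OF t\<phi>'] tame_compose[OF G(2)])
  have tp': "tame (\<lambda>y :: 'a \<times> 'a. G (fst y) \<bullet> snd y)"
    by (intro tame_intros tame_compose[OF G(2)])
  note C1 = covariance_formula[OF p t\<phi> tp g G(2), folded \<tau>_def]
  note C2 = covariance_formula[OF g tp' g G(2), folded \<tau>_def]
  let ?E = "\<integral>x. \<phi>' (g x) \<partial>\<mu>"
  let ?r = "\<lambda>t. (\<integral>z. \<phi>' (g (fst z)) * \<tau> t z \<partial>\<mu>2) - ?E * (\<integral>z. \<tau> t z \<partial>\<mu>2)"
  have si: "set_integrable lborel {0..pi/2} (\<lambda>t. ?E * (sin t * (\<integral>z. \<tau> t z \<partial>\<mu>2)))"
    using C2(2) by simp
  have split: "sin t * ?r t = sin t * (\<integral>z. \<phi>' (g (fst z)) * \<tau> t z \<partial>\<mu>2) - ?E * (sin t * (\<integral>z. \<tau> t z \<partial>\<mu>2))" for t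
    by (simp add: algebra_simps)
  have "(\<integral>x. \<phi> (g x) * g x \<partial>\<mu>) - (\<integral>x. \<phi> (g x) \<partial>\<mu>) * (\<integral>x. g x \<partial>\<mu>)
      - ?E * ((\<integral>x. (g x)\<^sup>2 \<partial>\<mu>) - (\<integral>x. g x \<partial>\<mu>)\<^sup>2) = (LBINT t:{0..pi/2}. sin t * ?r t)"
    unfolding split using C1 C2(1) si by (simp add: power2_eq_square)
  also have "\<bar>\<dots>\<bar> \<le> D * B"
  proof (rule abs_sin_weighted_integral_le)
    show "set_integrable lborel {0..pi/2} (\<lambda>t. sin t * ?r t)"
      unfolding split using C1(2) si by (rule set_integral_diff(1))
  qed (rule decouple)
  finally show ?thesis by (simp add: B_def)
qed

end

section \<open>Stein's method\<close>

lemma std_normal_density_DERIV: "(std_normal_density has_real_derivative - x * std_normal_density x) (at x within S)"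
  unfolding std_normal_density_def
  by (rule derivative_eq_intros refl | simp)+

lemma tendsto_std_normal_density_at_top: "(std_normal_density \<longlongrightarrow> 0) at_top"
proof -
  have "((\<lambda>x::real. 1 / sqrt (2 * pi) * exp (- x\<^sup>2 / 2)) \<longlongrightarrow> 0) at_top" by real_asymp
  then show ?thesis by (simp add: std_normal_density_def[abs_def])
qed

lemma integrable_std_normal_density: "integrable lborel std_normal_density"
  using integrable_normal_density[of 1 0] by simp

text \<open>The Mills ratio estimate: on x \<ge> w the factor x / w is at least 1, and x times the
  density has minus the density as antiderivative.\<close>

lemma std_normal_upper_tail_le:
  assumes w: "0 < w"
  shows "(\<integral>x. indicator {w..} x * std_normal_density x \<partial>lborel) \<le> std_normal_density w / w"
proof -
  let ?n = "std_normal_density"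
  have F: "((\<lambda>x. - ?n x / w) has_real_derivative x / w * ?n x) (at x)" for x
    using w by (auto intro!: derivative_eq_intros std_normal_density_DERIV)
  have "((\<lambda>x. - ?n x / w) \<longlongrightarrow> - 0 / w) at_top"
    by (intro tendsto_intros tendsto_std_normal_density_at_top) (use w in auto)
  then have *: "(\<integral>\<^sup>+x. ennreal (x / w * ?n x) * indicator {w ..} x \<partial>lborel) = ennreal (?n w / w)"
    using nn_integral_FTC_atLeast[OF _ F, of w "- 0 / w"] w by (simp add: zero_le_divide_iff)
  have "(\<integral>x. indicator {w..} x * ?n x \<partial>lborel) = enn2real (\<integral>\<^sup>+x. ennreal (indicator {w..} x * ?n x) \<partial>lborel)"
    by (rule integral_eq_nn_integral) auto
  also have "\<dots> \<le> enn2real (\<integral>\<^sup>+x. ennreal (x / w * ?n x) * indicator {w ..} x \<partial>lborel)"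
  proof (rule enn2real_mono)
    show "(\<integral>\<^sup>+x. ennreal (indicator {w..} x * ?n x) \<partial>lborel) \<le> (\<integral>\<^sup>+x. ennreal (x / w * ?n x) * indicator {w ..} x \<partial>lborel)"
    proof (rule nn_integral_mono)
      fix x :: real
      show "ennreal (indicator {w..} x * ?n x) \<le> ennreal (x / w * ?n x) * indicator {w ..} x"
        using w mult_right_mono[of 1 "x / w" "?n x"] by (auto simp: indicator_def intro!: ennreal_leI)
    qed
  qed (subst *, simp)
  also have "\<dots> = ?n w / w" unfolding * using w by simp
  finally show ?thesis .
qed

lemma std_normal_lower_tail_le:
  assumes w: "w < 0"
  shows "(\<integral>x. indicator {..w} x * std_normal_density x \<partial>lborel) \<le> std_normal_density w / - w"
proof -
  have "(\<integral>x. indicator {..w} x * std_normal_density x \<partial>lborel)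
      = (\<integral>x. indicator {..w} (- x) * std_normal_density (- x) \<partial>lborel)"
    using lborel_integral_real_affine[of "-1" "\<lambda>x. indicator {..w} x * std_normal_density x" 0] by simp
  also have "\<dots> = (\<integral>x. indicator {- w..} x * std_normal_density x \<partial>lborel)"
    by (intro Bochner_Integration.integral_cong) (auto simp: indicator_def std_normal_density_def)
  also have "\<dots> \<le> std_normal_density (- w) / - w"
    using w by (intro std_normal_upper_tail_le) auto
  finally show ?thesis by (simp add: std_normal_density_def)
qed

text \<open>Variation of constants: the solution is the integral of (h - Nh) times the density up to
  w, divided by the density at w. The equation itself then gives |\<phi>'| \<le> |h - Nh| + |w
  \<phi>(w)| \<le> 1 + 1, and continuity of h makes \<phi>' continuous.\<close>

lemma stein_equation_solution:
  fixes h :: "real \<Rightarrow> real"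
  assumes h: "continuous_on UNIV h" "\<And>x. 0 \<le> h x" "\<And>x. h x \<le> 1"
  obtains \<phi> \<phi>' C where "\<And>w. (\<phi> has_real_derivative \<phi>' w) (at w)" "continuous_on UNIV \<phi>'"
    "\<And>w. \<bar>\<phi> w\<bar> \<le> C" "\<And>w. \<bar>\<phi>' w\<bar> \<le> 2"
    "\<And>w. \<phi>' w - w * \<phi> w = h w - (\<integral>x. h x \<partial>std_normal_distribution)"
proof -
  interpret N: prob_space std_normal_distribution by (rule prob_space_normal_density) simp
  let ?n = "std_normal_density"
  define Nh where "Nh = (\<integral>x. h x \<partial>std_normal_distribution)"
  have hm: "h \<in> borel_measurable borel" using h(1) by (rule borel_measurable_continuous_onI)
  have hint: "integrable std_normal_distribution h"
    using hm h by (intro N.integrable_const_bound[where B=1]) auto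
  have Nh: "0 \<le> Nh" "Nh \<le> 1"
    using N.integral_ge_const[OF hint, of 0] N.integral_le_const[OF hint, of 1] h unfolding Nh_def by auto
  define k where "k x = (h x - Nh) * ?n x" for x
  have hn: "integrable lborel (\<lambda>x. ?n x * h x)"
    using hint hm by (subst (asm) integrable_density) auto
  have Nh_eq: "Nh = (\<integral>x. ?n x * h x \<partial>lborel)"
    unfolding Nh_def using hm by (subst integral_density) auto
  have kint: "integrable lborel k"
    unfolding k_def left_diff_distrib using hn integrable_std_normal_density by (simp add: mult.commute[of "h _"])
  have k0: "integral\<^sup>L lborel k = 0"
    unfolding k_def left_diff_distrib using hn integrable_std_normal_density Nh_eq by (simp add: mult.commute[of "h _"])
  have kcont: "continuous_on S k" for S
    unfolding k_def std_normal_density_def using continuous_on_subset[OF h(1)] by (auto intro!: continuous_intros)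
  have kle: "\<bar>k x\<bar> \<le> ?n x" for x
  proof -
    have "\<bar>h x - Nh\<bar> \<le> 1" using h(2)[of x] h(3)[of x] Nh by auto
    then show ?thesis unfolding k_def abs_mult using mult_right_mono[of "\<bar>h x - Nh\<bar>" 1 "?n x"] by simp
  qed
  define K where "K w = (\<integral>x. indicator {..w} x * k x \<partial>lborel)" for w
  have ind: "integrable lborel (\<lambda>x. indicator A x * k x)" "integrable lborel (\<lambda>x. indicator A x * ?n x)" if "A \<in> sets borel" for A
    using integrable_mult_indicator[of A lborel, OF _ kint] integrable_mult_indicator[of A lborel, OF _ integrable_std_normal_density] that by auto
  have Kderiv: "(K has_real_derivative k w) (at w)" for w
  proof -
    \<comment> \<open>Splitting at w - 1 leaves an integral over a compact interval that has w in
      its interior, where the fundamental theorem gives a two-sided derivative.\<close>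
    have K_eq: "K x = K (w - 1) + integral {w - 1..x} k" if "x \<in> {w - 1..w + 1}" for x
    proof -
      have "K x = (\<integral>y. indicator {..w - 1} y * k y + indicator {w - 1<..x} y * k y \<partial>lborel)"
        unfolding K_def using that by (intro Bochner_Integration.integral_cong) (auto simp: indicator_def)
      also have "\<dots> = K (w - 1) + (\<integral>y. indicator {w - 1<..x} y * k y \<partial>lborel)"
        unfolding K_def by (intro Bochner_Integration.integral_add ind) auto
      also have "(\<integral>y. indicator {w - 1<..x} y * k y \<partial>lborel) = (LBINT y:{w - 1..x}. k y)"
        unfolding set_lebesgue_integral_def
        by (intro integral_cong_AE) (use AE_lborel_singleton[of "w - 1"] kint in \<open>auto simp: indicator_def\<close>)
      also have "\<dots> = integral {w - 1..x} k"
        using ind(1)[of "{w - 1..x}"] by (intro set_borel_integral_eq_integral(2)) (auto simp: set_integrable_def)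
      finally show ?thesis .
    qed
    have "((\<lambda>x. integral {w - 1..x} k) has_vector_derivative k w) (at w within {w - 1..w + 1})"
      by (rule integral_has_vector_derivative[OF kcont]) auto
    then have "((\<lambda>x. K (w - 1) + integral {w - 1..x} k) has_vector_derivative k w) (at w within {w - 1..w + 1})"
      by (auto intro!: derivative_eq_intros)
    then have "(K has_vector_derivative k w) (at w within {w - 1..w + 1})"
      by (rule has_vector_derivative_transform[rotated 2]) (auto intro: K_eq)
    then show ?thesis
      by (simp add: has_real_derivative_iff_has_vector_derivative at_within_Icc_at)
  qed
  define \<phi> where "\<phi> w = K w / ?n w" for w
  define \<phi>' where "\<phi>' w = (h w - Nh) + w * \<phi> w" for w
  have npos: "0 < ?n w" for w by (simp add: std_normal_density_def)
  have D: "(\<phi> has_real_derivative \<phi>' w) (at w)" for w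
  proof -
    have "((\<lambda>w. K w / ?n w) has_real_derivative (k w * ?n w - K w * (- w * ?n w)) / (?n w * ?n w)) (at w)"
      using npos[of w] by (intro DERIV_divide Kderiv std_normal_density_DERIV) auto
    also have "(k w * ?n w - K w * (- w * ?n w)) / (?n w * ?n w) = \<phi>' w"
      using npos[of w] by (simp add: \<phi>'_def \<phi>_def k_def field_simps)
    finally show ?thesis by (simp add: \<phi>_def[abs_def])
  qed
  have c\<phi>: "continuous_on S \<phi>" for S
    using D by (meson DERIV_isCont continuous_at_imp_continuous_on)
  have tail: "\<bar>w * \<phi> w\<bar> \<le> 1" for w
  proof -
    have "\<bar>K w\<bar> * \<bar>w\<bar> \<le> ?n w"
    proof (cases w "0 :: real" rule: linorder_cases)
      case less
      have "\<bar>K w\<bar> \<le> (\<integral>x. \<bar>indicator {..w} x * k x\<bar> \<partial>lborel)" unfolding K_def by (rule integral_abs_bound)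
      also have "\<dots> \<le> (\<integral>x. indicator {..w} x * ?n x \<partial>lborel)"
        using kle by (intro integral_mono integrable_abs ind) (auto simp: abs_mult indicator_def)
      also have "\<dots> \<le> ?n w / - w" by (rule std_normal_lower_tail_le[OF less])
      finally show ?thesis using less by (simp add: field_simps)
    next
      case greater
      \<comment> \<open>Since \<open>k\<close> has integral 0, \<open>K w\<close> is minus the
        integral over the upper tail, so the Mills estimate also applies for positive w.\<close>
      have "K w + (\<integral>x. indicator {w<..} x * k x \<partial>lborel) = (\<integral>x. indicator {..w} x * k x + indicator {w<..} x * k x \<partial>lborel)"
        unfolding K_def by (intro Bochner_Integration.integral_add[symmetric] ind) auto
      also have "\<dots> = integral\<^sup>L lborel k"
        by (intro Bochner_Integration.integral_cong) (auto simp: indicator_def)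
      finally have "\<bar>K w\<bar> = \<bar>\<integral>x. indicator {w<..} x * k x \<partial>lborel\<bar>" using k0 by simp
      also have "\<dots> \<le> (\<integral>x. \<bar>indicator {w<..} x * k x\<bar> \<partial>lborel)" by (rule integral_abs_bound)
      also have "\<dots> \<le> (\<integral>x. indicator {w..} x * ?n x \<partial>lborel)"
        using kle by (intro integral_mono integrable_abs ind) (auto simp: abs_mult indicator_def)
      also have "\<dots> \<le> ?n w / w" by (rule std_normal_upper_tail_le[OF greater])
      finally show ?thesis using greater by (simp add: field_simps)
    qed (use npos[of w] in auto)
    then show ?thesis using npos[of w] by (simp add: \<phi>_def abs_mult field_simps)
  qed
  \<comment> \<open>The tail estimate controls \<open>\<phi>\<close> only away from 0; compactness
    covers [-1, 1]. The constant obtained serves only for tameness and does not enter the final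
    bound.\<close>
  have "compact (\<phi> ` {-1..1})" by (intro compact_continuous_image c\<phi>) auto
  then obtain C0 where C0: "\<And>w. w \<in> {-1..1} \<Longrightarrow> \<bar>\<phi> w\<bar> \<le> C0"
    by (meson compact_imp_bounded bounded_real imageI)
  have bound: "\<bar>\<phi> w\<bar> \<le> max C0 1" for w
  proof (cases "w \<in> {-1..1}")
    case False
    then have "1 \<le> \<bar>w\<bar>" by auto
    then have "\<bar>\<phi> w\<bar> \<le> \<bar>w\<bar> * \<bar>\<phi> w\<bar>" using mult_right_mono[of 1 "\<bar>w\<bar>" "\<bar>\<phi> w\<bar>"] by simp
    also have "\<dots> \<le> 1" using tail[of w] by (simp add: abs_mult)
    finally show ?thesis by simp
  qed (use C0 in \<open>auto simp: le_max_iff_disj\<close>)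
  show ?thesis
  proof
    show "(\<phi> has_real_derivative \<phi>' w) (at w)" for w by (rule D)
    show "continuous_on UNIV \<phi>'" unfolding \<phi>'_def by (intro continuous_intros h c\<phi>)
    show "\<bar>\<phi> w\<bar> \<le> max C0 1" for w by (rule bound)
    show "\<bar>\<phi>' w\<bar> \<le> 2" for w
      using tail[of w] h(2)[of w] h(3)[of w] Nh unfolding \<phi>'_def by linarith
    show "\<phi>' w - w * \<phi> w = h w - (\<integral>x. h x \<partial>std_normal_distribution)" for w
      by (simp add: \<phi>'_def Nh_def)
  qed
qed

context rotation_invariant
begin

text \<open>Stein's equation at the standardized variable, multiplied by -\<sigma>, has as
  expectation the quantity estimated in \<open>second_order_stein\<close> for y to \<phi>((y -
  m)/\<sigma>). That function has derivative at most 2/\<sigma>, and the division by the outer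
  \<sigma> turns this into 2/v.\<close>

theorem second_order_poincare_normal_approximation:
  fixes g :: "'a \<Rightarrow> real" and G :: "'a \<Rightarrow> 'a" and DG :: "'a \<Rightarrow> 'a \<Rightarrow> 'a"
  defines "m \<equiv> (\<integral>x. g x \<partial>\<mu>)" and "v \<equiv> (\<integral>x. (g x)\<^sup>2 \<partial>\<mu>) - (\<integral>x. g x \<partial>\<mu>)\<^sup>2"
  assumes s: "\<And>u. u \<bullet> cov_op u \<le> s * (norm u)\<^sup>2" "0 < s"
    and g: "\<And>x. (g has_derivative (\<lambda>h. G x \<bullet> h)) (at x)" "tame g"
    and G: "\<And>x. (G has_derivative DG x) (at x)" "tame G" "tame (\<lambda>p. DG (fst p) (snd p))"
    and k1: "\<And>x. norm (G x) \<le> k1 x" "tame k1" "(\<integral>x. k1 x ^ 4 \<partial>\<mu>) \<le> \<kappa>1 ^ 4" "0 < \<kappa>1"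
    and k2: "\<And>x v. norm (DG x v) \<le> k2 x * norm v" "\<And>x. 0 \<le> k2 x" "tame k2" "(\<integral>x. k2 x ^ 4 \<partial>\<mu>) \<le> \<kappa>2 ^ 4" "0 < \<kappa>2"
    and v: "0 < v"
    and h: "continuous_on UNIV h" "\<And>x. 0 \<le> h x" "\<And>x. h x \<le> 1"
  shows "\<bar>(\<integral>x. h ((g x - m) / sqrt v) \<partial>\<mu>) - (\<integral>x. h x \<partial>std_normal_distribution)\<bar>
      \<le> 4 * s * sqrt s * \<kappa>1 * \<kappa>2 / v"
proof -
  define \<sigma> where "\<sigma> = sqrt v"
  have \<sigma>: "0 < \<sigma>" "\<sigma> * \<sigma> = v" using v by (auto simp: \<sigma>_def)
  define Nh where "Nh = (\<integral>x. h x \<partial>std_normal_distribution)"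
  obtain \<phi> \<phi>' C where \<phi>: "\<And>w. (\<phi> has_real_derivative \<phi>' w) (at w)" "continuous_on UNIV \<phi>'"
    "\<And>w. \<bar>\<phi> w\<bar> \<le> C" "\<And>w. \<bar>\<phi>' w\<bar> \<le> 2" and eq: "\<And>w. \<phi>' w - w * \<phi> w = h w - Nh"
    using stein_equation_solution[OF h] unfolding Nh_def by metis
  let ?w = "\<lambda>x. (g x - m) / \<sigma>"
  have "\<bar>(\<integral>x. \<phi> (?w x) * g x \<partial>\<mu>) - (\<integral>x. \<phi> (?w x) \<partial>\<mu>) * (\<integral>x. g x \<partial>\<mu>)
      - (\<integral>x. \<phi>' (?w x) / \<sigma> \<partial>\<mu>) * ((\<integral>x. (g x)\<^sup>2 \<partial>\<mu>) - (\<integral>x. g x \<partial>\<mu>)\<^sup>2)\<bar> \<le> (2 / \<sigma>) * (2 * s * sqrt s * \<kappa>1 * \<kappa>2)"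
  proof (rule second_order_stein[OF s g G k1 k2, where \<phi>="\<lambda>y. \<phi> ((y - m) / \<sigma>)" and \<phi>'="\<lambda>y. \<phi>' ((y - m) / \<sigma>) / \<sigma>"])
    show "((\<lambda>y. \<phi> ((y - m) / \<sigma>)) has_real_derivative \<phi>' ((w - m) / \<sigma>) / \<sigma>) (at w)" for w
    proof -
      have "((\<lambda>y. (y - m) / \<sigma>) has_real_derivative 1 / \<sigma>) (at w)"
        using \<sigma> by (auto intro!: derivative_eq_intros)
      from DERIV_chain2[OF \<phi>(1) this] show ?thesis by simp
    qed
    show "continuous_on UNIV (\<lambda>y. \<phi>' ((y - m) / \<sigma>) / \<sigma>)"
      using \<sigma> by (intro continuous_intros continuous_on_compose2[OF \<phi>(2)]) auto
    show "\<bar>\<phi> ((w - m) / \<sigma>)\<bar> \<le> C" for w by (rule \<phi>)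
    show "\<bar>\<phi>' ((w - m) / \<sigma>) / \<sigma>\<bar> \<le> 2 / \<sigma>" for w
      using \<phi>(4)[of "(w - m) / \<sigma>"] \<sigma> by (simp add: abs_divide divide_right_mono)
  qed
  then have est: "\<bar>(\<integral>x. \<phi> (?w x) * g x \<partial>\<mu>) - (\<integral>x. \<phi> (?w x) \<partial>\<mu>) * m - (\<integral>x. \<phi>' (?w x) \<partial>\<mu>) * \<sigma>\<bar>
      \<le> (2 / \<sigma>) * (2 * s * sqrt s * \<kappa>1 * \<kappa>2)"
    unfolding m_def[symmetric] using \<sigma>(1) by (simp add: v_def[folded m_def, symmetric] \<sigma>(2)[symmetric])
  have tw: "tame ?w" unfolding divide_inverse by (intro tame_intros g)
  have c\<phi>: "continuous_on UNIV \<phi>" using \<phi>(1) by (meson DERIV_isCont continuous_at_imp_continuous_on)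
  have t\<phi>: "tame (\<lambda>x. \<phi> (?w x))" "tame (\<lambda>x. \<phi>' (?w x))" "tame (\<lambda>x. h (?w x))"
    by (rule tame_compose[OF tame_bounded tw]; use \<phi> c\<phi> h in force)+
  have "(\<integral>x. \<phi> (?w x) * g x \<partial>\<mu>) - (\<integral>x. \<phi> (?w x) \<partial>\<mu>) * m - (\<integral>x. \<phi>' (?w x) \<partial>\<mu>) * \<sigma>
      = (\<integral>x. \<phi> (?w x) * g x - \<phi> (?w x) * m - \<phi>' (?w x) * \<sigma> \<partial>\<mu>)"
    using integrable_tame[OF tame_mult[OF t\<phi>(1) g(2)]] integrable_tame[OF t\<phi>(1)] integrable_tame[OF t\<phi>(2)] by simp
  also have "\<dots> = (\<integral>x. - \<sigma> * (h (?w x) - Nh) \<partial>\<mu>)"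
  proof (rule Bochner_Integration.integral_cong)
    fix x
    have "- \<sigma> * (h (?w x) - Nh) = - \<sigma> * (\<phi>' (?w x) - ?w x * \<phi> (?w x))" by (simp only: eq)
    also have "\<dots> = \<phi> (?w x) * g x - \<phi> (?w x) * m - \<phi>' (?w x) * \<sigma>"
      using \<sigma>(1) by (simp add: field_simps)
    finally show "\<phi> (?w x) * g x - \<phi> (?w x) * m - \<phi>' (?w x) * \<sigma> = - \<sigma> * (h (?w x) - Nh)" by simp
  qed simp
  also have "\<dots> = - \<sigma> * ((\<integral>x. h (?w x) \<partial>\<mu>) - Nh)"
    using integrable_tame[OF t\<phi>(3)] by (simp add: prob_space)
  finally have "\<sigma> * \<bar>(\<integral>x. h (?w x) \<partial>\<mu>) - Nh\<bar> \<le> (2 / \<sigma>) * (2 * s * sqrt s * \<kappa>1 * \<kappa>2)"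
    using est \<sigma>(1) by (simp add: abs_mult)
  then have "\<bar>(\<integral>x. h (?w x) \<partial>\<mu>) - Nh\<bar> \<le> (2 / \<sigma>) * (2 * s * sqrt s * \<kappa>1 * \<kappa>2) / \<sigma>"
    using \<sigma>(1) by (simp add: pos_le_divide_eq mult.commute)
  also have "\<dots> = 4 * s * sqrt s * \<kappa>1 * \<kappa>2 / v"
    using \<sigma>(1) by (simp add: \<sigma>(2)[symmetric] field_simps)
  finally show ?thesis by (simp add: Nh_def \<sigma>_def)
qed

end

section \<open>Traces of matrix powers\<close>

lemma bounded_bilinear_matrix_mult:
  "bounded_bilinear ((**) :: real^'n^'m \<Rightarrow> real^'p^'n \<Rightarrow> real^'p^'m)"
  unfolding bilinear_conv_bounded_bilinear[symmetric] bilinear_def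
  by (auto intro!: linearI simp: vec_eq_iff matrix_matrix_mult_def sum.distrib sum_distrib_left algebra_simps)

lemma bounded_linear_transpose: "bounded_linear (transpose :: real^'n^'m \<Rightarrow> real^'m^'n)"
  unfolding linear_conv_bounded_linear[symmetric]
  by (rule linearI) (auto simp: transpose_def vec_eq_iff)

lemma bounded_linear_trace: "bounded_linear (trace :: real^'n^'n \<Rightarrow> real)"
  unfolding linear_conv_bounded_linear[symmetric]
  by (rule linearI) (auto simp: trace_def sum.distrib sum_distrib_left)

text \<open>The norm of the matrix type is the Frobenius norm. It is the Euclidean norm in which
  gradients and Hessians are measured, whereas \<open>matrix_onorm\<close> only enters their
  bounds.\<close>

lemma norm_matrix_square: "(norm (A :: real^'n^'m))\<^sup>2 = (\<Sum>i\<in>UNIV. \<Sum>j\<in>UNIV. (A $ i $ j)\<^sup>2)"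
  unfolding power2_norm_eq_inner by (simp add: inner_vec_def power2_eq_square)

lemma norm_transpose: "norm (transpose A :: real^'n^'m) = norm A"
proof -
  have "(norm (transpose A))\<^sup>2 = (norm A)\<^sup>2"
    unfolding norm_matrix_square transpose_def by simp (rule sum.swap)
  then show ?thesis by simp
qed

lemma trace_mult_eq_inner: "trace (A ** B) = transpose A \<bullet> (B :: real^'n^'n)"
  unfolding trace_def matrix_matrix_mult_def transpose_def inner_vec_def
  by simp (rule sum.swap)

lemma norm_mat_1: "norm (mat 1 :: real^'n^'n) = sqrt (real CARD('n))"
proof -
  have "(norm (mat 1 :: real^'n^'n))\<^sup>2 = real CARD('n)"
    unfolding norm_matrix_square mat_def by (simp add: if_distrib[of "\<lambda>x. x\<^sup>2"] cong: if_cong)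
  then show ?thesis by (metis norm_ge_zero real_sqrt_unique)
qed

lemma matrix_onorm_nonneg: "0 \<le> matrix_onorm A"
  unfolding matrix_onorm_def by (rule onorm_pos_le) (rule matrix_vector_mul_bounded_linear)

lemma norm_matrix_vector_le: "norm (A *v x) \<le> matrix_onorm A * norm x"
  unfolding matrix_onorm_def by (rule onorm) (rule matrix_vector_mul_bounded_linear)

lemma matrix_onorm_le_norm: "matrix_onorm A \<le> norm A"
  unfolding matrix_onorm_def
proof (rule onorm_le)
  fix x
  have "(norm (A *v x))\<^sup>2 = (\<Sum>i\<in>UNIV. (A $ i \<bullet> x)\<^sup>2)"
    unfolding power2_norm_eq_inner by (simp add: inner_vec_def matrix_vector_mult_def power2_eq_square)
  also have "\<dots> \<le> (\<Sum>i\<in>UNIV. (norm (A $ i))\<^sup>2 * (norm x)\<^sup>2)"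
    by (intro sum_mono) (metis Cauchy_Schwarz_ineq power2_norm_eq_inner)
  also have "\<dots> = (norm A * norm x)\<^sup>2"
    by (simp add: power_mult_distrib power2_norm_eq_inner[of A] inner_vec_def[of A] sum_distrib_right power2_norm_eq_inner)
  finally show "norm (A *v x) \<le> norm A * norm x" by (rule power2_le_imp_le) auto
qed

lemma matrix_onorm_triangle: "matrix_onorm (A + B) \<le> matrix_onorm A + matrix_onorm B"
  unfolding matrix_onorm_def matrix_vector_mult_add_rdistrib
  by (intro onorm_triangle matrix_vector_mul_bounded_linear)

text \<open>By the triangle inequality the operator norm is 1-Lipschitz for the Frobenius norm, and
  it is dominated by that norm.\<close>

lemma tame_matrix_onorm: "tame (matrix_onorm :: real^'m^'m \<Rightarrow> real)"
proof (rule tame_if_tame_norm_le)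
  have "\<bar>matrix_onorm A - matrix_onorm B\<bar> \<le> norm (A - B)" for A B :: "real^'m^'m"
    using matrix_onorm_triangle[of "A - B" B] matrix_onorm_triangle[of "B - A" A]
      matrix_onorm_le_norm[of "A - B"] matrix_onorm_le_norm[of "B - A"] norm_minus_commute[of A B]
    by auto
  then have "1-lipschitz_on UNIV (matrix_onorm :: real^'m^'m \<Rightarrow> real)"
    by (intro lipschitz_onI) (auto simp: dist_norm)
  then show "continuous_on UNIV (matrix_onorm :: real^'m^'m \<Rightarrow> real)" by (rule lipschitz_on_continuous_on)
  show "tame (\<lambda>A :: real^'m^'m. norm A)" by (intro tame_intros)
  show "norm (matrix_onorm A) \<le> norm A" for A :: "real^'m^'m"
    using matrix_onorm_nonneg[of A] matrix_onorm_le_norm[of A] by simp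
qed

text \<open>The transpose has no larger operator norm: pair \<open>x v* A\<close> with itself, move
  \<open>A\<close> to the other side and cancel one factor.\<close>

lemma norm_vector_matrix_le: "norm (x v* A) \<le> matrix_onorm A * norm x"
proof (cases "x v* A = 0")
  case True
  then show ?thesis using matrix_onorm_nonneg[of A] by simp
next
  case False
  have "norm (x v* A) * norm (x v* A) = x \<bullet> (A *v (x v* A))"
    using dot_lmul_matrix[of x A "x v* A"] by (simp add: power2_norm_eq_inner[symmetric] power2_eq_square)
  also have "\<dots> \<le> norm x * norm (A *v (x v* A))" by (rule norm_cauchy_schwarz)
  also have "\<dots> \<le> norm x * (matrix_onorm A * norm (x v* A))"
    by (intro mult_left_mono norm_matrix_vector_le) auto
  finally show ?thesis using False by (simp add: mult.commute)
qed

text \<open>Row by row, only the operator norm of \<open>A\<close> is paid. Submultiplicativity of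
  the Frobenius norm would instead cost up to sqrt n for every factor and spoil the dependence on
  the dimension.\<close>

lemma norm_matrix_mult_right_le: "norm (B ** A) \<le> norm B * matrix_onorm (A :: real^'m^'m)" for B :: "real^'m^'m"
proof -
  have row: "(B ** A) $ i = B $ i v* A" for i
    by (simp add: matrix_matrix_mult_def vector_matrix_mult_def vec_eq_iff mult.commute)
  have "(norm (B ** A))\<^sup>2 = (\<Sum>i\<in>UNIV. (norm (B $ i v* A))\<^sup>2)"
    by (simp add: power2_norm_eq_inner inner_vec_def[of "B ** A"] row)
  also have "\<dots> \<le> (\<Sum>i\<in>UNIV. (matrix_onorm A * norm (B $ i))\<^sup>2)"
    by (intro sum_mono power_mono norm_vector_matrix_le) auto
  also have "\<dots> = (norm B * matrix_onorm A)\<^sup>2"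
    by (simp add: power_mult_distrib power2_norm_eq_inner[of B] inner_vec_def[of B] sum_distrib_left sum_distrib_right power2_norm_eq_inner mult.commute)
  finally show ?thesis by (rule power2_le_imp_le) (simp add: matrix_onorm_nonneg)
qed

lemma norm_matrix_mult_left_le: "norm (A ** B) \<le> matrix_onorm (A :: real^'m^'m) * norm B" for B :: "real^'m^'m"
proof -
  have col: "transpose (A ** B) $ j = A *v (transpose B $ j)" for j
    by (simp add: matrix_matrix_mult_def matrix_vector_mult_def transpose_def vec_eq_iff)
  have "(norm (A ** B))\<^sup>2 = (norm (transpose (A ** B)))\<^sup>2" by (simp add: norm_transpose)
  also have "\<dots> = (\<Sum>j\<in>UNIV. (norm (A *v (transpose B $ j)))\<^sup>2)"
    by (simp add: power2_norm_eq_inner inner_vec_def[of "transpose (A ** B)"] col)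
  also have "\<dots> \<le> (\<Sum>j\<in>UNIV. (matrix_onorm A * norm (transpose B $ j))\<^sup>2)"
    by (intro sum_mono power_mono norm_matrix_vector_le) auto
  also have "\<dots> = (matrix_onorm A * norm (transpose B))\<^sup>2"
    by (simp add: power_mult_distrib power2_norm_eq_inner[of "transpose B"] inner_vec_def[of "transpose B"] sum_distrib_left power2_norm_eq_inner)
  finally have "norm (A ** B) \<le> matrix_onorm A * norm (transpose B)"
    by (rule power2_le_imp_le) (simp add: matrix_onorm_nonneg)
  then show ?thesis by (simp add: norm_transpose)
qed

lemma norm_matrix_pow_vector_le: "norm (matrix_pow A k *v x) \<le> matrix_onorm A ^ k * norm x" for A :: "real^'m^'m"
proof (induction k)
  case (Suc k)
  have "norm (A *v (matrix_pow A k *v x)) \<le> matrix_onorm A * norm (matrix_pow A k *v x)" by (rule norm_matrix_vector_le)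
  also have "\<dots> \<le> matrix_onorm A * (matrix_onorm A ^ k * norm x)"
    by (intro mult_left_mono Suc matrix_onorm_nonneg)
  finally show ?case by (simp add: matrix_vector_mul_assoc mult.assoc)
qed simp

lemma matrix_onorm_pow_le: "matrix_onorm (matrix_pow A k) \<le> matrix_onorm A ^ k"
  unfolding matrix_onorm_def[of "matrix_pow A k"]
  by (intro onorm_le norm_matrix_pow_vector_le)

text \<open>A power has no Frobenius factor of its own, so one is supplied by the identity matrix.
  This is the origin of the sqrt n in the gradient bound.\<close>

lemma norm_matrix_pow_le: "norm (matrix_pow A k :: real^'m^'m) \<le> sqrt (real CARD('m)) * matrix_onorm A ^ k"
proof -
  have "norm (matrix_pow A k ** mat 1) \<le> matrix_onorm (matrix_pow A k) * norm (mat 1 :: real^'m^'m)"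
    by (rule norm_matrix_mult_left_le)
  also have "\<dots> \<le> matrix_onorm A ^ k * sqrt (real CARD('m))"
    unfolding norm_mat_1 by (intro mult_right_mono matrix_onorm_pow_le) auto
  finally show ?thesis by (simp add: mult.commute)
qed

lemma abs_matrix_pow_entry_le: "\<bar>matrix_pow A k $ i $ j\<bar> \<le> matrix_onorm (A :: real^'m^'m) ^ k"
proof -
  have "\<bar>matrix_pow A k $ i $ j\<bar> = \<bar>(matrix_pow A k *v axis j 1) $ i\<bar>"
    by (simp add: matrix_vector_mult_basis column_def)
  also have "\<dots> \<le> norm (matrix_pow A k *v axis j 1)" by (rule component_le_norm_cart)
  also have "\<dots> \<le> matrix_onorm A ^ k" using norm_matrix_pow_vector_le[of A k "axis j 1"] by (simp add: norm_axis_1)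
  finally show ?thesis .
qed

lemma abs_trace_matrix_pow_le: "\<bar>trace (matrix_pow A k)\<bar> \<le> real CARD('m) * matrix_onorm (A :: real^'m^'m) ^ k"
proof -
  have "\<bar>trace (matrix_pow A k)\<bar> \<le> (\<Sum>i\<in>(UNIV :: 'm set). matrix_onorm A ^ k)"
    unfolding trace_def by (rule order_trans[OF sum_abs sum_mono[OF abs_matrix_pow_entry_le]])
  then show ?thesis by simp
qed

lemma matrix_pow_add: "matrix_pow A (j + k) = matrix_pow A j ** matrix_pow (A :: real^'m^'m) k"
  by (induction j) (simp_all add: matrix_mul_assoc)

section \<open>Derivatives of matrix powers and of their traces\<close>

primrec matrix_pow_deriv :: "real^'m^'m \<Rightarrow> nat \<Rightarrow> real^'m^'m \<Rightarrow> real^'m^'m" where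
  "matrix_pow_deriv A 0 B = 0"
| "matrix_pow_deriv A (Suc k) B = B ** matrix_pow A k + A ** matrix_pow_deriv A k B"

lemma has_derivative_matrix_pow:
  "((\<lambda>A. matrix_pow A k) has_derivative matrix_pow_deriv A k) (at (A :: real^'m^'m))"
proof (induction k)
  case (Suc k)
  have "matrix_pow_deriv A (Suc k) = (\<lambda>B. A ** matrix_pow_deriv A k B + B ** matrix_pow A k)"
    by (auto simp: add.commute)
  then show ?case
    using bounded_bilinear.FDERIV[OF bounded_bilinear_matrix_mult has_derivative_ident Suc] by simp
next
  case 0
  have "matrix_pow_deriv A 0 = (\<lambda>_. 0)" by auto
  then show ?case by simp
qed

text \<open>The derivative of A^k in direction B is the sum of the k products A^i B A^(k-1-i). In
  each of them B carries the Frobenius norm and the powers of A only the operator norm, so the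
  dimension does not appear.\<close>

lemma norm_matrix_pow_deriv_le:
  "norm (matrix_pow_deriv A k B) \<le> real k * matrix_onorm A ^ (k - 1) * norm (B :: real^'m^'m)"
proof (induction k)
  case (Suc k)
  have "norm (matrix_pow_deriv A (Suc k) B) \<le> norm (B ** matrix_pow A k) + norm (A ** matrix_pow_deriv A k B)"
    by (simp add: norm_triangle_ineq)
  also have "norm (B ** matrix_pow A k) \<le> norm B * matrix_onorm A ^ k"
    by (rule order_trans[OF norm_matrix_mult_right_le mult_left_mono[OF matrix_onorm_pow_le]]) simp
  also have "norm (A ** matrix_pow_deriv A k B) \<le> matrix_onorm A * (real k * matrix_onorm A ^ (k - 1) * norm B)"
    by (rule order_trans[OF norm_matrix_mult_left_le mult_left_mono[OF Suc matrix_onorm_nonneg]])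
  \<comment> \<open>For k = 0 the exponent k - 1 is truncated to 0, but both sides vanish through
    the factor \<open>real k\<close>.\<close>
  also have "\<dots> = real k * matrix_onorm A ^ k * norm B"
    by (cases k) auto
  finally show ?case by (simp add: algebra_simps)
qed simp

text \<open>By cyclicity of the trace all summands A^i B A^(k-i) contribute equally. The extra
  factor \<open>matrix_pow A j\<close> makes the induction work, as it absorbs the A that the
  recursion leaves on the left.\<close>

lemma trace_pow_mult_pow_deriv:
  fixes A B :: "real^'m^'m"
  shows "trace (matrix_pow A j ** matrix_pow_deriv A (Suc k) B) = real (Suc k) * trace (matrix_pow A (j + k) ** B)"
proof (induction k arbitrary: j)
  case 0
  then show ?case by simp
next
  case (Suc k)
  have "trace (matrix_pow A j ** (B ** matrix_pow A (Suc k))) = trace (matrix_pow A (j + Suc k) ** B)"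
    using trace_mul_sym[of "matrix_pow A j ** B" "matrix_pow A (Suc k)"]
    by (simp only: matrix_mul_assoc matrix_pow_add[symmetric] add.commute[of "Suc k" j])
  moreover have "trace (matrix_pow A j ** (A ** matrix_pow_deriv A (Suc k) B)) = real (Suc k) * trace (matrix_pow A (j + Suc k) ** B)"
  proof -
    have "matrix_pow A (Suc j) = matrix_pow A j ** A"
      using matrix_pow_add[of A j 1] by simp
    then have "matrix_pow A j ** (A ** M) = matrix_pow A (Suc j) ** M" for M :: "real^'m^'m"
      by (simp only: matrix_mul_assoc)
    then show ?thesis using Suc[of "Suc j"] by (simp only: add_Suc add_Suc_right)
  qed
  moreover have "trace (matrix_pow A j ** matrix_pow_deriv A (Suc (Suc k)) B)
     = trace (matrix_pow A j ** (B ** matrix_pow A (Suc k))) + trace (matrix_pow A j ** (A ** matrix_pow_deriv A (Suc k) B))"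
    by (simp only: matrix_pow_deriv.simps(2)[of _ "Suc k"] matrix_add_ldistrib trace_add)
  ultimately show ?case by (simp add: algebra_simps)
qed

text \<open>In other words, the gradient of tr(A^k) for the Frobenius inner product is k times the
  transpose of A^(k-1).\<close>

lemma trace_matrix_pow_deriv: "trace (matrix_pow_deriv A k B) = real k * (transpose (matrix_pow A (k - 1)) \<bullet> B)"
proof (cases k)
  case (Suc l)
  with trace_pow_mult_pow_deriv[of A 0 l B] show ?thesis
    by (simp only: matrix_pow.simps(1) matrix_mul_lid add_0 trace_mult_eq_inner diff_Suc_1)
qed (simp add: trace_def)

lemma tame_matrix_pow: "tame (\<lambda>A :: real^'m^'m. matrix_pow A k)"
proof (induction k)
  case (Suc k)
  show ?case
    using tame_bounded_bilinear[OF bounded_bilinear_matrix_mult tame_ident Suc] by simp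
qed (simp add: tame_const)

lemma tame_matrix_pow_deriv: "tame (\<lambda>p :: (real^'m^'m) \<times> _. matrix_pow_deriv (fst p) k (snd p))"
proof (induction k)
  case (Suc k)
  note mult = tame_bounded_bilinear[OF bounded_bilinear_matrix_mult]
  show ?case
    using tame_add[OF mult[OF tame_snd[OF tame_ident] tame_compose[OF tame_matrix_pow[of k] tame_fst[OF tame_ident]]]
        mult[OF tame_fst[OF tame_ident] Suc]]
    by simp
qed (simp add: tame_const)

lemma matrix_pow_complex_matrix: "matrix_pow (complex_matrix A) k = complex_matrix (matrix_pow A k)"
proof (induction k)
  case 0
  show ?case by (auto simp: complex_matrix_def mat_def vec_eq_iff)
next
  case (Suc k)
  then show ?case by (simp add: complex_matrix_def matrix_matrix_mult_def vec_eq_iff)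
qed

section \<open>Gaussian vectors\<close>

lemma (in prob_space) gaussian_rv_cases:
  assumes "gaussian_rv M Y"
  obtains (normal) m \<sigma> where "\<sigma> > 0" "distributed M lborel Y (\<lambda>x. ennreal (normal_density m \<sigma> x))"
    | (const) m where "AE \<omega> in M. Y \<omega> = m"
  using assms unfolding gaussian_rv_def by blast

lemma (in prob_space) gaussian_rv_integrable_moment:
  assumes Y: "gaussian_rv M Y"
  shows "integrable M (\<lambda>\<omega>. \<bar>Y \<omega>\<bar> ^ k)"
proof -
  have Ym: "Y \<in> borel_measurable M" using Y by (simp add: gaussian_rv_def)
  from Y show ?thesis
  proof (cases rule: gaussian_rv_cases)
    case (normal m \<sigma>)
    have "integrable lborel (\<lambda>x. normal_density m \<sigma> x * \<bar>x\<bar> ^ k)"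
    proof (rule Bochner_Integration.integrable_bound)
      show "integrable lborel (\<lambda>x. 2 ^ k * (normal_density m \<sigma> x * \<bar>x - m\<bar> ^ k) + (2 * \<bar>m\<bar>) ^ k * normal_density m \<sigma> x)"
        using integrable_normal_moment_abs[OF normal(1), of m k] integrable_normal_density[OF normal(1), of m] by simp
      show "AE x in lborel. norm (normal_density m \<sigma> x * \<bar>x\<bar> ^ k)
          \<le> norm (2 ^ k * (normal_density m \<sigma> x * \<bar>x - m\<bar> ^ k) + (2 * \<bar>m\<bar>) ^ k * normal_density m \<sigma> x)"
      proof (rule AE_I2)
        fix x
        have "\<bar>x\<bar> ^ k \<le> (2 * max \<bar>x - m\<bar> \<bar>m\<bar>) ^ k"
          using abs_triangle_ineq[of "x - m" m] by (intro power_mono) (auto simp: max_def)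
        also have "\<dots> \<le> 2 ^ k * \<bar>x - m\<bar> ^ k + (2 * \<bar>m\<bar>) ^ k" by (auto simp: max_def power_mult_distrib)
        finally have "normal_density m \<sigma> x * \<bar>x\<bar> ^ k \<le> normal_density m \<sigma> x * (2 ^ k * \<bar>x - m\<bar> ^ k + (2 * \<bar>m\<bar>) ^ k)"
          by (intro mult_left_mono) auto
        then show "norm (normal_density m \<sigma> x * \<bar>x\<bar> ^ k)
          \<le> norm (2 ^ k * (normal_density m \<sigma> x * \<bar>x - m\<bar> ^ k) + (2 * \<bar>m\<bar>) ^ k * normal_density m \<sigma> x)"
          by (simp add: algebra_simps)
      qed
    qed measurable
    then show ?thesis using distributed_integrable[OF normal(2), of "\<lambda>x. \<bar>x\<bar> ^ k"] by simp
  next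
    case (const m)
    then have "AE \<omega> in M. \<bar>Y \<omega>\<bar> ^ k = \<bar>m\<bar> ^ k" by eventually_elim simp
    then show ?thesis using Ym by (subst integrable_cong_AE) auto
  qed
qed

lemma (in prob_space) gaussian_rv_integrable:
  assumes "gaussian_rv M Y" shows "integrable M Y" "integrable M (\<lambda>\<omega>. (Y \<omega>)\<^sup>2)"
  using gaussian_rv_integrable_moment[OF assms, of 1] gaussian_rv_integrable_moment[OF assms, of 2] assms
  by (auto simp: gaussian_rv_def integrable_abs_iff)

text \<open>Scaling reduces the normal case to the standard one. Expressing the exponent by the
  second moment lets the same formula cover the almost surely constant case, where that moment is
  0.\<close>

lemma (in prob_space) gaussian_rv_characteristic_function:
  assumes Y: "gaussian_rv M Y" and mean: "expectation Y = 0"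
  shows "(\<integral>\<omega>. cis (Y \<omega>) \<partial>M) = of_real (exp (- expectation (\<lambda>\<omega>. (Y \<omega>)\<^sup>2) / 2))"
proof -
  have Ym: "Y \<in> borel_measurable M" using Y by (simp add: gaussian_rv_def)
  have cism: "cis \<in> borel_measurable borel" by (intro borel_measurable_continuous_onI continuous_intros)
  from Y show ?thesis
  proof (cases rule: gaussian_rv_cases)
    case (normal m \<sigma>)
    have m: "m = 0" using normal_distributed_expectation[OF normal] mean by simp
    have var: "expectation (\<lambda>\<omega>. (Y \<omega>)\<^sup>2) = \<sigma>\<^sup>2" using normal_distributed_variance[OF normal] mean by simp
    have "distributed M lborel (\<lambda>\<omega>. (Y \<omega> - 0) / \<sigma>) std_normal_density"
      using normal(2) normal_standard_normal_convert[OF normal(1), of Y 0] unfolding m by simp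
    then have std: "distr M lborel (\<lambda>\<omega>. Y \<omega> / \<sigma>) = std_normal_distribution"
      by (simp add: distributed_def)
    have "(\<integral>\<omega>. cis (Y \<omega>) \<partial>M) = (\<integral>\<omega>. iexp (\<sigma> * (Y \<omega> / \<sigma>)) \<partial>M)"
      using normal(1) by (simp add: cis_conv_exp)
    also have "\<dots> = (\<integral>x. iexp (\<sigma> * x) \<partial>distr M lborel (\<lambda>\<omega>. Y \<omega> / \<sigma>))"
      using Ym by (subst integral_distr) auto
    also have "\<dots> = char std_normal_distribution \<sigma>" unfolding std char_def ..
    finally show ?thesis by (simp add: char_std_normal_distribution var)
  next
    case (const m)
    have "expectation Y = m" using const Ym by (subst integral_cong_AE[of _ _ "\<lambda>_. m"]) (auto simp: prob_space)
    then have 0: "AE \<omega> in M. Y \<omega> = 0" using const mean by simp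
    then have "expectation (\<lambda>\<omega>. (Y \<omega>)\<^sup>2) = 0"
      using Ym by (subst integral_cong_AE[of _ _ "\<lambda>_. 0"]) auto
    moreover have "(\<integral>\<omega>. cis (Y \<omega>) \<partial>M) = (\<integral>\<omega>. 1 \<partial>M)"
      using 0 Ym measurable_compose[OF Ym cism] by (intro integral_cong_AE) auto
    ultimately show ?thesis by (simp add: prob_space)
  qed
qed

text \<open>The characteristic function of the product law at (u, v) is exp(-(Q u + Q v) / 2). As Q
  is the second moment of a linear form, Q u + Q v does not change when (u, v) is rotated, and
  uniqueness of characteristic functions yields the invariance of the law.\<close>

lemma (in prob_space) rotation_invariant_gaussian:
  fixes Y :: "'a \<Rightarrow> 'b::euclidean_space"
  assumes gauss: "\<And>u. gaussian_rv M (\<lambda>\<omega>. u \<bullet> Y \<omega>)" and mean: "\<And>u. expectation (\<lambda>\<omega>. u \<bullet> Y \<omega>) = 0"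
  shows "Y \<in> borel_measurable M" "rotation_invariant (distr M borel Y)"
proof -
  have "(\<lambda>\<omega>. Y \<omega> \<bullet> b) \<in> borel_measurable M" for b
    using gauss[of b] by (simp add: gaussian_rv_def inner_commute)
  then have "(\<lambda>\<omega>. \<Sum>b\<in>Basis. (Y \<omega> \<bullet> b) *\<^sub>R b) \<in> borel_measurable M"
    by (intro borel_measurable_sum borel_measurable_scaleR borel_measurable_const)
  then show Y[measurable]: "Y \<in> borel_measurable M" by (simp add: euclidean_representation)
  define \<mu> where "\<mu> = distr M borel Y"
  interpret \<mu>: prob_space \<mu> unfolding \<mu>_def by (rule prob_space_distr) (rule Y)
  interpret PP: pair_prob_space \<mu> \<mu> ..
  have sets_mu: "sets \<mu> = sets borel" by (simp add: \<mu>_def)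
  have sets_pair: "sets (\<mu> \<Otimes>\<^sub>M \<mu>) = sets borel"
    by (subst sets_pair_measure_cong[OF sets_mu sets_mu]) (simp only: borel_prod)
  have cism: "(\<lambda>x. cis (u \<bullet> x)) \<in> borel_measurable borel" for u :: "'c::{real_inner, second_countable_topology}"
    by (intro borel_measurable_continuous_onI continuous_intros)
  define Q where "Q u = (\<integral>\<omega>. (u \<bullet> Y \<omega>)\<^sup>2 \<partial>M)" for u
  have char: "(\<integral>x. cis (u \<bullet> x) \<partial>\<mu>) = of_real (exp (- Q u / 2))" for u
    unfolding \<mu>_def Q_def using gaussian_rv_characteristic_function[OF gauss mean, of u] cism[of u]
    by (subst integral_distr) auto
  have char2: "(\<integral>z. cis ((u, v) \<bullet> z) \<partial>(\<mu> \<Otimes>\<^sub>M \<mu>)) = of_real (exp (- (Q u + Q v) / 2))" for u v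
  proof -
    have "integrable (\<mu> \<Otimes>\<^sub>M \<mu>) (\<lambda>z. cis ((u, v) \<bullet> z))"
      using cism by (intro PP.integrable_const_bound[where B=1]) (auto simp: measurable_cong_sets[OF sets_pair refl])
    moreover have split: "(\<lambda>z. cis ((u, v) \<bullet> z)) = (\<lambda>(x, y). cis (u \<bullet> x) * cis (v \<bullet> y))"
      by (auto simp: cis_mult)
    ultimately have "integrable (\<mu> \<Otimes>\<^sub>M \<mu>) (\<lambda>(x, y). cis (u \<bullet> x) * cis (v \<bullet> y))" by simp
    from PP.integral_fst[OF this]
    have "(\<integral>z. cis ((u, v) \<bullet> z) \<partial>(\<mu> \<Otimes>\<^sub>M \<mu>)) = (\<integral>x. \<integral>y. cis (u \<bullet> x) * cis (v \<bullet> y) \<partial>\<mu> \<partial>\<mu>)"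
      unfolding split by simp
    also have "\<dots> = of_real (exp (- Q u / 2)) * of_real (exp (- Q v / 2))"
      by (simp add: char)
    finally show ?thesis by (simp add: exp_add[symmetric] add_divide_distrib flip: of_real_mult)
  qed
  have int2: "integrable M (\<lambda>\<omega>. (u \<bullet> Y \<omega>)\<^sup>2)" for u
    by (rule gaussian_rv_integrable(2)[OF gauss])
  have Q_rot: "Q (cos t *\<^sub>R u - sin t *\<^sub>R v) + Q (sin t *\<^sub>R u + cos t *\<^sub>R v) = Q u + Q v" for t u v
  proof -
    have "Q (cos t *\<^sub>R u - sin t *\<^sub>R v) + Q (sin t *\<^sub>R u + cos t *\<^sub>R v)
        = (\<integral>\<omega>. ((cos t *\<^sub>R u - sin t *\<^sub>R v) \<bullet> Y \<omega>)\<^sup>2 + ((sin t *\<^sub>R u + cos t *\<^sub>R v) \<bullet> Y \<omega>)\<^sup>2 \<partial>M)"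
      unfolding Q_def by (intro Bochner_Integration.integral_add[symmetric] int2)
    also have "\<dots> = (\<integral>\<omega>. (u \<bullet> Y \<omega>)\<^sup>2 + (v \<bullet> Y \<omega>)\<^sup>2 \<partial>M)"
    proof (rule Bochner_Integration.integral_cong)
      fix \<omega>
      have "(c * p - d * q)\<^sup>2 + (d * p + c * q)\<^sup>2 = (c\<^sup>2 + d\<^sup>2) * (p\<^sup>2 + q\<^sup>2)" for c d p q :: real
        by (simp add: power2_eq_square algebra_simps)
      from this[of "cos t" "u \<bullet> Y \<omega>" "sin t" "v \<bullet> Y \<omega>"]
      show "((cos t *\<^sub>R u - sin t *\<^sub>R v) \<bullet> Y \<omega>)\<^sup>2 + ((sin t *\<^sub>R u + cos t *\<^sub>R v) \<bullet> Y \<omega>)\<^sup>2 = (u \<bullet> Y \<omega>)\<^sup>2 + (v \<bullet> Y \<omega>)\<^sup>2"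
        by (simp add: inner_simps)
    qed simp
    finally show ?thesis unfolding Q_def using int2 by simp
  qed
  have rotm: "rot t \<in> (\<mu> \<Otimes>\<^sub>M \<mu>) \<rightarrow>\<^sub>M (\<mu> \<Otimes>\<^sub>M \<mu>)" for t
    unfolding measurable_cong_sets[OF sets_pair sets_pair]
    by (intro borel_measurable_continuous_onI tame_continuous tame_rot tame_const tame_ident)
  have "rotation_invariant \<mu>"
  proof
    show "sets \<mu> = sets borel" by fact
    show "integrable \<mu> (\<lambda>x. norm x ^ k)" for k
    proof -
      have int: "integrable M (\<lambda>\<omega>. real DIM('b) ^ k * (\<Sum>b\<in>Basis. \<bar>b \<bullet> Y \<omega>\<bar> ^ k))"
        by (intro integrable_mult_right Bochner_Integration.integrable_sum gaussian_rv_integrable_moment gauss)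
      have "integrable M (\<lambda>\<omega>. norm (Y \<omega>) ^ k)"
      proof (rule Bochner_Integration.integrable_bound[OF int])
        show "AE \<omega> in M. norm (norm (Y \<omega>) ^ k) \<le> norm (real DIM('b) ^ k * (\<Sum>b\<in>Basis. \<bar>b \<bullet> Y \<omega>\<bar> ^ k))"
        proof (rule AE_I2)
          fix \<omega>
          define m where "m = Max ((\<lambda>b. \<bar>b \<bullet> Y \<omega>\<bar>) ` (Basis :: 'b set))"
          have "m \<in> (\<lambda>b. \<bar>b \<bullet> Y \<omega>\<bar>) ` (Basis :: 'b set)" unfolding m_def by (intro Max_in) auto
          then obtain b0 where b0: "b0 \<in> Basis" "m = \<bar>b0 \<bullet> Y \<omega>\<bar>" by auto
          have "norm (Y \<omega>) \<le> (\<Sum>b\<in>Basis. \<bar>Y \<omega> \<bullet> b\<bar>)" by (rule norm_le_l1)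
          also have "\<dots> \<le> (\<Sum>b\<in>(Basis::'b set). m)"
            unfolding m_def by (intro sum_mono) (auto simp: inner_commute)
          finally have "norm (Y \<omega>) ^ k \<le> (real DIM('b) * m) ^ k" by (intro power_mono) auto
          also have "\<dots> = real DIM('b) ^ k * \<bar>b0 \<bullet> Y \<omega>\<bar> ^ k" by (simp add: power_mult_distrib b0)
          also have "\<dots> \<le> real DIM('b) ^ k * (\<Sum>b\<in>Basis. \<bar>b \<bullet> Y \<omega>\<bar> ^ k)"
            using b0 by (intro mult_left_mono member_le_sum) auto
          finally show "norm (norm (Y \<omega>) ^ k) \<le> norm (real DIM('b) ^ k * (\<Sum>b\<in>Basis. \<bar>b \<bullet> Y \<omega>\<bar> ^ k))" by simp
        qed
      qed measurable
      then show ?thesis unfolding \<mu>_def by (subst integrable_distr_eq) auto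
    qed
    show "distr (\<mu> \<Otimes>\<^sub>M \<mu>) (\<mu> \<Otimes>\<^sub>M \<mu>) (rot t) = \<mu> \<Otimes>\<^sub>M \<mu>" for t
    proof (rule characteristic_function_unique)
      show "prob_space (distr (\<mu> \<Otimes>\<^sub>M \<mu>) (\<mu> \<Otimes>\<^sub>M \<mu>) (rot t))" by (rule PP.prob_space_distr[OF rotm])
      show "prob_space (\<mu> \<Otimes>\<^sub>M \<mu>)" by unfold_locales
      fix w :: "'b \<times> 'b"
      obtain u v where w: "w = (u, v)" by (cases w)
      have "(\<integral>z. cis (w \<bullet> z) \<partial>distr (\<mu> \<Otimes>\<^sub>M \<mu>) (\<mu> \<Otimes>\<^sub>M \<mu>) (rot t)) = (\<integral>z. cis (w \<bullet> rot t z) \<partial>(\<mu> \<Otimes>\<^sub>M \<mu>))"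
        using cism[of w] by (subst integral_distr[OF rotm]) (auto simp: measurable_cong_sets[OF sets_pair refl])
      \<comment> \<open>The rotation is moved to the frequency through its adjoint, the rotation by
        -t.\<close>
      also have "\<dots> = (\<integral>z. cis ((cos t *\<^sub>R u - sin t *\<^sub>R v, sin t *\<^sub>R u + cos t *\<^sub>R v) \<bullet> z) \<partial>(\<mu> \<Otimes>\<^sub>M \<mu>))"
        by (intro Bochner_Integration.integral_cong) (auto simp: w rot_def inner_prod_def inner_simps algebra_simps)
      finally show "(\<integral>z. cis (w \<bullet> z) \<partial>distr (\<mu> \<Otimes>\<^sub>M \<mu>) (\<mu> \<Otimes>\<^sub>M \<mu>) (rot t)) = (\<integral>z. cis (w \<bullet> z) \<partial>(\<mu> \<Otimes>\<^sub>M \<mu>))"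
        by (simp only: char2 Q_rot w)
    qed (simp_all add: sets_pair)
  qed
  then show "rotation_invariant (distr M borel Y)" by (simp add: \<mu>_def)
qed

section \<open>Traces of power series\<close>

text \<open>The majorants \<open>c\<close> are kept apart from \<open>r\<close> because the
  coefficients will be \<open>Re (b k)\<close> while the bounds involve \<open>cmod (b k)\<close>.
  The Hessian is obtained by differentiating the explicit gradient; its direction supplies the
  Frobenius norm, so that sqrt n occurs only with \<open>\<kappa>1\<close>.\<close>

lemma trace_polynomial_normal_approximation:
  fixes \<mu> :: "(real^'n^'n) measure" and r c :: "nat \<Rightarrow> real" and K :: nat
  defines "g \<equiv> \<lambda>A :: real^'n^'n. \<Sum>k\<le>K. r k * trace (matrix_pow A k)"
  defines "m \<equiv> (\<integral>x. g x \<partial>\<mu>)" and "v \<equiv> (\<integral>x. (g x)\<^sup>2 \<partial>\<mu>) - (\<integral>x. g x \<partial>\<mu>)\<^sup>2"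
  assumes \<mu>: "rotation_invariant \<mu>"
    and s: "\<And>u. u \<bullet> rotation_invariant.cov_op \<mu> u \<le> s * (norm u)\<^sup>2" "0 < s"
    and rc: "\<And>k. \<bar>r k\<bar> \<le> c k"
    and \<kappa>1: "(\<integral>A. (\<Sum>k\<le>K. real k * c k * matrix_onorm A ^ (k - 1)) ^ 4 \<partial>\<mu>) \<le> \<kappa>1 ^ 4" "0 < \<kappa>1"
    and \<kappa>2: "(\<integral>A. (\<Sum>k\<le>K. real k * (real k - 1) * c k * matrix_onorm A ^ (k - 2)) ^ 4 \<partial>\<mu>) \<le> \<kappa>2 ^ 4" "0 < \<kappa>2"
    and v: "0 < v"
    and h: "continuous_on UNIV h" "\<And>x. 0 \<le> h x" "\<And>x. h x \<le> 1"
  shows "\<bar>(\<integral>x. h ((g x - m) / sqrt v) \<partial>\<mu>) - (\<integral>x. h x \<partial>std_normal_distribution)\<bar>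
      \<le> 4 * s * sqrt s * (sqrt (real CARD('n)) * \<kappa>1) * \<kappa>2 / v"
proof -
  interpret rotation_invariant \<mu> by (rule \<mu>)
  let ?n = "real CARD('n)"
  define G where "G A = (\<Sum>k\<le>K. (r k * real k) *\<^sub>R transpose (matrix_pow A (k - 1)))" for A :: "real^'n^'n"
  define DG where "DG A B = (\<Sum>k\<le>K. (r k * real k) *\<^sub>R transpose (matrix_pow_deriv A (k - 1) B))" for A B :: "real^'n^'n"
  define k1 where "k1 A = sqrt ?n * (\<Sum>k\<le>K. real k * c k * matrix_onorm A ^ (k - 1))" for A :: "real^'n^'n"
  define k2 where "k2 A = (\<Sum>k\<le>K. real k * (real k - 1) * c k * matrix_onorm A ^ (k - 2))" for A :: "real^'n^'n"
  have c: "0 \<le> c k" for k using rc[of k] by linarith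
  have kk: "0 \<le> real k * (real k - 1)" for k by (cases k) auto
  show ?thesis
    unfolding m_def v_def
  proof (rule second_order_poincare_normal_approximation[OF s, where G=G and DG=DG and ?k1.0=k1 and ?k2.0=k2])
    show "(g has_derivative (\<lambda>B. G A \<bullet> B)) (at A)" for A
    proof -
      have "((\<lambda>A. \<Sum>k\<le>K. r k * trace (matrix_pow A k)) has_derivative
          (\<lambda>B. \<Sum>k\<le>K. r k * trace (matrix_pow_deriv A k B))) (at A)"
        by (intro has_derivative_sum has_derivative_mult_right bounded_linear.has_derivative[OF bounded_linear_trace]
            has_derivative_matrix_pow)
      then show ?thesis
        unfolding g_def by (simp add: G_def inner_sum_left trace_matrix_pow_deriv mult.assoc)
    qed
    show "tame g"
      unfolding g_def by (intro tame_intros tame_linear_comp[OF bounded_linear_trace] tame_matrix_pow)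
    show "(G has_derivative DG A) (at A)" for A
      unfolding G_def[abs_def] DG_def[abs_def]
      by (intro has_derivative_sum has_derivative_scaleR_right bounded_linear.has_derivative[OF bounded_linear_transpose]
            has_derivative_matrix_pow)
    show "tame G"
      unfolding G_def[abs_def] by (intro tame_intros tame_linear_comp[OF bounded_linear_transpose] tame_matrix_pow)
    show "tame (\<lambda>p. DG (fst p) (snd p))"
      unfolding DG_def by (intro tame_intros tame_linear_comp[OF bounded_linear_transpose] tame_matrix_pow_deriv)
    show "norm (G A) \<le> k1 A" for A
    proof -
      have "norm (G A) \<le> (\<Sum>k\<le>K. (c k * real k) * (sqrt ?n * matrix_onorm A ^ (k - 1)))"
        unfolding G_def
        by (intro sum_norm_le) (auto simp: norm_transpose abs_mult intro!: mult_mono mult_right_mono mult_nonneg_nonneg rc norm_matrix_pow_le c)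
      then show ?thesis by (simp add: k1_def sum_distrib_left ac_simps)
    qed
    show "norm (DG A B) \<le> k2 A * norm B" for A B
    proof -
      have "norm (DG A B) \<le> (\<Sum>k\<le>K. (c k * real k) * (real (k - 1) * matrix_onorm A ^ (k - 1 - 1) * norm B))"
        unfolding DG_def
      proof (rule sum_norm_le)
        fix k
        have "norm ((r k * real k) *\<^sub>R transpose (matrix_pow_deriv A (k - 1) B)) = \<bar>r k\<bar> * real k * norm (matrix_pow_deriv A (k - 1) B)"
          by (simp add: norm_transpose abs_mult)
        also have "\<dots> \<le> (c k * real k) * (real (k - 1) * matrix_onorm A ^ (k - 1 - 1) * norm B)"
          by (intro mult_mono mult_right_mono rc norm_matrix_pow_deriv_le mult_nonneg_nonneg c) auto
        finally show "norm ((r k * real k) *\<^sub>R transpose (matrix_pow_deriv A (k - 1) B))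
            \<le> (c k * real k) * (real (k - 1) * matrix_onorm A ^ (k - 1 - 1) * norm B)" .
      qed
      also have "\<dots> = k2 A * norm B"
        unfolding k2_def sum_distrib_right
      proof (rule sum.cong)
        fix k
        \<comment> \<open>Truncated and real subtraction differ only for k = 0, where the factor
          \<open>real k\<close> vanishes; for k = 1 the second factor does.\<close>
        show "(c k * real k) * (real (k - 1) * matrix_onorm A ^ (k - 1 - 1) * norm B)
            = real k * (real k - 1) * c k * matrix_onorm A ^ (k - 2) * norm B"
          by (cases k) (auto simp: numeral_2_eq_2)
      qed simp
      finally show ?thesis .
    qed
    show "0 \<le> k2 A" for A
      unfolding k2_def by (intro sum_nonneg mult_nonneg_nonneg kk c zero_le_power matrix_onorm_nonneg)
    show "tame k1" "tame k2"
      unfolding k1_def[abs_def] k2_def[abs_def] by (intro tame_intros tame_matrix_onorm)+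
    show "(\<integral>x. k1 x ^ 4 \<partial>\<mu>) \<le> (sqrt ?n * \<kappa>1) ^ 4"
      using mult_left_mono[OF \<kappa>1(1), of "sqrt ?n ^ 4"] by (simp add: k1_def power_mult_distrib)
    show "(\<integral>x. k2 x ^ 4 \<partial>\<mu>) \<le> \<kappa>2 ^ 4" using \<kappa>2(1) by (simp add: k2_def)
    show "0 < (\<integral>x. (g x)\<^sup>2 \<partial>\<mu>) - (\<integral>x. g x \<partial>\<mu>)\<^sup>2" using v by (simp add: v_def)
  qed (use \<kappa>1 \<kappa>2 h in auto)
qed

section \<open>Convergence and truncation of the power series\<close>

lemma summable_norm_entire:
  fixes b :: "nat \<Rightarrow> complex"
  assumes "\<And>z. summable (\<lambda>k. b k * z ^ k)"
  shows "summable (\<lambda>k. cmod (b k) * x ^ k)"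
proof -
  have "norm (of_real x :: complex) < norm (of_real (\<bar>x\<bar> + 1) :: complex)"
    unfolding norm_of_real by simp
  from powser_insidea[OF assms this] have "summable (\<lambda>k. norm (cmod (b k) * x ^ k))"
    by (simp add: norm_mult norm_power abs_mult power_abs)
  then show ?thesis by (rule summable_norm_cancel)
qed

lemma summable_abs_series_d1:
  assumes "\<And>z. summable (\<lambda>k. b k * z ^ k)"
  shows "summable (\<lambda>k. real k * cmod (b k) * x ^ (k - 1))"
  using termdiff_converges_all[of "\<lambda>k. cmod (b k)" x] summable_norm_entire[OF assms]
  by (subst summable_Suc_iff[symmetric]) (simp add: diffs_def)

lemma summable_abs_series_d2:
  assumes "\<And>z. summable (\<lambda>k. b k * z ^ k)"
  shows "summable (\<lambda>k. real k * (real k - 1) * cmod (b k) * x ^ (k - 2))"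
proof -
  let ?f = "\<lambda>k. real k * (real k - 1) * cmod (b k) * x ^ (k - 2)"
  have "summable (\<lambda>k. diffs (diffs (\<lambda>k. cmod (b k))) k * x ^ k)"
    by (intro termdiff_converges_all summable_norm_entire[OF assms])
  moreover have "diffs (diffs (\<lambda>k. cmod (b k))) k * x ^ k = ?f (Suc (Suc k))" for k
    by (simp add: diffs_def)
  ultimately have "summable (\<lambda>k. ?f (Suc (Suc k)))" by (simp only:)
  then show ?thesis using summable_Suc_iff[of ?f] summable_Suc_iff[of "\<lambda>k. ?f (Suc k)"] by blast
qed

lemma partial_abs_series_d1_le:
  assumes "\<And>z. summable (\<lambda>k. b k * z ^ k)" "0 \<le> x"
  shows "(\<Sum>k\<le>K. real k * cmod (b k) * x ^ (k - 1)) \<le> abs_series_d1 b x"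
  unfolding abs_series_d1_def
  using assms(2) by (intro sum_le_suminf summable_abs_series_d1 assms) auto

lemma partial_abs_series_d2_le:
  assumes "\<And>z. summable (\<lambda>k. b k * z ^ k)" "0 \<le> x"
  shows "(\<Sum>k\<le>K. real k * (real k - 1) * cmod (b k) * x ^ (k - 2)) \<le> abs_series_d2 b x"
proof -
  have "0 \<le> real k * (real k - 1)" for k by (cases k) auto
  then show ?thesis
    unfolding abs_series_d2_def
    using assms(2) by (intro sum_le_suminf summable_abs_series_d2 assms) auto
qed

lemma matrix_pow_complex_matrix_entry:
  "matrix_pow (complex_matrix A) k $ i $ j = complex_of_real (matrix_pow A k $ i $ j)"
  unfolding matrix_pow_complex_matrix by (simp add: complex_matrix_def)

text \<open>The matrix is real, so its powers have real traces and only the real parts of the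
  coefficients survive. Entrywise convergence holds because the entries of the k-th power are
  bounded by the k-th power of the operator norm.\<close>

lemma trace_matrix_power_series_sums:
  fixes A :: "real^'n^'n"
  assumes b: "\<And>z. summable (\<lambda>k. b k * z ^ k)"
  shows "(\<lambda>k. Re (b k) * trace (matrix_pow A k)) sums Re (trace (matrix_power_series b (complex_matrix A)))"
proof -
  have entry: "summable (\<lambda>k. b k * matrix_pow (complex_matrix A) k $ i $ j)" for i j
  proof (rule summable_comparison_test'[OF summable_norm_entire[OF b, of "matrix_onorm A"], of 0])
    fix k
    show "norm (b k * matrix_pow (complex_matrix A) k $ i $ j) \<le> cmod (b k) * matrix_onorm A ^ k"
      using abs_matrix_pow_entry_le[of A k i j]
      by (simp add: norm_mult matrix_pow_complex_matrix_entry mult_left_mono)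
  qed
  have "(\<lambda>k. \<Sum>i\<in>UNIV. b k * matrix_pow (complex_matrix A) k $ i $ i) sums (\<Sum>i\<in>UNIV. \<Sum>k. b k * matrix_pow (complex_matrix A) k $ i $ i)"
    by (intro sums_sum summable_sums entry)
  also have "(\<lambda>k. \<Sum>i\<in>UNIV. b k * matrix_pow (complex_matrix A) k $ i $ i) = (\<lambda>k. b k * complex_of_real (trace (matrix_pow A k)))"
    by (simp add: matrix_pow_complex_matrix_entry trace_def sum_distrib_left)
  also have "(\<Sum>i\<in>UNIV. \<Sum>k. b k * matrix_pow (complex_matrix A) k $ i $ i) = trace (matrix_power_series b (complex_matrix A))"
    by (simp add: matrix_power_series_def trace_def)
  finally show ?thesis by (auto dest: sums_Re)
qed

text \<open>For k \<ge> 1 the factor k only enlarges a term, which bounds the truncated trace by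
  \<lambda> f1(\<lambda>), uniformly in \<open>K\<close>. The constant term is split off because f1
  does not see it. This provides the dominating function for the limit.\<close>

lemma abs_partial_trace_le:
  fixes A :: "real^'n^'n"
  assumes b: "\<And>z. summable (\<lambda>k. b k * z ^ k)"
  shows "\<bar>(\<Sum>k\<le>K. Re (b k) * trace (matrix_pow A k)) - Re (b 0) * real CARD('n)\<bar>
    \<le> real CARD('n) * (matrix_onorm A * abs_series_d1 b (matrix_onorm A))"
proof -
  let ?l = "matrix_onorm A"
  have l: "0 \<le> ?l" by (rule matrix_onorm_nonneg)
  have "(\<Sum>k\<le>K. Re (b k) * trace (matrix_pow A k)) = (\<Sum>k\<in>insert 0 {1..K}. Re (b k) * trace (matrix_pow A k))"
    by (rule sum.cong) auto
  then have "(\<Sum>k\<le>K. Re (b k) * trace (matrix_pow A k)) - Re (b 0) * real CARD('n) = (\<Sum>k\<in>{1..K}. Re (b k) * trace (matrix_pow A k))"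
    by (simp add: trace_I)
  also have "\<bar>\<dots>\<bar> \<le> (\<Sum>k\<in>{1..K}. real CARD('n) * (?l * (real k * cmod (b k) * ?l ^ (k - 1))))"
  proof (rule order_trans[OF sum_abs sum_mono])
    fix k assume k: "k \<in> {1..K}"
    have "\<bar>Re (b k) * trace (matrix_pow A k)\<bar> \<le> cmod (b k) * (real CARD('n) * ?l ^ k)"
      unfolding abs_mult by (intro mult_mono abs_Re_le_cmod abs_trace_matrix_pow_le) auto
    also have "\<dots> \<le> real k * (cmod (b k) * (real CARD('n) * ?l ^ k))"
      using k l mult_right_mono[of 1 "real k" "cmod (b k) * (real CARD('n) * ?l ^ k)"] by auto
    also have "?l ^ k = ?l * ?l ^ (k - 1)" using k by (cases k) auto
    finally show "\<bar>Re (b k) * trace (matrix_pow A k)\<bar> \<le> real CARD('n) * (?l * (real k * cmod (b k) * ?l ^ (k - 1)))"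
      by (simp add: ac_simps)
  qed
  also have "\<dots> = real CARD('n) * (?l * (\<Sum>k\<in>{1..K}. real k * cmod (b k) * ?l ^ (k - 1)))"
    by (simp add: sum_distrib_left)
  also have "(\<Sum>k\<in>{1..K}. real k * cmod (b k) * ?l ^ (k - 1)) \<le> (\<Sum>k\<le>K. real k * cmod (b k) * ?l ^ (k - 1))"
    using l by (intro sum_mono2) auto
  also have "\<dots> \<le> abs_series_d1 b ?l" by (rule partial_abs_series_d1_le[OF b l])
  finally show ?thesis using l by (simp add: mult_left_mono)
qed

text \<open>Passing to the limit in the truncations also shows that the trace is the constant
  Re(b_0) n wherever f1(\<lambda>) = 0. This is used to exclude that f1(\<lambda>) vanishes almost
  surely when the variance is positive.\<close>

lemma abs_trace_power_series_le:
  fixes A :: "real^'n^'n"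
  assumes b: "\<And>z. summable (\<lambda>k. b k * z ^ k)"
  shows "\<bar>Re (trace (matrix_power_series b (complex_matrix A))) - Re (b 0) * real CARD('n)\<bar>
    \<le> real CARD('n) * (matrix_onorm A * abs_series_d1 b (matrix_onorm A))"
proof (rule LIMSEQ_le_const2)
  show "(\<lambda>K. \<bar>(\<Sum>k\<le>K. Re (b k) * trace (matrix_pow A k)) - Re (b 0) * real CARD('n)\<bar>)
      \<longlonglongrightarrow> \<bar>Re (trace (matrix_power_series b (complex_matrix A))) - Re (b 0) * real CARD('n)\<bar>"
    using trace_matrix_power_series_sums[OF b, of A] by (intro tendsto_intros) (simp add: sums_def_le)
qed (use abs_partial_trace_le[OF b] in auto)

lemma power_series_trace_normal_approximation:
  fixes \<mu> :: "(real^'n^'n) measure" and b :: "nat \<Rightarrow> complex"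
  defines "g \<equiv> \<lambda>A :: real^'n^'n. Re (trace (matrix_power_series b (complex_matrix A)))"
  defines "m \<equiv> (\<integral>x. g x \<partial>\<mu>)" and "v \<equiv> (\<integral>x. (g x)\<^sup>2 \<partial>\<mu>) - (\<integral>x. g x \<partial>\<mu>)\<^sup>2"
  assumes b: "\<And>z. summable (\<lambda>k. b k * z ^ k)"
    and \<mu>: "rotation_invariant \<mu>"
    and s: "\<And>u. u \<bullet> rotation_invariant.cov_op \<mu> u \<le> s * (norm u)\<^sup>2" "0 < s"
    and \<kappa>1: "integrable \<mu> (\<lambda>A. abs_series_d1 b (matrix_onorm A) ^ 4)"
      "(\<integral>A. abs_series_d1 b (matrix_onorm A) ^ 4 \<partial>\<mu>) \<le> \<kappa>1 ^ 4" "0 < \<kappa>1"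
    and \<kappa>2: "integrable \<mu> (\<lambda>A. abs_series_d2 b (matrix_onorm A) ^ 4)"
      "(\<integral>A. abs_series_d2 b (matrix_onorm A) ^ 4 \<partial>\<mu>) \<le> \<kappa>2 ^ 4" "0 < \<kappa>2"
    and v: "0 < v"
    and h: "continuous_on UNIV h" "\<And>x. 0 \<le> h x" "\<And>x. h x \<le> 1"
  shows "\<bar>(\<integral>x. h ((g x - m) / sqrt v) \<partial>\<mu>) - (\<integral>x. h x \<partial>std_normal_distribution)\<bar>
      \<le> 4 * s * sqrt s * (sqrt (real CARD('n)) * \<kappa>1) * \<kappa>2 / v"
proof -
  interpret rotation_invariant \<mu> by (rule \<mu>)
  let ?n = "real CARD('n)"
  define gK where "gK K A = (\<Sum>k\<le>K. Re (b k) * trace (matrix_pow A k))" for K and A :: "real^'n^'n"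
  define mK where "mK K = (\<integral>x. gK K x \<partial>\<mu>)" for K
  define vK where "vK K = (\<integral>x. (gK K x)\<^sup>2 \<partial>\<mu>) - (\<integral>x. gK K x \<partial>\<mu>)\<^sup>2" for K
  \<comment> \<open>A common majorant of all truncations, whose square is integrable by the fourth
    moment condition on f1.\<close>
  define w where "w A = ?n * (cmod (b 0) + matrix_onorm A * abs_series_d1 b (matrix_onorm A))" for A :: "real^'n^'n"
  have lim: "(\<lambda>K. gK K A) \<longlonglongrightarrow> g A" for A
    using trace_matrix_power_series_sums[OF b, of A] unfolding gK_def g_def sums_def_le .
  have gK_le: "\<bar>gK K A\<bar> \<le> w A" for K A
  proof -
    have "\<bar>Re (b 0) * ?n\<bar> \<le> cmod (b 0) * ?n" by (simp add: abs_mult abs_Re_le_cmod mult_right_mono)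
    then show ?thesis
      using abs_partial_trace_le[OF b, of A K] by (simp add: gK_def w_def algebra_simps)
  qed
  have tgK: "tame (gK K)" for K
    unfolding gK_def[abs_def] by (intro tame_intros tame_linear_comp[OF bounded_linear_trace] tame_matrix_pow)
  have gm: "g \<in> borel_measurable \<mu>"
    by (rule borel_measurable_LIMSEQ_metric[OF tame_measurable[OF tgK] lim])
  have om [measurable]: "matrix_onorm \<in> borel_measurable \<mu>" by (rule tame_measurable[OF tame_matrix_onorm])
  have d1m: "(\<lambda>A. abs_series_d1 b (matrix_onorm A)) \<in> borel_measurable \<mu>"
    unfolding abs_series_d1_def by measurable
  have wm: "w \<in> borel_measurable \<mu>" unfolding w_def[abs_def] using d1m by measurable
  have w2: "integrable \<mu> (\<lambda>A. (w A)\<^sup>2)"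
  proof (rule Bochner_Integration.integrable_bound)
    show "integrable \<mu> (\<lambda>A. ?n\<^sup>2 * (2 * (cmod (b 0))\<^sup>2 + matrix_onorm A ^ 4 + abs_series_d1 b (matrix_onorm A) ^ 4))"
      using \<kappa>1(1) integrable_tame[OF tame_power[OF tame_matrix_onorm], of 4] by simp
    show "AE A in \<mu>. norm ((w A)\<^sup>2) \<le> norm (?n\<^sup>2 * (2 * (cmod (b 0))\<^sup>2 + matrix_onorm A ^ 4 + abs_series_d1 b (matrix_onorm A) ^ 4))"
    proof (rule AE_I2)
      fix A
      \<comment> \<open>Separating \<lambda> from f1(\<lambda>) is what makes a fourth moment of
        f1(\<lambda>) sufficient, since \<lambda> has moments of all orders.\<close>
      have "(p + q * r)\<^sup>2 \<le> 2 * p\<^sup>2 + q ^ 4 + r ^ 4" for p q r :: real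
      proof -
        have "0 \<le> (p - q * r)\<^sup>2" "0 \<le> (q\<^sup>2 - r\<^sup>2)\<^sup>2" by simp_all
        then show ?thesis by (simp add: power2_eq_square power4_eq_xxxx algebra_simps)
      qed
      then have "(w A)\<^sup>2 \<le> ?n\<^sup>2 * (2 * (cmod (b 0))\<^sup>2 + matrix_onorm A ^ 4 + abs_series_d1 b (matrix_onorm A) ^ 4)"
        unfolding w_def power_mult_distrib by (intro mult_left_mono) auto
      then show "norm ((w A)\<^sup>2) \<le> norm (?n\<^sup>2 * (2 * (cmod (b 0))\<^sup>2 + matrix_onorm A ^ 4 + abs_series_d1 b (matrix_onorm A) ^ 4))"
        by simp
    qed
  qed (use wm in measurable)
  have w1: "integrable \<mu> w" using square_integrable_imp_integrable[OF wm w2] .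
  have mlim: "mK \<longlonglongrightarrow> m"
    unfolding mK_def[abs_def] m_def
    by (rule integral_dominated_convergence[OF gm tame_measurable[OF tgK] w1]) (use lim gK_le in auto)
  have sqlim: "(\<lambda>K. \<integral>x. (gK K x)\<^sup>2 \<partial>\<mu>) \<longlonglongrightarrow> (\<integral>x. (g x)\<^sup>2 \<partial>\<mu>)"
  proof (rule integral_dominated_convergence[OF _ _ w2])
    show "(\<lambda>x. (g x)\<^sup>2) \<in> borel_measurable \<mu>" using gm by measurable
    show "(\<lambda>x. (gK K x)\<^sup>2) \<in> borel_measurable \<mu>" for K by (intro tame_measurable tame_power tgK)
    show "AE x in \<mu>. (\<lambda>K. (gK K x)\<^sup>2) \<longlonglongrightarrow> (g x)\<^sup>2" by (intro AE_I2 tendsto_power lim)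
    show "AE x in \<mu>. norm ((gK K x)\<^sup>2) \<le> (w x)\<^sup>2" for K
      using power_mono[OF gK_le abs_ge_zero, where n=2] by simp
  qed
  have vlim: "vK \<longlonglongrightarrow> v"
    unfolding vK_def[abs_def] v_def using sqlim mlim unfolding mK_def[abs_def] m_def by (intro tendsto_intros)
  \<comment> \<open>Some truncations may have variance 0; the comparison of limits concerns large
    \<open>K\<close> only.\<close>
  have vpos: "eventually (\<lambda>K. 0 < vK K) sequentially" using order_tendstoD(1)[OF vlim v] .
  have hlim: "(\<lambda>K. \<integral>x. h ((gK K x - mK K) / sqrt (vK K)) \<partial>\<mu>) \<longlonglongrightarrow> (\<integral>x. h ((g x - m) / sqrt v) \<partial>\<mu>)"
  proof (rule integral_dominated_convergence[where w="\<lambda>_. 1"])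
    have hm: "h \<in> borel_measurable borel" using h(1) by (rule borel_measurable_continuous_onI)
    show "(\<lambda>x. h ((g x - m) / sqrt v)) \<in> borel_measurable \<mu>" using hm gm by measurable
    show "(\<lambda>x. h ((gK K x - mK K) / sqrt (vK K))) \<in> borel_measurable \<mu>" for K
      using hm tame_measurable[OF tgK, of K] by measurable
    show "AE x in \<mu>. (\<lambda>K. h ((gK K x - mK K) / sqrt (vK K))) \<longlonglongrightarrow> h ((g x - m) / sqrt v)"
    proof (rule AE_I2)
      fix x
      have "(\<lambda>K. (gK K x - mK K) / sqrt (vK K)) \<longlonglongrightarrow> (g x - m) / sqrt v"
        using v by (intro tendsto_intros lim mlim vlim) auto
      then show "(\<lambda>K. h ((gK K x - mK K) / sqrt (vK K))) \<longlonglongrightarrow> h ((g x - m) / sqrt v)"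
        using h(1) by (intro isCont_tendsto_compose[of _ h]) (auto simp: continuous_on_eq_continuous_at)
    qed
  qed (use h in auto)
  have d1_trunc: "(\<integral>A. (\<Sum>k\<le>K. real k * cmod (b k) * matrix_onorm A ^ (k - 1)) ^ 4 \<partial>\<mu>) \<le> \<kappa>1 ^ 4" for K
  proof (rule order_trans[OF integral_mono \<kappa>1(2)])
    show "integrable \<mu> (\<lambda>A. (\<Sum>k\<le>K. real k * cmod (b k) * matrix_onorm A ^ (k - 1)) ^ 4)"
      by (intro integrable_tame tame_intros tame_matrix_onorm)
    show "(\<Sum>k\<le>K. real k * cmod (b k) * matrix_onorm A ^ (k - 1)) ^ 4 \<le> abs_series_d1 b (matrix_onorm A) ^ 4" for A
      by (intro power_mono partial_abs_series_d1_le b matrix_onorm_nonneg sum_nonneg mult_nonneg_nonneg zero_le_power) auto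
  qed (rule \<kappa>1)
  have d2_trunc: "(\<integral>A. (\<Sum>k\<le>K. real k * (real k - 1) * cmod (b k) * matrix_onorm A ^ (k - 2)) ^ 4 \<partial>\<mu>) \<le> \<kappa>2 ^ 4" for K
  proof (rule order_trans[OF integral_mono \<kappa>2(2)])
    show "integrable \<mu> (\<lambda>A. (\<Sum>k\<le>K. real k * (real k - 1) * cmod (b k) * matrix_onorm A ^ (k - 2)) ^ 4)"
      by (intro integrable_tame tame_intros tame_matrix_onorm)
    have "0 \<le> real k * (real k - 1)" for k by (cases k) auto
    then show "(\<Sum>k\<le>K. real k * (real k - 1) * cmod (b k) * matrix_onorm A ^ (k - 2)) ^ 4 \<le> abs_series_d2 b (matrix_onorm A) ^ 4" for A
      by (intro power_mono partial_abs_series_d2_le b matrix_onorm_nonneg sum_nonneg mult_nonneg_nonneg[OF mult_nonneg_nonneg]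
          zero_le_power norm_ge_zero)
  qed (rule \<kappa>2)
  have rc: "\<bar>Re (b k)\<bar> \<le> cmod (b k)" for k by (rule abs_Re_le_cmod)
  show ?thesis
  proof (rule tendsto_le[OF trivial_limit_sequentially])
    show "(\<lambda>K. 4 * s * sqrt s * (sqrt ?n * \<kappa>1) * \<kappa>2 / vK K) \<longlonglongrightarrow> 4 * s * sqrt s * (sqrt ?n * \<kappa>1) * \<kappa>2 / v"
      using v by (intro tendsto_intros vlim) auto
    show "(\<lambda>K. \<bar>(\<integral>x. h ((gK K x - mK K) / sqrt (vK K)) \<partial>\<mu>) - (\<integral>x. h x \<partial>std_normal_distribution)\<bar>)
        \<longlonglongrightarrow> \<bar>(\<integral>x. h ((g x - m) / sqrt v) \<partial>\<mu>) - (\<integral>x. h x \<partial>std_normal_distribution)\<bar>"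
      by (intro tendsto_intros hlim)
    show "eventually (\<lambda>K. \<bar>(\<integral>x. h ((gK K x - mK K) / sqrt (vK K)) \<partial>\<mu>) - (\<integral>x. h x \<partial>std_normal_distribution)\<bar>
        \<le> 4 * s * sqrt s * (sqrt ?n * \<kappa>1) * \<kappa>2 / vK K) sequentially"
      using vpos
    proof eventually_elim
      case (elim K)
      show ?case
        using elim unfolding mK_def vK_def gK_def
        by (intro trace_polynomial_normal_approximation[OF \<mu> s rc d1_trunc \<kappa>1(3) d2_trunc \<kappa>2(3) _ h])
    qed
  qed
qed

section \<open>Total variation distance and fourth moments\<close>

lemma L4_norm_finite:
  assumes Y: "Y \<in> borel_measurable M" and fin: "L4_norm M Y \<noteq> \<infinity>"
  shows "integrable M (\<lambda>\<omega>. Y \<omega> ^ 4)" "integral\<^sup>L M (\<lambda>\<omega>. Y \<omega> ^ 4) = enn2real (L4_norm M Y) ^ 4"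
    "L4_norm M Y = ennreal (enn2real (L4_norm M Y))"
proof -
  let ?I = "\<integral>\<^sup>+ \<omega>. ennreal (Y \<omega> ^ 4) \<partial>M"
  have I: "?I \<noteq> \<infinity>" and L: "L4_norm M Y = ennreal (root 4 (enn2real ?I))"
    using fin unfolding L4_norm_def by (auto simp: Let_def split: if_splits)
  then show "integrable M (\<lambda>\<omega>. Y \<omega> ^ 4)"
    using Y by (intro integrableI_bounded) (auto simp: less_top)
  have "integral\<^sup>L M (\<lambda>\<omega>. Y \<omega> ^ 4) = enn2real ?I"
    using Y by (intro integral_eq_nn_integral) auto
  also have "\<dots> = root 4 (enn2real ?I) ^ 4" by simp
  finally show "integral\<^sup>L M (\<lambda>\<omega>. Y \<omega> ^ 4) = enn2real (L4_norm M Y) ^ 4" unfolding L by simp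
  show "L4_norm M Y = ennreal (enn2real (L4_norm M Y))" unfolding L by simp
qed

lemma L4_norm_eq_0_imp_AE:
  assumes Y: "Y \<in> borel_measurable M" and 0: "L4_norm M Y = 0"
  shows "AE \<omega> in M. Y \<omega> = 0"
proof -
  have int: "integrable M (\<lambda>\<omega>. Y \<omega> ^ 4)" "integral\<^sup>L M (\<lambda>\<omega>. Y \<omega> ^ 4) = 0"
    using L4_norm_finite[OF Y] 0 by auto
  then have "AE \<omega> in M. Y \<omega> ^ 4 = 0"
    using integral_nonneg_eq_0_iff_AE[OF int(1)] by simp
  then show ?thesis by eventually_elim simp
qed

lemma (in prob_space) L4_norm_AE_const_finite:
  assumes "AE \<omega> in M. Y \<omega> = c"
  shows "L4_norm M Y \<noteq> \<infinity>"
proof -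
  have "(\<integral>\<^sup>+ \<omega>. ennreal (Y \<omega> ^ 4) \<partial>M) = (\<integral>\<^sup>+ \<omega>. ennreal (c ^ 4) \<partial>M)"
    using assms by (intro nn_integral_cong_AE) auto
  then show ?thesis by (simp add: L4_norm_def emeasure_space_1)
qed

lemma tv_dist_le:
  assumes "prob_space M" "prob_space N" and W: "W \<in> borel_measurable M" and Z: "Z \<in> borel_measurable N"
    and h: "\<And>h :: real \<Rightarrow> real. continuous_on UNIV h \<Longrightarrow> (\<And>x. 0 \<le> h x) \<Longrightarrow> (\<And>x. h x \<le> 1)
        \<Longrightarrow> \<bar>(\<integral>\<omega>. h (W \<omega>) \<partial>M) - (\<integral>\<omega>. h (Z \<omega>) \<partial>N)\<bar> \<le> D"
  shows "tv_dist M W N Z \<le> D"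
  unfolding tv_dist_def
proof (rule cSUP_least)
  fix B :: "real set" assume B: "B \<in> sets borel"
  have "\<bar>measure (distr M borel W) B - measure (distr N borel Z) B\<bar> \<le> D"
  proof (rule measure_diff_le_continuous)
    show "prob_space (distr M borel W)" "prob_space (distr N borel Z)"
      using assms by (auto intro: prob_space.prob_space_distr)
    fix g :: "real \<Rightarrow> real" assume g: "continuous_on UNIV g" "\<And>x. 0 \<le> g x" "\<And>x. g x \<le> 1"
    have "g \<in> borel_measurable borel" using g(1) by (rule borel_measurable_continuous_onI)
    then show "integral\<^sup>L (distr M borel W) g - integral\<^sup>L (distr N borel Z) g \<le> D"
      using h[OF g] W Z by (simp add: integral_distr)
  qed (use B in auto)
  then show "\<bar>measure M (W -` B \<inter> space M) - measure N (Z -` B \<inter> space N)\<bar> \<le> D"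
    using B W Z by (simp add: measure_distr)
qed auto

lemma tv_dist_AE_const:
  assumes "prob_space M" "prob_space N" and W: "W \<in> borel_measurable M" and Z: "Z \<in> borel_measurable N"
    and "AE \<omega> in M. W \<omega> = c" "AE \<omega> in N. Z \<omega> = c"
  shows "tv_dist M W N Z \<le> 0"
proof (rule tv_dist_le)
  fix h :: "real \<Rightarrow> real" assume "continuous_on UNIV h"
  then have h: "h \<in> borel_measurable borel" by (rule borel_measurable_continuous_onI)
  have "(\<integral>\<omega>. h (W \<omega>) \<partial>M) = (\<integral>\<omega>. h c \<partial>M)" "(\<integral>\<omega>. h (Z \<omega>) \<partial>N) = (\<integral>\<omega>. h c \<partial>N)"
    using assms h by (intro integral_cong_AE; auto)+
  then show "\<bar>(\<integral>\<omega>. h (W \<omega>) \<partial>M) - (\<integral>\<omega>. h (Z \<omega>) \<partial>N)\<bar> \<le> 0"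
    using assms by (simp add: prob_space.prob_space)
qed (use assms in auto)

lemma (in prob_space) integral_normal_standardize:
  fixes h :: "real \<Rightarrow> real"
  assumes "0 < \<sigma>" "distributed M lborel Z (\<lambda>x. ennreal (normal_density m \<sigma> x))" "h \<in> borel_measurable borel"
  shows "(\<integral>\<omega>. h (Z \<omega>) \<partial>M) = (\<integral>x. h (m + \<sigma> * x) \<partial>std_normal_distribution)"
proof -
  note assms(3) [measurable]
  have D: "distributed M lborel (\<lambda>\<omega>. (Z \<omega> - m) / \<sigma>) std_normal_density"
    using assms normal_standard_normal_convert[OF assms(1), of Z m] by simp
  then have Zm: "(\<lambda>\<omega>. (Z \<omega> - m) / \<sigma>) \<in> M \<rightarrow>\<^sub>M lborel" by (rule distributed_measurable)
  have "(\<integral>x. h (m + \<sigma> * x) \<partial>std_normal_distribution) = (\<integral>x. h (m + \<sigma> * x) \<partial>distr M lborel (\<lambda>\<omega>. (Z \<omega> - m) / \<sigma>))"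
    using D by (simp add: distributed_def)
  also have "\<dots> = (\<integral>\<omega>. h (m + \<sigma> * ((Z \<omega> - m) / \<sigma>)) \<partial>M)"
    by (intro integral_distr[OF Zm]) measurable
  finally show ?thesis using assms(1) by simp
qed

lemma (in prob_space) integrable_square_if_power4:
  fixes W :: "'a \<Rightarrow> real"
  assumes W: "W \<in> borel_measurable M" "integrable M (\<lambda>\<omega>. W \<omega> ^ 4)"
  shows "integrable M (\<lambda>\<omega>. (W \<omega>)\<^sup>2)"
  using square_integrable_imp_integrable[of "\<lambda>\<omega>. (W \<omega>)\<^sup>2"] W by simp

lemma (in prob_space) AE_const_if_variance_0:
  fixes W :: "'a \<Rightarrow> real"
  assumes W: "W \<in> borel_measurable M" "integrable M (\<lambda>\<omega>. (W \<omega>)\<^sup>2)" and 0: "variance W = 0"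
  shows "AE \<omega> in M. W \<omega> = expectation W"
proof -
  have "integrable M W" using square_integrable_imp_integrable[OF W] .
  then have int: "integrable M (\<lambda>\<omega>. (W \<omega> - expectation W)\<^sup>2)"
    using W(2) by (simp add: power2_diff)
  have "AE \<omega> in M. (W \<omega> - expectation W)\<^sup>2 = 0"
    using 0 by (simp only: integral_nonneg_eq_0_iff_AE[OF int AE_I2[OF zero_le_power2]])
  then show ?thesis by eventually_elim simp
qed

lemma (in prob_space) AE_const_variance:
  fixes W :: "'a \<Rightarrow> real"
  assumes W: "W \<in> borel_measurable M" and c: "AE \<omega> in M. W \<omega> = c"
  shows "expectation W = c" "variance W = 0"
proof -
  have "expectation W = (\<integral>\<omega>. c \<partial>M)" using assms by (intro integral_cong_AE) auto
  then show E: "expectation W = c" by (simp add: prob_space)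
  have "variance W = (\<integral>\<omega>. 0 \<partial>M)" using assms E by (intro integral_cong_AE) auto
  then show "variance W = 0" by simp
qed

text \<open>All terms of f2 are nonnegative, so each vanishes, and for k \<ge> 2 the corresponding
  term of f1 is such a term up to a factor and one more power of x. This rules out b = 0 together
  with a infinite, where the extended product a b would be 0.\<close>

lemma abs_series_d2_eq_0_imp:
  assumes b: "\<And>z. summable (\<lambda>k. b k * z ^ k)" and x: "0 \<le> x" and 0: "abs_series_d2 b x = 0"
  shows "abs_series_d1 b x = cmod (b 1)"
proof -
  have nn: "0 \<le> real k * (real k - 1) * cmod (b k) * x ^ (k - 2)" for k
  proof -
    have "0 \<le> real k * (real k - 1)" by (cases k) auto
    then show ?thesis using x by (intro mult_nonneg_nonneg[OF mult_nonneg_nonneg]) auto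
  qed
  have z: "real k * (real k - 1) * cmod (b k) * x ^ (k - 2) = 0" for k
    using suminf_eq_zero_iff[OF summable_abs_series_d2[OF b] nn] 0 unfolding abs_series_d2_def by blast
  have "real k * cmod (b k) * x ^ (k - 1) = (if k = 1 then cmod (b 1) else 0)" for k
  proof (cases "k \<le> 1")
    case False
    then have "cmod (b k) * x ^ (k - 2) = 0" using z[of k] by simp
    moreover have "x ^ (k - 1) = x ^ (k - 2) * x" using False by (simp flip: power_Suc2 add: Suc_diff_Suc numeral_2_eq_2)
    ultimately show ?thesis using False by auto
  qed (cases k; auto)
  then show ?thesis unfolding abs_series_d1_def
    using suminf_finite[of "{1}" "\<lambda>k. real k * cmod (b k) * x ^ (k - 1)"] by auto
qed

theorem proposition4p4:
  fixes M :: "'w measure" and N :: "'v measure"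
    and X :: "'n::finite \<Rightarrow> 'n \<Rightarrow> 'w \<Rightarrow> real"
    and \<Sigma> :: "real^('n \<times> 'n)^('n \<times> 'n)"
    and A :: "'w \<Rightarrow> real^'n^'n"
    and f :: "complex \<Rightarrow> complex" and b :: "nat \<Rightarrow> complex"
    and \<Lambda> :: "'w \<Rightarrow> real" and \<alpha> \<beta> :: ennreal
    and W :: "'w \<Rightarrow> real" and Z :: "'v \<Rightarrow> real"
  assumes "prob_space M" and "prob_space N"
    and "jointly_gaussian M (\<lambda>(i, j). X i j)"
    and "\<And>i j. integral\<^sup>L M (X i j) = 0"
    and "\<Sigma> = (\<chi> p q. covariance M (X (fst p) (snd p)) (X (fst q) (snd q)))"
    and "A = (\<lambda>\<omega>. \<chi> i j. X i j \<omega> / sqrt (real CARD('n)))"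
    and "f holomorphic_on UNIV"
    and "\<And>z. (\<lambda>m. b m * z ^ m) sums f z"
    and "\<Lambda> = (\<lambda>\<omega>. matrix_onorm (A \<omega>))"
    and "\<alpha> = L4_norm M (\<lambda>\<omega>. abs_series_d1 b (\<Lambda> \<omega>))"
    and "\<beta> = L4_norm M (\<lambda>\<omega>. abs_series_d2 b (\<Lambda> \<omega>))"
    and "W = (\<lambda>\<omega>. Re (trace (matrix_power_series b (complex_matrix (A \<omega>)))))"
    and "integrable M (\<lambda>\<omega>. W \<omega> ^ 4)"
    and "gaussian_rv N Z"
    and "integral\<^sup>L N Z = integral\<^sup>L M W"
    and "prob_space.variance N Z = prob_space.variance M W"
  shows "ennreal (tv_dist M W N Z)
    \<le> ennreal (2 * sqrt 5 * matrix_onorm \<Sigma> powr (3/2)) * \<alpha> * \<beta>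
       / ennreal (prob_space.variance M W * real CARD('n))"
proof -
  interpret M: prob_space M by fact
  interpret N: prob_space N by fact
  let ?n = "real CARD('n)"
  have n: "0 < ?n" by simp
  note jg = assms(3) and mean = assms(4) and \<Sigma> = assms(5) and A = assms(6) and \<Lambda> = assms(9)
    and \<alpha> = assms(10) and \<beta> = assms(11) and W = assms(12) and W4 = assms(13) and Zg = assms(14)
  have b: "summable (\<lambda>k. b k * z ^ k)" for z using assms(8) by (rule sums_summable)
  have Zm: "Z \<in> borel_measurable N" using Zg by (simp add: gaussian_rv_def)

  have lin: "u \<bullet> A \<omega> = (\<Sum>p\<in>UNIV. (u $ fst p $ snd p / sqrt ?n) * (\<lambda>(i, j). X i j) p \<omega>)" for u \<omega>
    unfolding A inner_vec_def by (simp add: sum.cartesian_product case_prod_beta inner_vec_def flip: UNIV_Times_UNIV)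
  have Xg: "gaussian_rv M (X i j)" for i j
  proof -
    have "gaussian_rv M (\<lambda>\<omega>. \<Sum>p\<in>UNIV. (if p = (i, j) then 1 else 0) * (\<lambda>(i, j). X i j) p \<omega>)"
      by (rule jg[unfolded jointly_gaussian_def, rule_format])
    then show ?thesis by (simp add: if_distrib[of "\<lambda>x. x * _"] cong: if_cong)
  qed
  have Ag: "gaussian_rv M (\<lambda>\<omega>. u \<bullet> A \<omega>)" for u
    unfolding lin by (rule jg[unfolded jointly_gaussian_def, rule_format])
  have Xint: "integrable M (X i j)" for i j by (rule M.gaussian_rv_integrable(1)[OF Xg])
  have Amean: "(\<integral>\<omega>. u \<bullet> A \<omega> \<partial>M) = 0" for u
    unfolding lin using Xint mean by (simp add: case_prod_beta)
  define \<mu> where "\<mu> = distr M borel A"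
  have Am [measurable]: "A \<in> borel_measurable M" and rot: "rotation_invariant \<mu>"
    unfolding \<mu>_def using M.rotation_invariant_gaussian[OF Ag Amean] by blast+
  interpret rotation_invariant \<mu> by (rule rot)
  have int_mu: "integral\<^sup>L \<mu> F = (\<integral>\<omega>. F (A \<omega>) \<partial>M)" if "F \<in> borel_measurable borel" for F :: "_ \<Rightarrow> real"
    unfolding \<mu>_def using that by (simp add: integral_distr)

  \<comment> \<open>The scaling of the entries by 1 / sqrt n turns the quadratic form of the
    covariance operator into that of \<Sigma> / n. The vector \<open>u'\<close> is the matrix
    \<open>u\<close> read as a vector indexed by pairs, which preserves the Euclidean norm.\<close>
  have cov: "u \<bullet> cov_op u \<le> matrix_onorm \<Sigma> / ?n * (norm u)\<^sup>2" for u
  proof -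
    define u' where "u' = (\<chi> p. u $ fst p $ snd p)"
    have XX: "integrable M (\<lambda>\<omega>. X i j \<omega> * X k l \<omega>)" for i j k l
    proof (rule Bochner_Integration.integrable_bound)
      show "integrable M (\<lambda>\<omega>. (X i j \<omega>)\<^sup>2 + (X k l \<omega>)\<^sup>2)"
        using M.gaussian_rv_integrable(2)[OF Xg] by simp
      show "(\<lambda>\<omega>. X i j \<omega> * X k l \<omega>) \<in> borel_measurable M"
        using Xint by (intro borel_measurable_times) (auto dest: borel_measurable_integrable)
      show "AE \<omega> in M. norm (X i j \<omega> * X k l \<omega>) \<le> norm ((X i j \<omega>)\<^sup>2 + (X k l \<omega>)\<^sup>2)"
      proof (rule AE_I2)
        fix \<omega>
        have "\<bar>x * y\<bar> \<le> x\<^sup>2 + y\<^sup>2" for x y :: real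
          using sum_squares_bound[of "\<bar>x\<bar>" "\<bar>y\<bar>"] zero_le_power2[of x] zero_le_power2[of y]
          unfolding power2_abs abs_mult by linarith
        then show "norm (X i j \<omega> * X k l \<omega>) \<le> norm ((X i j \<omega>)\<^sup>2 + (X k l \<omega>)\<^sup>2)" by simp
      qed
    qed
    have "u \<bullet> cov_op u = (\<integral>\<omega>. (u \<bullet> A \<omega>) * (u \<bullet> A \<omega>) \<partial>M)"
      unfolding inner_cov_op by (rule int_mu) measurable
    also have "\<dots> = (\<integral>\<omega>. (\<Sum>p\<in>UNIV. \<Sum>q\<in>UNIV. (u' $ p * u' $ q / ?n) * (X (fst p) (snd p) \<omega> * X (fst q) (snd q) \<omega>)) \<partial>M)"
      unfolding lin sum_product u'_def
      by (intro Bochner_Integration.integral_cong sum.cong) (auto simp: case_prod_beta)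
    also have "\<dots> = (\<Sum>p\<in>UNIV. \<Sum>q\<in>UNIV. (u' $ p * u' $ q / ?n) * (\<integral>\<omega>. X (fst p) (snd p) \<omega> * X (fst q) (snd q) \<omega> \<partial>M))"
      using XX by simp
    also have "\<dots> = (u' \<bullet> (\<Sigma> *v u')) / ?n"
      unfolding \<Sigma> covariance_def mean inner_vec_def matrix_vector_mult_def
      by (simp add: sum_distrib_left sum_divide_distrib ac_simps)
    also have "\<dots> \<le> (norm u' * (matrix_onorm \<Sigma> * norm u')) / ?n"
      by (intro divide_right_mono order_trans[OF norm_cauchy_schwarz] mult_left_mono norm_matrix_vector_le) auto
    also have "\<dots> = matrix_onorm \<Sigma> / ?n * (norm u')\<^sup>2" by (simp add: power2_eq_square)
    also have "(norm u')\<^sup>2 = (norm u)\<^sup>2"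
      unfolding power2_norm_eq_inner u'_def
      by (simp add: inner_vec_def sum.cartesian_product case_prod_beta flip: UNIV_Times_UNIV)
    finally show ?thesis .
  qed

  define g where "g A = Re (trace (matrix_power_series b (complex_matrix A)))" for A :: "real^'n^'n"
  have gm [measurable]: "g \<in> borel_measurable borel"
  proof (rule borel_measurable_LIMSEQ_metric)
    show "(\<lambda>A. \<Sum>k\<le>K. Re (b k) * trace (matrix_pow A k)) \<in> borel_measurable borel" for K
      by (intro borel_measurable_continuous_onI tame_continuous tame_intros tame_linear_comp[OF bounded_linear_trace] tame_matrix_pow)
    show "(\<lambda>K. \<Sum>k\<le>K. Re (b k) * trace (matrix_pow A k)) \<longlonglongrightarrow> g A" for A
      using trace_matrix_power_series_sums[OF b, of A] unfolding g_def sums_def_le .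
  qed
  have Wg: "W = (\<lambda>\<omega>. g (A \<omega>))" unfolding W g_def ..
  have Wm: "W \<in> borel_measurable M" unfolding Wg by measurable
  have W2: "integrable M (\<lambda>\<omega>. (W \<omega>)\<^sup>2)" by (rule M.integrable_square_if_power4[OF Wm W4])
  have W1: "integrable M W" by (rule M.square_integrable_imp_integrable[OF Wm W2])
  have om [measurable]: "matrix_onorm \<in> borel_measurable (borel :: (real^'n^'n) measure)"
    by (intro borel_measurable_continuous_onI tame_continuous tame_matrix_onorm)
  have d1 [measurable]: "(\<lambda>A :: real^'n^'n. abs_series_d1 b (matrix_onorm A)) \<in> borel_measurable borel"
    unfolding abs_series_d1_def by measurable
  have d2 [measurable]: "(\<lambda>A :: real^'n^'n. abs_series_d2 b (matrix_onorm A)) \<in> borel_measurable borel"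
    unfolding abs_series_d2_def by measurable
  have d1m: "(\<lambda>\<omega>. abs_series_d1 b (\<Lambda> \<omega>)) \<in> borel_measurable M"
    and d2m: "(\<lambda>\<omega>. abs_series_d2 b (\<Lambda> \<omega>)) \<in> borel_measurable M"
    unfolding \<Lambda> by measurable
  have \<Lambda>0: "0 \<le> \<Lambda> \<omega>" for \<omega> unfolding \<Lambda> by (rule matrix_onorm_nonneg)
  define v where "v = M.variance W"

  show ?thesis
  \<comment> \<open>With variance 0 the right-hand side may be 0 / 0, which is 0 in
    \<open>ennreal\<close>, so the left-hand side must itself be shown to vanish: both variables are
    the same constant almost surely.\<close>
  proof (cases "v = 0")
    case True
    then have Wc: "AE \<omega> in M. W \<omega> = M.expectation W"
      using M.AE_const_if_variance_0[OF Wm W2] by (simp add: v_def)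
    from Zg have "AE \<omega> in N. Z \<omega> = M.expectation W"
    proof (cases rule: N.gaussian_rv_cases)
      case (normal m \<sigma>)
      then have "N.variance Z = \<sigma>\<^sup>2" by (rule N.normal_distributed_variance)
      then show ?thesis using True assms(16) normal(1) by (simp add: v_def)
    next
      case (const m)
      then show ?thesis using N.AE_const_variance(1)[OF Zm const] assms(15) by simp
    qed
    then have "tv_dist M W N Z \<le> 0"
      using tv_dist_AE_const[OF assms(1,2) Wm Zm Wc] by blast
    then show ?thesis by (simp add: ennreal_neg)
  next
    case False
    have v: "0 < v" using False by (simp add: v_def less_le)
    have veq: "v = (\<integral>x. (g x)\<^sup>2 \<partial>\<mu>) - (\<integral>x. g x \<partial>\<mu>)\<^sup>2"
      unfolding v_def M.variance_eq[OF W1 W2] by (simp add: int_mu Wg)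
    define m where "m = M.expectation W"
    have meq: "m = (\<integral>x. g x \<partial>\<mu>)" unfolding m_def Wg by (simp add: int_mu)
    have not_const: "\<not> (AE \<omega> in M. W \<omega> = c)" for c
      using M.AE_const_variance(2)[OF Wm] v unfolding v_def by fastforce
    \<comment> \<open>A vanishing covariance would make A zero almost surely and W constant.
      Positivity is needed for \<open>s\<close>, and also to keep the product with infinite a or b
      infinite.\<close>
    have \<Sigma>_pos: "0 < matrix_onorm \<Sigma>"
    proof (rule ccontr)
      assume "\<not> 0 < matrix_onorm \<Sigma>"
      then have \<Sigma>0: "matrix_onorm \<Sigma> = 0" using matrix_onorm_nonneg[of \<Sigma>] by simp
      have "AE \<omega> in M. u \<bullet> A \<omega> = 0" for u
      proof -
        have "(\<integral>\<omega>. (u \<bullet> A \<omega>)\<^sup>2 \<partial>M) = u \<bullet> cov_op u"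
          unfolding inner_cov_op power2_eq_square by (rule int_mu[symmetric]) measurable
        also have "\<dots> \<le> 0" using cov[of u] \<Sigma>0 by simp
        finally have "(\<integral>\<omega>. (u \<bullet> A \<omega>)\<^sup>2 \<partial>M) = 0" by (intro antisym Bochner_Integration.integral_nonneg) auto
        then have "AE \<omega> in M. (u \<bullet> A \<omega>)\<^sup>2 = 0"
          using integral_nonneg_eq_0_iff_AE[OF M.gaussian_rv_integrable(2)[OF Ag, of u]] by simp
        then show ?thesis by eventually_elim simp
      qed
      then have "AE \<omega> in M. \<forall>u\<in>Basis. u \<bullet> A \<omega> = 0" by (intro AE_finite_allI) auto
      then have "AE \<omega> in M. W \<omega> = g 0"
      proof eventually_elim
        case (elim \<omega>)
        then have "A \<omega> = 0" by (metis euclidean_eqI inner_commute inner_zero_left)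
        then show ?case by (simp add: Wg)
      qed
      then show False using not_const by blast
    qed
    define s where "s = matrix_onorm \<Sigma> / ?n"
    have s: "0 < s" using \<Sigma>_pos n by (simp add: s_def)

    from Zg have Zn: "distributed N lborel Z (\<lambda>x. ennreal (normal_density m (sqrt v) x))"
    proof (cases rule: N.gaussian_rv_cases)
      case (normal m' \<sigma>)
      have "m' = m" using N.normal_distributed_expectation[OF normal] assms(15) by (simp add: m_def)
      moreover have "\<sigma>\<^sup>2 = v" using N.normal_distributed_variance[OF normal] assms(16) by (simp add: v_def)
      then have "\<sigma> = sqrt v" using normal(1) by (simp add: real_sqrt_unique)
      ultimately show ?thesis using normal(2) by simp
    next
      case (const m)
      then show ?thesis using N.AE_const_variance(2)[OF Zm const] assms(16) v by (simp add: v_def)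
    qed

    \<comment> \<open>Strictly positive majorants take the place of a and b, because the
      approximation theorem divides by them and b is 0 for affine f.\<close>
    have bound: "tv_dist M W N Z \<le> 4 * s * sqrt s * (sqrt ?n * \<kappa>1) * \<kappa>2 / v"
      if fin: "\<alpha> \<noteq> \<infinity>" "\<beta> \<noteq> \<infinity>" and \<kappa>: "0 < \<kappa>1" "enn2real \<alpha> \<le> \<kappa>1" "0 < \<kappa>2" "enn2real \<beta> \<le> \<kappa>2" for \<kappa>1 \<kappa>2
    proof (rule tv_dist_le[OF assms(1,2) Wm Zm])
      fix h :: "real \<Rightarrow> real" assume h: "continuous_on UNIV h" "\<And>x. 0 \<le> h x" "\<And>x. h x \<le> 1"
      have hm [measurable]: "h \<in> borel_measurable borel" using h(1) by (rule borel_measurable_continuous_onI)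
      \<comment> \<open>The test function is transported to the standardized scale, so that the
        bound for it compares \<open>h\<close> of W with \<open>h\<close> of Z.\<close>
      let ?h = "\<lambda>x. h (m + sqrt v * x)"
      have hc: "continuous_on UNIV ?h"
        by (rule continuous_on_compose2[OF h(1)]) (auto intro!: continuous_intros)
      have i1: "integrable \<mu> (\<lambda>A. abs_series_d1 b (matrix_onorm A) ^ 4)" "integrable \<mu> (\<lambda>A. abs_series_d2 b (matrix_onorm A) ^ 4)"
        using L4_norm_finite(1)[OF d1m] L4_norm_finite(1)[OF d2m] fin
        unfolding \<alpha> \<beta> \<mu>_def \<Lambda> by (auto simp: integrable_distr_eq)
      have i2: "(\<integral>A. abs_series_d1 b (matrix_onorm A) ^ 4 \<partial>\<mu>) = enn2real \<alpha> ^ 4"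
        "(\<integral>A. abs_series_d2 b (matrix_onorm A) ^ 4 \<partial>\<mu>) = enn2real \<beta> ^ 4"
        using L4_norm_finite(2)[OF d1m] L4_norm_finite(2)[OF d2m] fin
        unfolding \<alpha> \<beta> \<Lambda> by (simp_all add: int_mu)
      have "\<bar>(\<integral>x. ?h ((g x - m) / sqrt v) \<partial>\<mu>) - (\<integral>x. ?h x \<partial>std_normal_distribution)\<bar>
          \<le> 4 * s * sqrt s * (sqrt ?n * \<kappa>1) * \<kappa>2 / v"
        unfolding meq veq g_def
      proof (rule power_series_trace_normal_approximation[OF b rot])
        show "u \<bullet> cov_op u \<le> s * (norm u)\<^sup>2" for u using cov[of u] by (simp add: s_def)
        show "(\<integral>A. abs_series_d1 b (matrix_onorm A) ^ 4 \<partial>\<mu>) \<le> \<kappa>1 ^ 4"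
          "(\<integral>A. abs_series_d2 b (matrix_onorm A) ^ 4 \<partial>\<mu>) \<le> \<kappa>2 ^ 4"
          unfolding i2 using \<kappa> by (auto intro!: power_mono)
        show "0 < (\<integral>x. (Re (trace (matrix_power_series b (complex_matrix x))))\<^sup>2 \<partial>\<mu>)
            - (\<integral>x. Re (trace (matrix_power_series b (complex_matrix x))) \<partial>\<mu>)\<^sup>2"
          using v unfolding veq g_def .
        show "continuous_on UNIV (\<lambda>x. h ((\<integral>x. Re (trace (matrix_power_series b (complex_matrix x))) \<partial>\<mu>)
           + sqrt ((\<integral>x. (Re (trace (matrix_power_series b (complex_matrix x))))\<^sup>2 \<partial>\<mu>)
            - (\<integral>x. Re (trace (matrix_power_series b (complex_matrix x))) \<partial>\<mu>)\<^sup>2) * x))"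
          using hc unfolding meq veq g_def .
      qed (use i1 s \<kappa> h in auto)
      also have "(\<integral>x. ?h ((g x - m) / sqrt v) \<partial>\<mu>) = (\<integral>\<omega>. h (W \<omega>) \<partial>M)"
        using v by (simp add: int_mu Wg)
      also have "(\<integral>x. ?h x \<partial>std_normal_distribution) = (\<integral>\<omega>. h (Z \<omega>) \<partial>N)"
        using v by (intro N.integral_normal_standardize[symmetric] Zn hm) auto
      finally show "\<bar>(\<integral>\<omega>. h (W \<omega>) \<partial>M) - (\<integral>\<omega>. h (Z \<omega>) \<partial>N)\<bar> \<le> 4 * s * sqrt s * (sqrt ?n * \<kappa>1) * \<kappa>2 / v" .
    qed

    \<comment> \<open>Without this, a = 0 and b infinite would make the right-hand side 0. If a were
      0, then W would be constant almost surely, against the positive variance.\<close>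
    have \<alpha>0: "\<alpha> \<noteq> 0"
    proof
      assume "\<alpha> = 0"
      then have "AE \<omega> in M. abs_series_d1 b (\<Lambda> \<omega>) = 0" using L4_norm_eq_0_imp_AE[OF d1m] by (simp add: \<alpha>)
      then have "AE \<omega> in M. W \<omega> = Re (b 0) * ?n"
      proof eventually_elim
        case (elim \<omega>)
        then show ?case using abs_trace_power_series_le[OF b, of "A \<omega>"] by (simp add: W \<Lambda>)
      qed
      then show False using not_const by blast
    qed
    \<comment> \<open>The other indefinite product: if f2(\<lambda>) vanishes almost surely, then
      f1(\<lambda>) is the constant |b_1| and has a finite fourth moment.\<close>
    have \<beta>0: "\<alpha> \<noteq> \<infinity>" if "\<beta> = 0"
    proof -
      have "AE \<omega> in M. abs_series_d2 b (\<Lambda> \<omega>) = 0" using L4_norm_eq_0_imp_AE[OF d2m] that by (simp add: \<beta>)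
      then have "AE \<omega> in M. abs_series_d1 b (\<Lambda> \<omega>) = cmod (b 1)"
        by eventually_elim (rule abs_series_d2_eq_0_imp[OF b \<Lambda>0])
      then show ?thesis unfolding \<alpha> by (rule M.L4_norm_AE_const_finite)
    qed
    let ?c = "2 * sqrt 5 * matrix_onorm \<Sigma> powr (3/2)"
    have c: "0 < ?c" using \<Sigma>_pos by simp
    show ?thesis
    proof (cases "\<alpha> = \<infinity> \<or> \<beta> = \<infinity>")
      case True
      then have "ennreal ?c * \<alpha> * \<beta> = \<infinity>"
        using \<alpha>0 \<beta>0 c by (auto simp: ennreal_mult_eq_top_iff ennreal_mult_top ennreal_top_mult)
      then show ?thesis using v n by (simp add: v_def[symmetric] ennreal_top_divide)
    next
      case False
      define a' b' where "a' = enn2real \<alpha>" and "b' = enn2real \<beta>"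
      have ab: "\<alpha> = ennreal a'" "\<beta> = ennreal b'" "0 \<le> a'" "0 \<le> b'"
        using False by (auto simp: a'_def b'_def less_top)
      have "tv_dist M W N Z \<le> 4 * s * sqrt s * (sqrt ?n * a') * b' / v"
      \<comment> \<open>Positive majorants a + e and b + e are inserted and e is sent to 0, which
        covers b = 0.\<close>
      proof (rule tendsto_lowerbound)
        show "((\<lambda>e. 4 * s * sqrt s * (sqrt ?n * (a' + e)) * (b' + e) / v) \<longlongrightarrow> 4 * s * sqrt s * (sqrt ?n * a') * b' / v) (at_right 0)"
          using v by (auto intro!: tendsto_eq_intros)
        show "eventually (\<lambda>e. tv_dist M W N Z \<le> 4 * s * sqrt s * (sqrt ?n * (a' + e)) * (b' + e) / v) (at_right 0)"
          using eventually_at_right_less[of 0]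
        proof eventually_elim
          case (elim e)
          show ?case
            by (rule bound) (use elim False ab(3,4) in \<open>auto simp flip: a'_def b'_def\<close>)
        qed
      qed simp
      also have "\<dots> \<le> ?c * a' * b' / (v * ?n)"
      proof -
        have "s * sqrt s * sqrt ?n = matrix_onorm \<Sigma> * sqrt (matrix_onorm \<Sigma>) / ?n"
          using n by (simp add: s_def real_sqrt_divide)
        also have "matrix_onorm \<Sigma> * sqrt (matrix_onorm \<Sigma>) = matrix_onorm \<Sigma> powr (3/2)"
          using \<Sigma>_pos powr_add[of "matrix_onorm \<Sigma>" 1 "1/2"] by (simp add: powr_half_sqrt)
        finally have k: "s * sqrt s * sqrt ?n = matrix_onorm \<Sigma> powr (3/2) / ?n" .
        have "4 * s * sqrt s * (sqrt ?n * a') * b' / v = 4 * ((s * sqrt s * sqrt ?n) * a' * b' / v)"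
          by (simp only: ac_simps times_divide_eq_right)
        also have "\<dots> = 4 * (matrix_onorm \<Sigma> powr (3/2) / ?n * a' * b' / v)"
          by (simp only: k)
        also have "\<dots> \<le> (2 * sqrt 5) * (matrix_onorm \<Sigma> powr (3/2) / ?n * a' * b' / v)"
        proof (rule mult_right_mono)
          have "2 \<le> sqrt (5 :: real)" by (rule real_le_rsqrt) simp
          then show "4 \<le> 2 * sqrt 5" by simp
        qed (use v n ab in auto)
        finally show ?thesis by (simp add: ac_simps)
      qed
      finally have "ennreal (tv_dist M W N Z) \<le> ennreal (?c * a' * b' / (v * ?n))" by (rule ennreal_leI)
      also have "\<dots> = ennreal ?c * \<alpha> * \<beta> / ennreal (v * ?n)"
        using v n ab c by (simp add: divide_ennreal[symmetric] ennreal_mult)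
      finally show ?thesis by (simp add: v_def)
    qed
  qed
qed

end
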